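(* Let $n\ge2$, $N\ge1$ be integers, $s\in(0,1)$, $\Lambda\ge1$, and let $k\ge0$ be an integer. There is a constant $c$ depending only on $n,N,s,\Lambda,k$ such that the following holds. Let $a_0\in\mathbb{R}^{N\times N}$ be a constant matrix with $\Lambda^{-1}|\xi|^2\le\langle a_0\xi,\xi\rangle$ for all $\xi\in\mathbb{R}^N$ and $|a_0|\le\Lambda$, let $B\subset\mathbb{R}^n$ be a ball, and let $h\in W^{s,2}(B;\mathbb{R}^N)\cap L^1_{2s}$ be a weak solution to $-\mathcal{L}_{a_0}h=0$ in $B$. Then $h\in C^\infty_{\mathrm{loc}}(B;\mathbb{R}^N)$ and, for every $h_0\in\mathbb{R}^N$, $$|B|^{k/n}\,\|D^k(h-h_0)\|_{L^\infty(B/2)}\le c\left(\Big(\frac1{|B|}\int_B|h-h_0|^2dx\Big)^{1/2}+\mathtt{Tail}(h-h_0;B)\right).$$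
   Context: $B/2$ is the ball concentric with $B$ having half its radius. $L^1_{2s}:=\{w\in L^1_{\mathrm{loc}}(\mathbb{R}^n;\mathbb{R}^N)\colon\int_{\mathbb{R}^n}\frac{|w(x)|}{1+|x|^{n+2s}}dx<\infty\}$; $\mathtt{Tail}(w;B_\varrho(x)):=\varrho^{2s}\int_{\mathbb{R}^n\setminus B_\varrho(x)}\frac{|w(y)|}{|y-x|^{n+2s}}dy$. The map $h$ is a weak solution to $-\mathcal{L}_{a_0}h=0$ in $B$ if $$\int_{\mathbb{R}^n}\int_{\mathbb{R}^n}\langle a_0(h(x)-h(y)),\varphi(x)-\varphi(y)\rangle\frac{dx\,dy}{|x-y|^{n+2s}}=0$$ for every $\varphi\in W^{s,2}(\mathbb{R}^n;\mathbb{R}^N)$ with compact support in $B$. *)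

theory Defs
  imports "HOL-Analysis.Analysis" "HOL-Probability.Essential_Supremum"
begin

text \<open>
  Functions from n-dimensional Euclidean space \<^typ>\<open>real ^ 'n\<close> to \<^typ>\<open>real ^ 'm\<close> are representatives
  of their almost-everywhere classes; \<open>n\<close> is \<open>CARD('n)\<close> and \<open>N\<close> is \<open>CARD('m)\<close>.
  On the diagonal the singular kernels below take the value 0, by the convention \<open>x / 0 = 0\<close>;
  the diagonal is a null set.
\<close>

definition frac_sobolev :: "real \<Rightarrow> (real ^ 'n) set \<Rightarrow> (real ^ 'n \<Rightarrow> real ^ 'm) set" where
  "frac_sobolev s \<Omega> = {w.
     set_borel_measurable lebesgue \<Omega> w \<and>
     set_integrable lebesgue \<Omega> (\<lambda>x. (norm (w x))\<^sup>2) \<and>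
     set_integrable (lebesgue \<Otimes>\<^sub>M lebesgue) (\<Omega> \<times> \<Omega>)
       (\<lambda>(x, y). (norm (w x - w y))\<^sup>2 / norm (x - y) powr (real CARD('n) + 2 * s))}"

text \<open>The space \<open>L\<^sup>1\<^sub>2\<^sub>s\<close>.\<close>

definition tail_space :: "real \<Rightarrow> (real ^ 'n \<Rightarrow> real ^ 'm) set" where
  "tail_space s = {w.
     (\<forall>K. compact K \<longrightarrow> w absolutely_integrable_on K) \<and>
     integrable lebesgue (\<lambda>x. norm (w x) / (1 + norm x powr (real CARD('n) + 2 * s)))}"

definition tail :: "real \<Rightarrow> (real ^ 'n \<Rightarrow> real ^ 'm) \<Rightarrow> real ^ 'n \<Rightarrow> real \<Rightarrow> real" where
  "tail s w x \<rho> =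
     \<rho> powr (2 * s) *
     (LINT y:(- ball x \<rho>)|lebesgue. norm (w y) / norm (y - x) powr (real CARD('n) + 2 * s))"

definition compact_support_in :: "(real ^ 'n) set \<Rightarrow> (real ^ 'n \<Rightarrow> real ^ 'm) \<Rightarrow> bool" where
  "compact_support_in B \<phi> \<longleftrightarrow>
     compact (closure {x. \<phi> x \<noteq> 0}) \<and> closure {x. \<phi> x \<noteq> 0} \<subseteq> B"

text \<open>
  Weak solutions of \<open>- L\<^sub>a h = 0\<close> in \<open>B\<close>. The double integral is required to exist and to vanish
  (a non-integrable integrand would have Bochner integral 0). Existence is automatic for \<open>B\<close> a
  ball and \<open>h\<close> in \<open>frac_sobolev s B \<inter> tail_space s\<close>.
\<close>

definition weak_solution ::
  "real \<Rightarrow> real ^ 'm ^ 'm \<Rightarrow> (real ^ 'n) set \<Rightarrow> (real ^ 'n \<Rightarrow> real ^ 'm) \<Rightarrow> bool" where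
  "weak_solution s a B h \<longleftrightarrow>
     (\<forall>\<phi>. \<phi> \<in> frac_sobolev s UNIV \<longrightarrow> compact_support_in B \<phi> \<longrightarrow>
        has_bochner_integral (lebesgue \<Otimes>\<^sub>M lebesgue)
          (\<lambda>(x, y). ((a *v (h x - h y)) \<bullet> (\<phi> x - \<phi> y)) /
                    norm (x - y) powr (real CARD('n) + 2 * s))
          0)"

text \<open>Iterated partial derivatives: \<open>partials [i\<^sub>1, \<dots>, i\<^sub>k] f = \<partial>\<^sub>i\<^sub>1 \<dots> \<partial>\<^sub>i\<^sub>k f\<close>.\<close>

primrec partials :: "'n list \<Rightarrow> (real ^ 'n \<Rightarrow> real ^ 'm) \<Rightarrow> real ^ 'n \<Rightarrow> real ^ 'm" where
  "partials [] f = f"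
| "partials (i # is) f = (\<lambda>x. frechet_derivative (partials is f) (at x) (axis i 1))"

text \<open>
  On an open set, differentiability of the iterated partials of every order amounts to the
  existence and continuity of all of them, i.e. to membership in \<open>C\<^sup>\<infinity>\<close>.
\<close>

definition smooth_on :: "(real ^ 'n) set \<Rightarrow> (real ^ 'n \<Rightarrow> real ^ 'm) \<Rightarrow> bool" where
  "smooth_on S f \<longleftrightarrow> (\<forall>is. partials is f differentiable_on S)"

text \<open>The Euclidean norm of the tensor \<open>D\<^sup>k f(x)\<close> of all partial derivatives of order \<open>k\<close>.\<close>

definition norm_D :: "nat \<Rightarrow> (real ^ 'n \<Rightarrow> real ^ 'm) \<Rightarrow> real ^ 'n \<Rightarrow> real" where
  "norm_D k f x = sqrt (\<Sum>is | length is = k. (norm (partials is f x))\<^sup>2)"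

definition Linf_norm :: "(real ^ 'n) set \<Rightarrow> (real ^ 'n \<Rightarrow> real) \<Rightarrow> ereal" where
  "Linf_norm S u = esssup (lebesgue_on S) (\<lambda>x. ereal \<bar>u x\<bar>)"

end

theory Submission
  imports Defs
begin

text \<open>
  Since \<open>a\<^sub>0\<close> is constant and invertible, testing with \<open>\<phi> = f \<xi>\<close> for scalar \<open>f\<close> and all vectors \<open>\<xi>\<close> makes
  every component of \<open>h\<close> weakly s-harmonic. Write \<open>L\<close> for the fractional Laplacian and \<open>n\<close> for the
  dimension, let \<open>\<chi>\<close> be a smooth radially decreasing bump and \<open>P = L \<chi>\<close>. Testing with
  \<open>\<chi>((\<cdot> - x) / t)\<close> shows that \<open>h\<close> integrates to zero against \<open>P((\<cdot> - x) / t)\<close> whenever the ball of radius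
  \<open>t\<close> about \<open>x\<close> lies in \<open>B\<close>. Put \<open>G(x) = \<integral>\<^sub>0\<^sup>1 \<tau>\<^sup>n\<^sup>-\<^sup>1 P(\<tau> x) d\<tau>\<close> and \<open>G\<^sub>d(x) = d\<^sup>-\<^sup>n G(x / d)\<close>. The difference
  \<open>G\<^sub>d - G\<^sub>e\<close> is a superposition of the functions \<open>P(\<cdot> / t)\<close> with \<open>d \<le> t < e\<close>, so \<open>h * G\<^sub>d = h * G\<^sub>e\<close>, and
  letting \<open>d \<rightarrow> 0\<close> gives \<open>(\<integral> G) h = h * G\<^sub>e\<close>.

  This reproducing formula yields everything, because \<open>G\<close> is smooth, all its derivatives are
  \<open>O((1 + |x|)\<^sup>-\<^sup>n\<^sup>-\<^sup>2\<^sup>s)\<close>, and \<open>\<integral> G > 0\<close>. Indeed \<open>|x|\<^sup>n G(x)\<close> is a positive multiple of the integral of \<open>P\<close>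
  over the ball of radius \<open>|x|\<close>. That integral is nonnegative because \<open>\<chi>\<close> and the indicator of the
  ball are both radially decreasing, and it decays like \<open>|x|\<^sup>-\<^sup>2\<^sup>s\<close> because \<open>\<integral> P = 0\<close>. Derivatives of \<open>G\<close>
  far out are controlled by means of \<open>\<nabla>G = (P - n G) x / |x|\<^sup>2\<close>.
\<close>


section \<open>Radial integration\<close>

text \<open>The definition of G is forced by dilations. In polar form n G + x . grad G = P, so
  d^(-n) G(x / d) has the derivative - d^(-n-1) P(x / d) in d: if h integrates to zero against all
  dilates of P about a point, the scale d does not matter. G is thus a smooth mean value kernel.
  Unlike the Poisson kernel of a ball it has no singularity on a sphere, so derivatives can be moved
  onto it without loss. The price is an algebraic tail, and the rate n + 2s is the one at which
  functions of L^1_2s can still be integrated against it; this is where Tail enters the estimate.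
  Two obstacles shape the rest. The singular kernel is not integrable at 0, so Fubini cannot split
  the bilinear form directly; it is cut off near the diagonal, and the cut-off is removed only after
  symmetrisation. And h has no pointwise values, so the limit d -> 0 is taken after integration over
  boxes, which gives an identity almost everywhere whose convolution side is the smooth
  representative.\<close>

lemma translation_invariant_eq_lborel:
  fixes M :: "'a::euclidean_space measure"
  assumes sets[measurable_cong]: "sets M = sets borel"
    and trans: "\<And>c. distr M borel (\<lambda>x. c + x) = M"
    and finite: "\<And>r. emeasure M (ball 0 r) < \<infinity>"
    and ball: "emeasure M (ball 0 1) = emeasure lborel (ball (0::'a) 1)"
  shows "M = lborel"
proof (rule measure_eqI)
  fix A assume "A \<in> sets M"
  then have A[measurable]: "A \<in> sets borel" by (simp add: sets)
  interpret M: sigma_finite_measure M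
  proof
    show "\<exists>F. countable F \<and> F \<subseteq> sets M \<and> \<Union>F = space M \<and> (\<forall>a\<in>F. emeasure M a \<noteq> \<infinity>)"
    proof (intro exI conjI ballI)
      show "countable (range (\<lambda>i::nat. ball (0::'a) (real i)))" by simp
      show "range (\<lambda>i::nat. ball (0::'a) (real i)) \<subseteq> sets M" by (auto simp: sets)
      have "\<exists>i. x \<in> ball (0::'a) (real i)" for x by (simp add: reals_Archimedean2)
      then show "\<Union> (range (\<lambda>i::nat. ball (0::'a) (real i))) = space M"
        using sets_eq_imp_space_eq[OF sets] by auto
      fix a assume "a \<in> range (\<lambda>i::nat. ball (0::'a) (real i))"
      then show "emeasure M a \<noteq> \<infinity>" using finite by (auto simp: less_top)
    qed
  qed
  interpret pair_sigma_finite M lborel ..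
  let ?B = "ball (0::'a) 1"
  have [measurable]: "?B \<in> sets borel" by simp
  have tr: "(\<integral>\<^sup>+x. f (c + x) \<partial>M) = (\<integral>\<^sup>+x. f x \<partial>M)" if [measurable]: "f \<in> borel_measurable borel" for f c
    by (subst trans[of c, symmetric], subst nn_integral_distr) auto
  have trl: "(\<integral>\<^sup>+x. f (c + x) \<partial>lborel) = (\<integral>\<^sup>+x. f x \<partial>lborel)" if [measurable]: "f \<in> borel_measurable borel" for f and c :: 'a
    by (subst lborel_distr_plus[of c, symmetric], subst nn_integral_distr) auto
  \<comment> \<open>Uniqueness of Haar measure: invariance of \<open>M\<close> couples the two
    variables, invariance of \<open>lborel\<close> moves the shift to the ball, and invariance of
    \<open>M\<close> together with the symmetry of the ball decouples them with the roles of the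
    measures exchanged.\<close>
  have "emeasure M A * emeasure lborel ?B = (\<integral>\<^sup>+y. indicator ?B y * emeasure M A \<partial>lborel)"
    by (subst nn_integral_multc) (auto simp: mult.commute)
  also have "\<dots> = (\<integral>\<^sup>+y. indicator ?B y * (\<integral>\<^sup>+x. indicator A (y + x) \<partial>M) \<partial>lborel)"
    by (subst tr) (auto simp: sets)
  also have "\<dots> = (\<integral>\<^sup>+y. (\<integral>\<^sup>+x. indicator ?B y * indicator A (y + x) \<partial>M) \<partial>lborel)"
    by (subst nn_integral_cmult) auto
  also have "\<dots> = (\<integral>\<^sup>+x. (\<integral>\<^sup>+y. indicator ?B y * indicator A (y + x) \<partial>lborel) \<partial>M)"
    by (rule Fubini') auto
  also have "\<dots> = (\<integral>\<^sup>+x. (\<integral>\<^sup>+y. indicator ?B (- x + y) * indicator A y \<partial>lborel) \<partial>M)"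
  proof (rule nn_integral_cong)
    fix x
    show "(\<integral>\<^sup>+y. indicator ?B y * indicator A (y + x) \<partial>lborel) = (\<integral>\<^sup>+y. indicator ?B (- x + y) * indicator A y \<partial>lborel)"
      using trl[of "\<lambda>y. indicator ?B (- x + y) * indicator A y" x] by (simp add: add.commute)
  qed
  also have "\<dots> = (\<integral>\<^sup>+y. (\<integral>\<^sup>+x. indicator ?B (- x + y) * indicator A y \<partial>M) \<partial>lborel)"
    by (rule Fubini'[symmetric]) auto
  also have "\<dots> = (\<integral>\<^sup>+y. (\<integral>\<^sup>+x. indicator ?B (- y + x) \<partial>M) * indicator A y \<partial>lborel)"
    by (subst nn_integral_multc[symmetric])
      (auto intro!: nn_integral_cong arg_cong2[of _ _ _ _ "(*)"] simp: indicator_def dist_norm norm_minus_commute algebra_simps)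
  also have "\<dots> = (\<integral>\<^sup>+y. emeasure M ?B * indicator A y \<partial>lborel)"
    by (subst tr) (auto simp: sets)
  also have "\<dots> = emeasure lborel ?B * emeasure lborel A"
    by (subst nn_integral_cmult) (auto simp: ball)
  finally have eq: "emeasure M A * emeasure lborel ?B = emeasure lborel ?B * emeasure lborel A" .
  have "emeasure lborel ?B \<noteq> 0" "emeasure lborel ?B \<noteq> \<infinity>"
    using unit_ball_vol_pos[of "real DIM('a)"] by (auto simp: emeasure_ball simp del: unit_ball_vol_pos)
  with eq show "emeasure M A = emeasure lborel A"
    by (metis ennreal_mult_cancel_left infinity_ennreal_def mult.commute)
qed (simp add: sets)

text \<open>An orthogonal map fixes every centred ball and turns translations into translations, so
  its image measure meets the criterion above. This is what makes \<open>P\<close> radial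
  later.\<close>

lemma lborel_distr_orthogonal:
  fixes f :: "'a::euclidean_space \<Rightarrow> 'a"
  assumes f: "orthogonal_transformation f"
  shows "distr lborel borel f = lborel"
proof (rule translation_invariant_eq_lborel)
  have lin: "linear f" and surj: "surj f"
    using f by (simp_all add: orthogonal_transformation_linear orthogonal_transformation_surj)
  have nf: "norm (f x) = norm x" for x using f by (simp add: orthogonal_transformation)
  have [measurable]: "f \<in> borel_measurable borel"
    using lin by (simp add: borel_measurable_continuous_onI linear_continuous_on linear_linear)
  fix c
  obtain d where d: "c = f d" using surj by blast
  have "distr (distr lborel borel f) borel (\<lambda>x. c + x) = distr (distr lborel borel (\<lambda>x. d + x)) borel f"
    by (auto simp: distr_distr o_def d linear_add[OF lin])
  then show "distr (distr lborel borel f) borel (\<lambda>x. c + x) = distr lborel borel f"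
    by (simp add: lborel_distr_plus)
  have "f -` ball 0 r = ball 0 r" for r by (auto simp: nf)
  then have e: "emeasure (distr lborel borel f) (ball 0 r) = emeasure lborel (ball (0::'a) r)" for r
    by (simp add: emeasure_distr)
  show "emeasure (distr lborel borel f) (ball 0 r) < \<infinity>" for r
    unfolding e by (metis bounded_ball emeasure_bounded_finite)
  show "emeasure (distr lborel borel f) (ball 0 1) = emeasure lborel (ball (0::'a) 1)" by (rule e)
qed simp

text \<open>Polar coordinates as an image measure. The rays \<open>{..a}\<close> generate the Borel
  sets; on them the left side is the volume of a ball and the right side the integral of the radial
  derivative of that volume.\<close>

lemma lborel_distr_norm:
  "distr (lborel :: 'a::euclidean_space measure) borel norm =
     density lborel (\<lambda>t. ennreal (real DIM('a) * unit_ball_vol DIM('a) * (t ^ (DIM('a) - 1) * indicator {0..} t)))"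
  (is "?L = density lborel ?d")
proof (rule measure_eqI_generator_eq[where E="range (\<lambda>a::real. {..a})" and A="\<lambda>i::nat. {..real i}" and \<Omega>=UNIV])
  let ?n = "DIM('a)" and ?w = "unit_ball_vol (real DIM('a))"
  have 1: "emeasure ?L {..a} = ennreal (?w * (max 0 a) ^ ?n)" for a
  proof -
    have "norm -` {..a} = cball (0::'a) a" by auto
    then show ?thesis
      by (cases "0 \<le> a") (simp_all add: emeasure_distr emeasure_cball max_def)
  qed
  have 2: "emeasure (density lborel ?d) {..a} = ennreal (?w * (max 0 a) ^ ?n)" for a
  proof -
    \<comment> \<open>For negative \<open>a\<close> the interval \<open>{0..max 0 a}\<close> is the
      single point 0, which \<open>{..a}\<close> misses; the two integrands therefore agree only off
      \<open>{0}\<close>.\<close>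
    have "emeasure (density lborel ?d) {..a} =
        (\<integral>\<^sup>+t. ennreal (real ?n * ?w * t ^ (?n - 1)) * indicator {0..max 0 a} t \<partial>lborel)"
      by (subst emeasure_density, simp, simp)
        (intro nn_integral_cong_AE AE_I[where N="{0}"], auto simp: indicator_def max_def)
    also have "\<dots> = ?w * (max 0 a) ^ ?n - ?w * 0 ^ ?n"
      by (rule nn_integral_FTC_Icc) (auto intro!: derivative_eq_intros simp: unit_ball_vol_nonneg)
    finally show ?thesis by simp
  qed
  show "emeasure ?L X = emeasure (density lborel ?d) X" if "X \<in> range (\<lambda>a::real. {..a})" for X
    using that 1 2 by auto
  show "emeasure ?L {..real i} \<noteq> \<infinity>" for i unfolding 1 by simp
  show "Int_stable (range (\<lambda>a::real. {..a}))" by (auto simp: Int_stable_def)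
  show "sets ?L = sigma_sets UNIV (range atMost)" "sets (density lborel ?d) = sigma_sets UNIV (range atMost)"
    by (simp_all add: borel_eq_atMost)
  show "(\<Union>i. {..real i}) = (UNIV::real set)" by (auto intro: real_arch_simple)
qed auto

lemma integrable_radial_iff:
  fixes f :: "real \<Rightarrow> real"
  assumes [measurable]: "f \<in> borel_measurable borel"
  shows "integrable lborel (\<lambda>x::'a::euclidean_space. f (norm x)) \<longleftrightarrow>
         integrable lborel (\<lambda>t. indicator {0..} t * (t ^ (DIM('a) - 1) * f t))"
proof -
  have "integrable lborel (\<lambda>x::'a. f (norm x)) \<longleftrightarrow> integrable (distr (lborel::'a measure) borel norm) f"
    by (rule integrable_distr_eq[symmetric]) auto
  also have "\<dots> \<longleftrightarrow> integrable lborel (\<lambda>t. (real DIM('a) * unit_ball_vol DIM('a)) * (indicator {0..} t * (t ^ (DIM('a) - 1) * f t)))"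
    unfolding lborel_distr_norm by (subst integrable_real_density) (auto simp: mult_ac indicator_def)
  also have "\<dots> \<longleftrightarrow> integrable lborel (\<lambda>t. indicator {0..} t * (t ^ (DIM('a) - 1) * f t))"
    using unit_ball_vol_pos[of "real DIM('a)"] by (subst integrable_mult_left_iff) (auto simp del: unit_ball_vol_pos)
  finally show ?thesis .
qed

lemma integral_radial:
  fixes f :: "real \<Rightarrow> real"
  assumes [measurable]: "f \<in> borel_measurable borel"
  shows "(\<integral>x. f (norm x) \<partial>(lborel::'a::euclidean_space measure)) =
         real DIM('a) * unit_ball_vol DIM('a) * (\<integral>t. indicator {0..} t * (t ^ (DIM('a) - 1) * f t) \<partial>lborel)"
proof -
  have "(\<integral>x. f (norm x) \<partial>(lborel::'a measure)) = (\<integral>t. f t \<partial>(distr (lborel::'a measure) borel norm))"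
    by (rule integral_distr[symmetric]) auto
  also have "\<dots> = (\<integral>t. (real DIM('a) * unit_ball_vol DIM('a)) * (indicator {0..} t * (t ^ (DIM('a) - 1) * f t)) \<partial>lborel)"
    unfolding lborel_distr_norm by (subst integral_real_density) (auto simp: mult_ac indicator_def intro!: Bochner_Integration.integral_cong)
  finally show ?thesis by simp
qed

lemma integrable_lborel_powr_to_inf:
  assumes "e < -1" "0 < (c::real)"
  shows "integrable lborel (\<lambda>t. indicator {c..} t * t powr e)"
proof -
  have "set_integrable lebesgue {c..} (\<lambda>t. t powr e)"
    using assms by (intro nonnegative_absolutely_integrable_1 has_integral_integrable[OF has_integral_powr_to_inf]) auto
  then have "integrable lebesgue (\<lambda>t. indicator {c..} t * t powr e)"
    by (simp add: set_integrable_def)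
  then show ?thesis by (subst (asm) integrable_completion) auto
qed

lemma integrable_lborel_powr_from_0:
  assumes "e > (-1::real)"
  shows "integrable lborel (\<lambda>t. indicator {0..1} t * t powr e)"
proof -
  have "set_integrable lebesgue {0..1} (\<lambda>t. t powr e)"
    using assms by (intro nonnegative_absolutely_integrable_1 has_integral_integrable[OF has_integral_powr_from_0]) auto
  then have "integrable lebesgue (\<lambda>t. indicator {0..1} t * t powr e)"
    by (simp add: set_integrable_def)
  then show ?thesis by (subst (asm) integrable_completion) auto
qed

lemma lborel_integral_affine:
  fixes f :: "'a::euclidean_space \<Rightarrow> real"
  assumes [measurable]: "f \<in> borel_measurable borel" and c: "c \<noteq> 0"
  shows "(\<integral>x. f (t + c *\<^sub>R x) \<partial>lborel) = (\<integral>x. f x \<partial>lborel) / \<bar>c\<bar> ^ DIM('a)"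
    and "integrable lborel (\<lambda>x. f (t + c *\<^sub>R x)) \<longleftrightarrow> integrable lborel f"
proof -
  have "integral\<^sup>L (density (distr lborel borel (\<lambda>x. t + c *\<^sub>R x)) (\<lambda>_. \<bar>c\<bar>^DIM('a))) f
     = \<bar>c\<bar>^DIM('a) * (\<integral>x. f (t + c *\<^sub>R x) \<partial>lborel)"
    by (subst integral_real_density) (auto simp: integral_distr)
  then show "(\<integral>x. f (t + c *\<^sub>R x) \<partial>lborel) = (\<integral>x. f x \<partial>lborel) / \<bar>c\<bar> ^ DIM('a)"
    using c unfolding lborel_affine[OF c, of t, symmetric] by simp
  have "integrable (density (distr lborel borel (\<lambda>x. t + c *\<^sub>R x)) (\<lambda>_. \<bar>c\<bar>^DIM('a))) f
     \<longleftrightarrow> integrable lborel (\<lambda>x. f (t + c *\<^sub>R x))"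
    using c by (subst integrable_real_density) (auto simp: integrable_distr_eq)
  then show "integrable lborel (\<lambda>x. f (t + c *\<^sub>R x)) \<longleftrightarrow> integrable lborel f"
    unfolding lborel_affine[OF c, of t, symmetric] by simp
qed

section \<open>The singular kernel and the integrable weight\<close>

locale frac_order =
  fixes s :: real
  assumes s_pos: "0 < s" and s_less: "s < 1"
begin

text \<open>On the diagonal \<open>kern 0 = 0\<close>, because \<open>0 powr p = 0\<close> for every exponent.\<close>

definition kern :: "real ^ 'n \<Rightarrow> real" where
  "kern z = norm z powr - (real CARD('n) + 2 * s)"

text \<open>The regular counterpart of \<open>kern\<close>: of the same order at infinity but
  bounded by 1 near the origin. All decay estimates are stated against it, and integrability against
  it expresses membership in L^1_2s.\<close>

definition wt :: "real ^ 'n \<Rightarrow> real" where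
  "wt z = (1 + norm z) powr - (real CARD('n) + 2 * s)"

lemma kern_measurable[measurable]: "kern \<in> borel_measurable borel"
  unfolding kern_def by simp

lemma wt_measurable[measurable]: "wt \<in> borel_measurable borel"
  unfolding wt_def by simp

lemma kern_nonneg[simp]: "0 \<le> kern z" by (simp add: kern_def)
lemma wt_pos[simp]: "0 < wt z" unfolding wt_def by (auto simp: add_pos_nonneg) (smt (verit) norm_ge_zero)
lemma wt_nonneg[simp]: "0 \<le> wt z" using wt_pos[of z] by linarith

lemma kern_minus[simp]: "kern (- z) = kern z" by (simp add: kern_def)

text \<open>In polar coordinates the integrand is t^(1 - 2s) on the unit interval, integrable
  because s < 1, and t^(-1 - 2s) beyond it, integrable because s > 0. The factor
  \<open>min 1 ((norm z)\<^sup>2)\<close> is the size of second differences of a smooth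
  bump.\<close>

lemma integrable_levy: "integrable lborel (\<lambda>z::real^'n. min 1 ((norm z)\<^sup>2) * kern z)"
proof -
  let ?n = "CARD('n)"
  let ?a = "real CARD('n) + 2 * s"
  let ?f = "\<lambda>t::real. min 1 (t\<^sup>2) * t powr - ?a"
  have "integrable lborel (\<lambda>t. indicator {0..1} t * t powr (1 - 2 * s) + indicator {1..} t * t powr (- 1 - 2 * s))"
    using s_pos s_less
    by (intro Bochner_Integration.integrable_add integrable_lborel_powr_from_0 integrable_lborel_powr_to_inf) auto
  then have "integrable lborel (\<lambda>t. indicator {0..} t * (t ^ (?n - 1) * ?f t))"
  proof (rule Bochner_Integration.integrable_bound, measurable, intro AE_I2)
    fix t :: real
    have n: "real (?n - Suc 0) = real ?n - 1" using zero_less_card_finite[where 'a='n]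
      by (subst of_nat_diff) (auto simp: Suc_le_eq)
    show "norm (indicator {0..} t * (t ^ (?n - 1) * ?f t)) \<le>
      norm (indicator {0..1} t * t powr (1 - 2 * s) + indicator {1..} t * t powr (- 1 - 2 * s))"
    proof (cases "t > 0")
      case True
      then have p: "t ^ (?n - 1) = t powr (real ?n - 1)" "t\<^sup>2 = t powr 2"
        using powr_realpow[OF True, of "?n - 1"] powr_realpow[OF True, of 2] n by simp_all
      show ?thesis
      proof (cases "t \<le> 1")
        case t: True
        with True have "t\<^sup>2 \<le> 1" by (simp add: power_le_one)
        then have "t ^ (?n - 1) * ?f t = t powr (1 - 2 * s)"
          by (simp only: min_absorb2 p, simp only: powr_add[symmetric]) (simp add: algebra_simps)
        then show ?thesis using True t by (auto simp: indicator_def)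
      next
        case t: False
        with True have "t\<^sup>2 \<ge> 1" by simp
        then have "t ^ (?n - 1) * ?f t = t powr (-1 - 2 * s)"
          by (simp only: min_absorb1 p mult_1_left, simp only: powr_add[symmetric]) (simp add: algebra_simps)
        then show ?thesis using True t by (auto simp: indicator_def)
      qed
    next
      case False
      then show ?thesis by (cases "t = 0") (auto simp: indicator_def)
    qed
  qed
  then have "integrable lborel (\<lambda>z::real^'n. ?f (norm z))"
    by (subst integrable_radial_iff) (auto simp: DIM_cart)
  then show ?thesis by (simp add: kern_def)
qed

lemma integrable_kern_far:
  assumes "0 < e"
  shows "integrable lborel (\<lambda>z::real^'n. indicator {e..} (norm z) * kern z)"
proof (rule Bochner_Integration.integrable_bound[OF integrable_mult_right[OF integrable_levy, of "max 1 (1 / e\<^sup>2)"]], measurable, intro AE_I2)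
  fix z :: "real^'n"
  have "1 \<le> max 1 (1 / e\<^sup>2) * min 1 ((norm z)\<^sup>2)" if "e \<le> norm z"
  proof (cases "norm z \<ge> 1")
    case True then have "1 \<le> (norm z)\<^sup>2" by simp
    then show ?thesis by simp
  next
    case False
    then have m: "min 1 ((norm z)\<^sup>2) = (norm z)\<^sup>2" by (simp add: power_le_one)
    have "1 \<le> 1 / e\<^sup>2 * (norm z)\<^sup>2" using that assms by (simp add: field_simps power_mono)
    also have "\<dots> \<le> max 1 (1 / e\<^sup>2) * (norm z)\<^sup>2" by (intro mult_right_mono) auto
    finally show ?thesis using m by simp
  qed
  then have "1 * kern z \<le> max 1 (1 / e\<^sup>2) * min 1 ((norm z)\<^sup>2) * kern z" if "e \<le> norm z"
    using that by (intro mult_right_mono) auto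
  then show "norm (indicator {e..} (norm z) * kern z) \<le> norm (max 1 (1 / e\<^sup>2) * (min 1 ((norm z)\<^sup>2) * kern z))"
    by (auto simp: indicator_def abs_mult)
qed

lemma wt_le_1: "wt (z :: real^'n) \<le> 1"
  using powr_mono2'[of "- (real CARD('n) + 2 * s)" 1 "1 + norm z"] s_pos by (simp add: wt_def)

lemma wt_le_kern: "z \<noteq> 0 \<Longrightarrow> wt z \<le> kern z"
  unfolding wt_def kern_def using s_pos by (intro powr_mono2') auto

lemma integrable_wt: "integrable lborel (wt :: real^'n \<Rightarrow> real)"
proof -
  have "integrable lborel (\<lambda>z::real^'n. indicator (ball 0 1) z + indicator {1..} (norm z) * kern z)"
    by (intro Bochner_Integration.integrable_add integrable_kern_far)
      (auto intro!: integrable_real_indicator simp: emeasure_ball)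
  then show ?thesis
  proof (rule Bochner_Integration.integrable_bound, measurable, intro AE_I2)
    fix z :: "real^'n"
    show "norm (wt z) \<le> norm (indicator (ball 0 1) z + indicator {1..} (norm z) * kern z)"
      using wt_le_1[of z] wt_le_kern[of z] by (cases "z = 0") (auto simp: indicator_def)
  qed
qed

text \<open>With \<open>kern_le_wt\<close> the basic means of comparing weights at different points:
  enlarging the argument by a factor \<open>c\<close> costs the power n + 2s of
  \<open>c\<close>.\<close>

lemma wt_scale:
  assumes "c \<ge> 1" "1 + norm x \<le> c * (1 + norm (y :: real^'n))"
  shows "wt y \<le> c powr (real CARD('n) + 2 * s) * wt (x :: real^'n)"
proof -
  let ?a = "real CARD('n) + 2 * s"
  have "wt y = c powr ?a * (c * (1 + norm y)) powr - ?a"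
    using assms powr_add[of c ?a "- ?a"] unfolding wt_def by (subst powr_mult) (simp_all add: mult.assoc[symmetric])
  also have "\<dots> \<le> c powr ?a * (1 + norm x) powr - ?a"
    using assms s_pos by (intro mult_left_mono powr_mono2') (auto simp: add_pos_nonneg)
  finally show ?thesis by (simp add: wt_def)
qed

lemma kern_le_wt:
  assumes "c \<ge> 1" "1 + norm x \<le> c * norm (y :: real^'n)" 
  shows "kern y \<le> c powr (real CARD('n) + 2 * s) * wt (x :: real^'n)"
proof -
  let ?a = "real CARD('n) + 2 * s"
  have "norm y > 0" using assms by (smt (verit) norm_ge_zero mult_nonneg_nonpos norm_not_less_zero)
  then have "kern y = c powr ?a * (c * norm y) powr - ?a"
    using assms powr_add[of c ?a "- ?a"] unfolding kern_def by (subst powr_mult) (simp_all add: mult.assoc[symmetric])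
  also have "\<dots> \<le> c powr ?a * (1 + norm x) powr - ?a"
    using assms s_pos by (intro mult_left_mono powr_mono2') (auto simp: add_pos_nonneg)
  finally show ?thesis by (simp add: wt_def)
qed

end

section \<open>Differentiation and smooth bumps\<close>

text \<open>Dominated convergence of the difference quotients along sequences. The mean value
  inequality controls the increment and the bound on \<open>k'\<close> the linear part, so twice
  \<open>CARD('n) * b\<close> is a majorant. The derivative is given by its coordinate components
  because iterated partial derivatives are read off from them.\<close>

lemma has_derivative_integral_param:
  fixes k :: "real ^ 'n \<Rightarrow> 'z \<Rightarrow> 'b::{banach, second_countable_topology}"
  assumes r: "0 < r"
    and int: "\<And>x. x \<in> ball x0 r \<Longrightarrow> integrable M (k x)"
    and der: "\<And>x z. x \<in> ball x0 r \<Longrightarrow> z \<in> space M \<Longrightarrow>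
      ((\<lambda>x. k x z) has_derivative (\<lambda>v. \<Sum>i\<in>UNIV. v $ i *\<^sub>R k' i x z)) (at x)"
    and bound: "\<And>i x z. x \<in> ball x0 r \<Longrightarrow> z \<in> space M \<Longrightarrow> norm (k' i x z) \<le> b z"
    and b: "integrable M b"
    and meas: "\<And>i. k' i x0 \<in> borel_measurable M"
  shows "((\<lambda>x. \<integral>z. k x z \<partial>M) has_derivative (\<lambda>v. \<Sum>i\<in>UNIV. v $ i *\<^sub>R (\<integral>z. k' i x0 z \<partial>M))) (at x0)"
proof -
  let ?D = "\<lambda>x z v. \<Sum>i\<in>UNIV. v $ i *\<^sub>R k' i x z"
  have x0: "x0 \<in> ball x0 r" using r by simp
  have k'int: "integrable M (k' i x0)" for i
    using bound[OF x0] by (intro Bochner_Integration.integrable_bound[OF b] meas) (auto intro!: AE_I2 order_trans[OF bound[OF x0]])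
  have Dint: "integrable M (\<lambda>z. ?D x0 z v)" for v
    by (intro Bochner_Integration.integrable_sum integrable_scaleR_right k'int)
  have Dn: "norm (?D x z v) \<le> (real CARD('n) * b z) * norm v" if "x \<in> ball x0 r" "z \<in> space M" for x z v
  proof -
    have "norm (?D x z v) \<le> (\<Sum>i::'n\<in>UNIV. norm v * b z)"
      using bound[OF that] component_le_norm_cart[of v]
      by (intro sum_norm_le) (auto intro!: mult_mono)
    then show ?thesis by (simp add: algebra_simps)
  qed
  have bl: "bounded_linear (?D x z)" if "x \<in> ball x0 r" "z \<in> space M" for x z
    using der[OF that] by (rule has_derivative_bounded_linear)
  have lip: "norm (k x z - k x0 z) \<le> (real CARD('n) * b z) * norm (x - x0)" if x: "x \<in> ball x0 r" and z: "z \<in> space M" for x z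
  proof (rule differentiable_bound[of "ball x0 r" "\<lambda>x. k x z" "\<lambda>x. ?D x z"])
    fix y assume y: "y \<in> ball x0 r"
    show "((\<lambda>x. k x z) has_derivative ?D y z) (at y within ball x0 r)"
      using der[OF y z] by (rule has_derivative_at_withinI)
    show "onorm (?D y z) \<le> real CARD('n) * b z"
      using Dn[OF y z] by (rule onorm_le)
  qed (use x x0 in auto)
  have bl0: "bounded_linear (\<lambda>v. \<Sum>i\<in>UNIV. v $ i *\<^sub>R (\<integral>z. k' i x0 z \<partial>M))"
    by (intro bounded_linear_sum bounded_linear_scaleR_const bounded_linear_vec_nth)
  show ?thesis
    unfolding has_derivative_at
  proof (intro conjI bl0)
    show "(\<lambda>h. norm ((\<integral>z. k (x0 + h) z \<partial>M) - (\<integral>z. k x0 z \<partial>M) - (\<Sum>i\<in>UNIV. h $ i *\<^sub>R (\<integral>z. k' i x0 z \<partial>M))) / norm h) \<midarrow>0\<rightarrow> 0"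
      unfolding tendsto_at_iff_sequentially
    proof (intro allI impI)
      fix V :: "nat \<Rightarrow> real^'n" assume V0: "\<forall>i. V i \<in> UNIV - {0}" and V: "V \<longlonglongrightarrow> 0"
      \<comment> \<open>The quotient is replaced by 0 while \<open>V m\<close> is still too long for
        the local hypotheses; so every \<open>q m\<close> is integrable and dominated, and the
        sequence is unchanged eventually.\<close>
      define q where "q m z = (if norm (V m) < r then (1 / norm (V m)) *\<^sub>R (k (x0 + V m) z - k x0 z - ?D x0 z (V m)) else 0)" for m z
      have xv: "x0 + V m \<in> ball x0 r" if "norm (V m) < r" for m using that by (simp add: dist_norm)
      have qint: "integrable M (q m)" for m
      proof (cases "norm (V m) < r")
        case True
        then have "q m = (\<lambda>z. (1 / norm (V m)) *\<^sub>R (k (x0 + V m) z - k x0 z - ?D x0 z (V m)))" by (auto simp: q_def)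
        then show ?thesis using int[OF x0] int[OF xv[OF True]] Dint[of "V m"] by simp
      next
        case False
        then have "q m = (\<lambda>z. 0)" by (auto simp: q_def)
        then show ?thesis by simp
      qed
      have ev: "\<forall>\<^sub>F m in sequentially. norm (V m) < r"
        using tendstoD[OF V r] by (simp add: dist_norm)
      have "(\<lambda>m. \<integral>z. q m z \<partial>M) \<longlonglongrightarrow> (\<integral>z. 0 \<partial>M)"
      proof (rule integral_dominated_convergence[where w="\<lambda>z. 2 * (real CARD('n) * b z)"])
        show "integrable M (\<lambda>z. 2 * (real CARD('n) * b z))" using b by simp
        show "q m \<in> borel_measurable M" for m using qint by auto
        show "AE z in M. norm (q m z) \<le> 2 * (real CARD('n) * b z)" for m
        proof (rule AE_I2)
          fix z assume z: "z \<in> space M"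
          have b0: "0 \<le> b z" using order_trans[OF norm_ge_zero bound[OF x0 z]] by simp
          show "norm (q m z) \<le> 2 * (real CARD('n) * b z)"
          proof (cases "norm (V m) < r")
            case True
            have "norm (k (x0 + V m) z - k x0 z - ?D x0 z (V m)) \<le> (real CARD('n) * b z) * norm (V m) + (real CARD('n) * b z) * norm (V m)"
              using lip[OF xv[OF True] z] by (intro order_trans[OF norm_triangle_ineq4 add_mono[OF _ Dn[OF x0 z]]]) simp
            moreover have "norm (q m z) = norm (k (x0 + V m) z - k x0 z - ?D x0 z (V m)) / norm (V m)"
              unfolding q_def if_P[OF True] norm_scaleR by simp
            ultimately show ?thesis using V0 by (simp add: pos_divide_le_eq mult_ac)
          qed (simp add: q_def b0)
        qed
        show "AE z in M. (\<lambda>m. q m z) \<longlonglongrightarrow> 0"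
        proof (rule AE_I2)
          fix z assume z: "z \<in> space M"
          have "(\<lambda>h. norm (k (x0 + h) z - k x0 z - ?D x0 z h) / norm h) \<midarrow>0\<rightarrow> 0"
            using der[OF x0 z] unfolding has_derivative_at by auto
          then have "(\<lambda>m. norm (k (x0 + V m) z - k x0 z - ?D x0 z (V m)) / norm (V m)) \<longlonglongrightarrow> 0"
            unfolding tendsto_at_iff_sequentially using V0 V by (auto simp: o_def)
          then have "(\<lambda>m. norm (q m z)) \<longlonglongrightarrow> 0"
            by (rule Lim_transform_eventually) (use ev in eventually_elim, simp add: q_def)
          then show "(\<lambda>m. q m z) \<longlonglongrightarrow> 0" by (rule tendsto_norm_zero_cancel)
        qed
      qed simp
      then have "(\<lambda>m. norm (\<integral>z. q m z \<partial>M)) \<longlonglongrightarrow> 0" by (simp add: tendsto_norm_zero)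
      moreover have "\<forall>\<^sub>F m in sequentially. norm (\<integral>z. q m z \<partial>M) =
        norm ((\<integral>z. k (x0 + V m) z \<partial>M) - (\<integral>z. k x0 z \<partial>M) - (\<Sum>i\<in>UNIV. V m $ i *\<^sub>R (\<integral>z. k' i x0 z \<partial>M))) / norm (V m)"
        using ev
      proof eventually_elim
        case (elim m)
        have "(\<integral>z. q m z \<partial>M) = (1 / norm (V m)) *\<^sub>R (\<integral>z. k (x0 + V m) z - k x0 z - ?D x0 z (V m) \<partial>M)"
          using elim by (simp add: q_def)
        also have "(\<integral>z. k (x0 + V m) z - k x0 z - ?D x0 z (V m) \<partial>M) =
          (\<integral>z. k (x0 + V m) z \<partial>M) - (\<integral>z. k x0 z \<partial>M) - (\<Sum>i\<in>UNIV. V m $ i *\<^sub>R (\<integral>z. k' i x0 z \<partial>M))"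
          using int[OF x0] int[OF xv[OF elim]] Dint[of "V m"] k'int
          by (simp add: Bochner_Integration.integral_sum)
        finally show ?case by simp
      qed
      ultimately show "((\<lambda>h. norm ((\<integral>z. k (x0 + h) z \<partial>M) - (\<integral>z. k x0 z \<partial>M) - (\<Sum>i\<in>UNIV. h $ i *\<^sub>R (\<integral>z. k' i x0 z \<partial>M))) / norm h) \<circ> V) \<longlonglongrightarrow> 0"
        by (simp add: o_def Lim_transform_eventually)
    qed
  qed
qed

lemma frechet_derivative_axis:
  fixes f :: "real ^ 'n \<Rightarrow> 'b::real_normed_vector"
  assumes "(f has_derivative (\<lambda>v. \<Sum>i\<in>UNIV. v $ i *\<^sub>R D i)) (at x)"
  shows "frechet_derivative f (at x) (axis i 1) = D i"
proof -
  have "frechet_derivative f (at x) (axis i 1) = (\<Sum>j\<in>UNIV. axis i 1 $ j *\<^sub>R D j)"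
    by (simp add: frechet_derivative_at[OF assms, symmetric])
  also have "\<dots> = (\<Sum>j\<in>UNIV. if j = i then D j else 0)"
    by (rule sum.cong) (auto simp: axis_def)
  finally show ?thesis by simp
qed

text \<open>Scalar counterpart of one step of \<open>partials\<close>; \<open>pds\<close> iterates
  it. Kernels and test functions are scalar, solutions are vector valued.\<close>

definition pd :: "'n \<Rightarrow> (real ^ 'n \<Rightarrow> real) \<Rightarrow> real ^ 'n \<Rightarrow> real" where
  "pd i f x = frechet_derivative f (at x) (axis i 1)"

primrec pds :: "'n list \<Rightarrow> (real ^ 'n \<Rightarrow> real) \<Rightarrow> real ^ 'n \<Rightarrow> real" where
  "pds [] f = f"
| "pds (i # is) f = pd i (pds is f)"

lemma pd_eq:
  "(f has_derivative (\<lambda>v. \<Sum>i\<in>UNIV. v $ i * D i)) (at x) \<Longrightarrow> pd i f x = D i"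
  unfolding pd_def using frechet_derivative_axis[of f D x i] by simp

lemma has_derivative_coord_mult:
  fixes f :: "real ^ 'n \<Rightarrow> real"
  assumes "(f has_derivative (\<lambda>v. \<Sum>i\<in>UNIV. v $ i * D i)) (at x)"
  shows "((\<lambda>x. x $ j * f x) has_derivative (\<lambda>v. \<Sum>i\<in>UNIV. v $ i * ((if i = j then f x else 0) + x $ j * D i))) (at x)"
proof -
  have "((\<lambda>x. x $ j * f x) has_derivative (\<lambda>v. x $ j * (\<Sum>i\<in>UNIV. v $ i * D i) + v $ j * f x)) (at x)"
    by (rule has_derivative_mult[OF bounded_linear_imp_has_derivative[OF bounded_linear_vec_nth] assms])
  moreover have "x $ j * (\<Sum>i\<in>UNIV. v $ i * D i) + v $ j * f x =
     (\<Sum>i\<in>UNIV. v $ i * ((if i = j then f x else 0) + x $ j * D i))" for v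
    by (simp add: algebra_simps sum.distrib sum_distrib_left if_distrib[of "\<lambda>u. _ * u"] cong: if_cong)
  ultimately show ?thesis by simp
qed

lemma has_derivative_radial:
  fixes \<beta> :: "real \<Rightarrow> real" and x :: "real ^ 'n"
  assumes "(\<beta> has_real_derivative d) (at (x \<bullet> x))"
  shows "((\<lambda>x. \<beta> (x \<bullet> x)) has_derivative (\<lambda>v. \<Sum>i\<in>UNIV. v $ i * (2 * (x $ i * d)))) (at x)"
proof -
  have "((\<lambda>x. x \<bullet> x) has_derivative (\<lambda>v. 2 * (v \<bullet> x))) (at x)"
    by (auto intro!: derivative_eq_intros simp: inner_commute)
  then have "((\<lambda>x. \<beta> (x \<bullet> x)) has_derivative (\<lambda>v. 2 * (v \<bullet> x) * d)) (at x)"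
    using assms unfolding has_field_derivative_def by (auto dest!: has_derivative_compose simp: mult_ac)
  moreover have "2 * (v \<bullet> x) * d = (\<Sum>i\<in>UNIV. v $ i * (2 * (x $ i * d)))" for v
    by (simp add: inner_vec_def sum_distrib_left sum_distrib_right algebra_simps)
  ultimately show ?thesis by simp
qed

text \<open>With u = 1 / (1 - t) this is p(u) exp(-u), extended by 0. Since u' = u^2,
  differentiation replaces p by u^2 (p' - p), so letting p range over all polynomials closes the
  family under derivatives. The case p = 1 is the profile of the standard mollifier.\<close>

definition bexp :: "real poly \<Rightarrow> real \<Rightarrow> real" where
  "bexp p t = (if t < 1 then poly p (1 / (1 - t)) * exp (- (1 / (1 - t))) else 0)"

lemma poly_over_exp_tendsto_0: "((\<lambda>u. poly p u * exp (- u)) \<longlongrightarrow> (0::real)) at_top"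
proof -
  have "((\<lambda>u. \<Sum>i\<le>degree p. coeff p i * (u ^ i / exp u)) \<longlongrightarrow> (\<Sum>i\<le>degree p. coeff p i * 0)) at_top"
    by (intro tendsto_intros tendsto_power_div_exp_0)
  then show ?thesis by (simp add: poly_altdef sum_divide_distrib exp_minus divide_inverse sum_distrib_right mult.assoc)
qed

lemma bexp_has_derivative:
  "(bexp p has_real_derivative bexp ([:0, 0, 1:] * (pderiv p - p)) t) (at t)"
proof -
  consider "t < 1" | "t > 1" | "t = 1" by linarith
  then show ?thesis
  proof cases
    case 1
    have "((\<lambda>t. poly p (1 / (1 - t)) * exp (- (1 / (1 - t)))) has_real_derivative
      bexp ([:0, 0, 1:] * (pderiv p - p)) t) (at t)"
      using 1 by (auto intro!: derivative_eq_intros DERIV_chain2[OF poly_DERIV] simp: bexp_def power2_eq_square algebra_simps)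
    then show ?thesis
      by (rule DERIV_cong_ev[THEN iffD1, rotated 3])
        (use 1 in \<open>auto intro!: eventually_mono[OF eventually_nhds_in_open[of "{..<1}"]] simp: bexp_def\<close>)
  next
    case 2
    have "((\<lambda>t. 0) has_real_derivative 0) (at t)" by simp
    then show ?thesis
      by (rule DERIV_cong_ev[THEN iffD1, rotated 3])
        (use 2 in \<open>auto intro!: eventually_mono[OF eventually_nhds_in_open[of "{1<..}"]] simp: bexp_def\<close>)
  next
    case 3
    have l: "((\<lambda>h. bexp p (1 + h) / h) \<longlongrightarrow> 0) (at_left 0)"
    proof -
      \<comment> \<open>At the junction the left quotient is -u p(u) exp(-u) with u = -1/h, and
        \<open>pCons 0 p\<close> is the polynomial u p(u); the exponential wins.\<close>
      have "((\<lambda>u. - (poly (pCons 0 p) u * exp (- u))) \<longlongrightarrow> - 0) at_top"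
        by (intro tendsto_minus poly_over_exp_tendsto_0)
      moreover have "filterlim (\<lambda>h::real. - inverse h) at_top (at_left 0)"
        using filterlim_inverse_at_bot_neg by (simp add: filterlim_uminus_at_top)
      ultimately have "((\<lambda>h. - (poly (pCons 0 p) (- inverse h) * exp (- (- inverse h)))) \<longlongrightarrow> 0) (at_left 0)"
        by (auto dest: filterlim_compose)
      then show ?thesis
        by (rule Lim_transform_eventually)
          (auto simp: eventually_at_filter bexp_def field_simps intro!: always_eventually)
    qed
    have r: "((\<lambda>h. bexp p (1 + h) / h) \<longlongrightarrow> 0) (at_right 0)"
      by (rule Lim_transform_eventually[OF tendsto_const])
        (auto simp: eventually_at_filter bexp_def intro!: always_eventually)
    show ?thesis unfolding 3 DERIV_def
      using l r by (simp add: bexp_def filterlim_split_at)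
  qed
qed

text \<open>A class just large enough to contain the standard bump and to be closed under partial
  derivatives. A property proved by induction over it, such as vanishing outside the unit ball,
  holds at once for all derivatives of the bump.\<close>

inductive bump :: "(real ^ 'n \<Rightarrow> real) \<Rightarrow> bool" where
  base: "bump (\<lambda>x. bexp p (x \<bullet> x))"
| coord: "bump f \<Longrightarrow> bump (\<lambda>x. x $ j * f x)"
| add: "bump f \<Longrightarrow> bump g \<Longrightarrow> bump (\<lambda>x. f x + g x)"

lemma bexp_smult: "bexp (smult c p) t = c * bexp p t" by (simp add: bexp_def)

lemma bump_zero: "bump (\<lambda>x. 0)"
  using base[of 0] by (simp add: bexp_def cong: if_cong)

lemma bump_derivative:
  "bump f \<Longrightarrow> \<exists>D. (\<forall>i. bump (D i)) \<and> (\<forall>x. (f has_derivative (\<lambda>v. \<Sum>i\<in>UNIV. v $ i * D i x)) (at x))"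
proof (induction rule: bump.induct)
  case (base p)
  let ?q = "smult 2 ([:0, 0, 1:] * (pderiv p - p))"
  have "bump (\<lambda>x. x $ i * bexp ?q (x \<bullet> x))" for i
    by (intro bump.intros)
  moreover have "((\<lambda>x. bexp p (x \<bullet> x)) has_derivative (\<lambda>v. \<Sum>i\<in>UNIV. v $ i * (x $ i * bexp ?q (x \<bullet> x)))) (at x)" for x :: "real^'n"
    using has_derivative_radial[OF bexp_has_derivative, of p x] by (simp only: bexp_smult mult.left_commute)
  ultimately show ?case by (intro exI[of _ "\<lambda>i x. x $ i * bexp ?q (x \<bullet> x)"] conjI allI)
next
  case (coord f j)
  then obtain D where D: "\<And>i. bump (D i)" "\<And>x. (f has_derivative (\<lambda>v. \<Sum>i\<in>UNIV. v $ i * D i x)) (at x)" by blast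
  have "bump (\<lambda>x. (if i = j then f x else 0) + x $ j * D i x)" for i
    using coord.hyps D(1) bump_zero by (cases "i = j") (auto intro!: bump.intros)
  then show ?case using has_derivative_coord_mult[OF D(2)]
    by (intro exI[of _ "\<lambda>i x. (if i = j then f x else 0) + x $ j * D i x"] conjI allI)
next
  case (add f g)
  then obtain D E where "\<And>i. bump (D i)" "\<And>x. (f has_derivative (\<lambda>v. \<Sum>i\<in>UNIV. v $ i * D i x)) (at x)"
    "\<And>i. bump (E i)" "\<And>x. (g has_derivative (\<lambda>v. \<Sum>i\<in>UNIV. v $ i * E i x)) (at x)" by blast
  then show ?case
    by (intro exI[of _ "\<lambda>i x. D i x + E i x"] conjI allI bump.add)
      (auto dest: has_derivative_add simp: distrib_left sum.distrib)
qed

lemma bump_pd: "bump f \<Longrightarrow> bump (pd i f)"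
  and bump_has_derivative: "bump f \<Longrightarrow> (f has_derivative (\<lambda>v. \<Sum>i\<in>UNIV. v $ i * pd i f x)) (at x)"
proof -
  assume "bump f"
  then obtain D where D: "\<And>i. bump (D i)" "\<And>x. (f has_derivative (\<lambda>v. \<Sum>i\<in>UNIV. v $ i * D i x)) (at x)"
    using bump_derivative by blast
  have "pd i f = D i" for i using pd_eq[OF D(2)] by auto
  with D show "bump (pd i f)" "(f has_derivative (\<lambda>v. \<Sum>i\<in>UNIV. v $ i * pd i f x)) (at x)" by simp_all
qed

lemma bump_pds: "bump f \<Longrightarrow> bump (pds is f)"
  by (induction "is") (auto intro: bump_pd)

lemma bump_continuous: "bump f \<Longrightarrow> continuous_on A f"
  by (meson bump_has_derivative continuous_at_imp_continuous_on has_derivative_continuous)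

lemma bump_outside: "bump f \<Longrightarrow> 1 \<le> norm x \<Longrightarrow> f x = 0"
proof (induction rule: bump.induct)
  case (base p)
  then have "1 \<le> x \<bullet> x" by (simp add: dot_square_norm)
  then show ?case by (simp add: bexp_def)
qed auto

lemma bump_bounded: assumes "bump f" obtains C where "0 \<le> C" "\<And>x. \<bar>f x\<bar> \<le> C"
proof -
  have "bounded (f ` cball 0 1)"
    by (intro compact_imp_bounded compact_continuous_image bump_continuous[OF assms] compact_cball)
  then obtain C where "0 < C" "\<And>x. norm x \<le> 1 \<Longrightarrow> \<bar>f x\<bar> \<le> C"
    unfolding bounded_pos by auto
  moreover have "\<bar>f x\<bar> \<le> C" if "\<not> norm x \<le> 1" for x
    using bump_outside[OF assms, of x] that \<open>0 < C\<close> by simp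
  ultimately show ?thesis using that[of C] by (meson less_imp_le)
qed

lemma bump_lipschitz:
  fixes f :: "real^'n \<Rightarrow> real"
  assumes "bump f" obtains C where "0 \<le> C" "\<And>x y. \<bar>f x - f y\<bar> \<le> C * norm (x - y)"
proof -
  have "\<exists>C. 0 \<le> C \<and> (\<forall>x. \<bar>pd i f x\<bar> \<le> C)" for i
    using bump_bounded[OF bump_pd[OF assms, of i]] by metis
  then obtain C where C: "\<And>i. 0 \<le> C i" "\<And>i x. \<bar>pd i f x\<bar> \<le> C i" by metis
  have "norm (f x - f y) \<le> (\<Sum>i\<in>UNIV. C i) * norm (x - y)" for x y
  proof (rule differentiable_bound[of UNIV f "\<lambda>x v. \<Sum>i\<in>UNIV. v $ i * pd i f x"])
    show "onorm (\<lambda>v. \<Sum>i\<in>UNIV. v $ i * pd i f x) \<le> (\<Sum>i\<in>UNIV. C i)" for x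
    proof (rule onorm_le)
      fix v :: "real^'n"
      have "norm (\<Sum>i\<in>UNIV. v $ i * pd i f x) \<le> (\<Sum>i\<in>UNIV. norm v * C i)"
        using component_le_norm_cart[of v] C by (intro sum_norm_le) (auto simp: abs_mult intro!: mult_mono)
      then show "norm (\<Sum>i\<in>UNIV. v $ i * pd i f x) \<le> (\<Sum>i\<in>UNIV. C i) * norm v"
        by (simp add: sum_distrib_left mult.commute)
    qed
  qed (use bump_has_derivative[OF assms] in auto)
  then show ?thesis using that[of "\<Sum>i\<in>UNIV. C i"] C by (auto intro: sum_nonneg)
qed

text \<open>The second difference with the sign that makes it nonnegative at a maximum.\<close>

definition diff2 :: "(real^'n \<Rightarrow> real) \<Rightarrow> real^'n \<Rightarrow> real^'n \<Rightarrow> real" where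
  "diff2 f x z = 2 * f x - f (x + z) - f (x - z)"

text \<open>The mean value theorem is applied to t -> f(x + t z) + f(x - t z), whose increment over
  the unit interval is minus the second difference. Its derivative compares gradients at two points
  \<open>2 * t * norm z\<close> apart, and the Lipschitz bound for the partial derivatives yields
  the second factor \<open>norm z\<close>.\<close>

lemma bump_diff2:
  fixes f :: "real^'n \<Rightarrow> real"
  assumes "bump f" obtains C where "0 \<le> C" "\<And>x z. \<bar>diff2 f x z\<bar> \<le> C * (norm z)\<^sup>2"
proof -
  have "\<exists>C. 0 \<le> C \<and> (\<forall>x y. \<bar>pd i f x - pd i f y\<bar> \<le> C * norm (x - y))" for i
    using bump_lipschitz[OF bump_pd[OF assms, of i]] by metis
  then obtain C where C: "\<And>i. 0 \<le> C i" "\<And>i x y. \<bar>pd i f x - pd i f y\<bar> \<le> C i * norm (x - y)" by metis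
  let ?C = "2 * (\<Sum>i\<in>UNIV. C i)"
  have "\<bar>diff2 f x z\<bar> \<le> ?C * (norm z)\<^sup>2" for x z
  proof -
    let ?g = "\<lambda>t. f (x + t *\<^sub>R z) + f (x - t *\<^sub>R z)"
    let ?g' = "\<lambda>t. \<Sum>i\<in>UNIV. z $ i * (pd i f (x + t *\<^sub>R z) - pd i f (x - t *\<^sub>R z))"
    have d: "(?g has_real_derivative ?g' t) (at t)" for t
    proof -
      have 1: "((\<lambda>t. x + t *\<^sub>R z) has_derivative (\<lambda>u. u *\<^sub>R z)) (at t)"
        "((\<lambda>t. x - t *\<^sub>R z) has_derivative (\<lambda>u. - (u *\<^sub>R z))) (at t)"
        by (auto intro!: derivative_eq_intros)
      have "(?g has_derivative (\<lambda>u. (\<Sum>i\<in>UNIV. (u *\<^sub>R z) $ i * pd i f (x + t *\<^sub>R z)) +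
           (\<Sum>i\<in>UNIV. (- (u *\<^sub>R z)) $ i * pd i f (x - t *\<^sub>R z)))) (at t)"
        by (intro has_derivative_add has_derivative_compose[OF 1(1) bump_has_derivative[OF assms]]
            has_derivative_compose[OF 1(2) bump_has_derivative[OF assms]])
      then show ?thesis unfolding has_field_derivative_def
        by (rule has_derivative_eq_rhs) (auto simp: fun_eq_iff sum_distrib_right sum_distrib_left sum.distrib[symmetric] algebra_simps sum_subtractf sum_negf)
    qed
    obtain t where t: "0 < t" "t < 1" "?g 1 - ?g 0 = (1 - 0) * ?g' t"
      using MVT2[of 0 1 ?g ?g'] d by auto
    have "\<bar>?g' t\<bar> \<le> (\<Sum>i\<in>UNIV. norm z * (C i * (2 * norm z)))"
    proof (rule order_trans[OF sum_abs], rule sum_mono)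
      fix i
      have "\<bar>pd i f (x + t *\<^sub>R z) - pd i f (x - t *\<^sub>R z)\<bar> \<le> C i * norm ((x + t *\<^sub>R z) - (x - t *\<^sub>R z))"
        by (rule C)
      also have "(x + t *\<^sub>R z) - (x - t *\<^sub>R z) = (2 * t) *\<^sub>R z" by (simp add: scaleR_2[symmetric] flip: scaleR_scaleR)
      also have "C i * norm ((2 * t) *\<^sub>R z) \<le> C i * (2 * norm z)"
        using t C(1)[of i] by (intro mult_left_mono) (auto simp: mult_left_le_one_le)
      finally show "\<bar>z $ i * (pd i f (x + t *\<^sub>R z) - pd i f (x - t *\<^sub>R z))\<bar> \<le> norm z * (C i * (2 * norm z))"
        unfolding abs_mult by (intro mult_mono component_le_norm_cart) auto
    qed
    also have "\<dots> = ?C * (norm z)\<^sup>2" by (simp add: sum_distrib_left sum_distrib_right power2_eq_square algebra_simps)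
    finally show ?thesis using t(3) by (simp add: diff2_def)
  qed
  then show ?thesis using that[of ?C] C by (auto intro: sum_nonneg)
qed

section \<open>The symmetrised form of the operator\<close>

lemma diff2_measurable[measurable (raw)]:
  assumes [measurable]: "f \<in> borel_measurable borel" "g \<in> borel_measurable M" "h \<in> borel_measurable M"
  shows "(\<lambda>w. diff2 f (g w) (h w)) \<in> borel_measurable M"
  unfolding diff2_def by measurable

context frac_order
begin

text \<open>The quantitative content of a compactly supported function with Lipschitz gradient,
  phrased without derivatives; in this form it is stable under translation and dilation.\<close>

definition testfun :: "(real ^ 'n \<Rightarrow> real) \<Rightarrow> bool" where
  "testfun f \<longleftrightarrow> f \<in> borel_measurable borel \<and>
    (\<exists>C\<ge>0. \<exists>R\<ge>1. (\<forall>x. \<bar>f x\<bar> \<le> C) \<and> (\<forall>x. R \<le> norm x \<longrightarrow> f x = 0) \<and>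
      (\<forall>x y. \<bar>f x - f y\<bar> \<le> C * norm (x - y)) \<and> (\<forall>x z. \<bar>diff2 f x z\<bar> \<le> C * (norm z)\<^sup>2))"

lemma testfunE:
  assumes "testfun f"
  obtains C R where "0 \<le> C" "1 \<le> R" "\<And>x. \<bar>f x\<bar> \<le> C" "\<And>x. R \<le> norm x \<Longrightarrow> f x = 0"
    "\<And>x y. \<bar>f x - f y\<bar> \<le> C * norm (x - y)" "\<And>x z. \<bar>diff2 f x z\<bar> \<le> C * min 1 ((norm z)\<^sup>2)"
proof -
  obtain C R where *: "0 \<le> C" "1 \<le> R" "\<And>x. \<bar>f x\<bar> \<le> C" "\<And>x. R \<le> norm x \<Longrightarrow> f x = 0"
    "\<And>x y. \<bar>f x - f y\<bar> \<le> C * norm (x - y)" "\<And>x z. \<bar>diff2 f x z\<bar> \<le> C * (norm z)\<^sup>2"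
    using assms unfolding testfun_def by metis
  show ?thesis
  \<comment> \<open>The three terms of \<open>diff2\<close> carry the coefficients 2, 1, 1, so 4
    times the supremum bound covers the trivial estimate too.\<close>
  proof (rule that[of "4 * C" R])
    fix x z
    have "\<bar>diff2 f x z\<bar> \<le> 4 * C"
      using *(3)[of x] *(3)[of "x + z"] *(3)[of "x - z"] unfolding diff2_def by linarith
    moreover have "\<bar>diff2 f x z\<bar> \<le> 4 * C * (norm z)\<^sup>2"
      using *(6)[of x z] mult_nonneg_nonneg[OF \<open>0 \<le> C\<close> zero_le_power2[of "norm z"]] by linarith
    ultimately show "\<bar>diff2 f x z\<bar> \<le> 4 * C * min 1 ((norm z)\<^sup>2)" by (simp add: min_def)
    fix y
    show "\<bar>f x - f y\<bar> \<le> 4 * C * norm (x - y)"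
      using *(5)[of x y] mult_nonneg_nonneg[OF \<open>0 \<le> C\<close> norm_ge_zero[of "x - y"]] by linarith
    show "\<bar>f x\<bar> \<le> 4 * C" using *(3)[of x] \<open>0 \<le> C\<close> by linarith
  qed (use * in auto)
qed

lemma testfun_measurable[measurable_dest]: "testfun f \<Longrightarrow> f \<in> borel_measurable borel"
  by (simp add: testfun_def)

lemma bump_testfun: 
  assumes "bump f" shows "testfun f"
proof -
  obtain C1 C2 C3 where C: "0 \<le> C1" "\<And>x. \<bar>f x\<bar> \<le> C1" "0 \<le> C2" "\<And>x y. \<bar>f x - f y\<bar> \<le> C2 * norm (x - y)"
    "0 \<le> C3" "\<And>x z. \<bar>diff2 f x z\<bar> \<le> C3 * (norm z)\<^sup>2"
    using bump_bounded[OF assms] bump_lipschitz[OF assms] bump_diff2[OF assms] by metis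
  have "f \<in> borel_measurable borel"
    using bump_continuous[OF assms] by (rule borel_measurable_continuous_onI)
  moreover have "\<bar>f x\<bar> \<le> C1 + C2 + C3" for x using C(2)[of x] C by linarith
  moreover have "\<bar>f x - f y\<bar> \<le> (C1 + C2 + C3) * norm (x - y)" for x y
    using C by (intro order_trans[OF C(4)] mult_right_mono) auto
  moreover have "\<bar>diff2 f x z\<bar> \<le> (C1 + C2 + C3) * (norm z)\<^sup>2" for x z
    using C by (intro order_trans[OF C(6)] mult_right_mono) auto
  ultimately show ?thesis unfolding testfun_def using C bump_outside[OF assms]
    by (intro conjI exI[of _ "C1 + C2 + C3"] exI[of _ 1]) auto
qed

lemma testfun_affine:
  fixes f :: "real^'n \<Rightarrow> real"
  assumes f: "testfun f" and t: "0 < t"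
  shows "testfun (\<lambda>y. f ((1 / t) *\<^sub>R (y - x)))"
proof -
  obtain C R where C: "0 \<le> C" "1 \<le> R" "\<And>x. \<bar>f x\<bar> \<le> C" "\<And>x. R \<le> norm x \<Longrightarrow> f x = 0"
    "\<And>x y. \<bar>f x - f y\<bar> \<le> C * norm (x - y)" "\<And>x z. \<bar>diff2 f x z\<bar> \<le> C * (norm z)\<^sup>2"
    using f unfolding testfun_def by metis
  have [measurable]: "f \<in> borel_measurable borel" using f by (simp add: testfun_def)
  \<comment> \<open>A dilation by \<open>1 / t\<close> changes the supremum bound by 1, the
    Lipschitz bound by \<open>1 / t\<close> and the second difference bound by the square of
    \<open>1 / t\<close>.\<close>
  let ?C = "C * max 1 (max (1 / t) (1 / t\<^sup>2))"
  let ?g = "\<lambda>y. f ((1 / t) *\<^sub>R (y - x))"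
  show ?thesis
    unfolding testfun_def
  proof (intro conjI exI allI impI)
    show "0 \<le> ?C" using C by (simp add: max_def)
    show "1 \<le> norm x + t * R + 1" using t C by simp
    show "\<bar>?g y\<bar> \<le> ?C" for y
      using C(1) order_trans[OF C(3)] by (metis max.cobounded1 mult.right_neutral mult_left_mono)
    show "?g y = 0" if "norm x + t * R + 1 \<le> norm y" for y
    proof (rule C(4))
      have "t * R \<le> norm (y - x)" using that norm_triangle_ineq2[of y x] by linarith
      then show "R \<le> norm ((1 / t) *\<^sub>R (y - x))" using t unfolding norm_scaleR by (simp add: pos_le_divide_eq mult.commute)
    qed
    show "\<bar>?g y - ?g z\<bar> \<le> ?C * norm (y - z)" for y z
    proof -
      have "\<bar>?g y - ?g z\<bar> \<le> C * norm ((1 / t) *\<^sub>R (y - x) - (1 / t) *\<^sub>R (z - x))" by (rule C)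
      also have "(1 / t) *\<^sub>R (y - x) - (1 / t) *\<^sub>R (z - x) = (1 / t) *\<^sub>R (y - z)" by (simp add: algebra_simps)
      also have "C * norm ((1 / t) *\<^sub>R (y - z)) = C * (1 / t) * norm (y - z)" using t by simp
      also have "\<dots> \<le> ?C * norm (y - z)" using C t by (intro mult_right_mono mult_left_mono) auto
      finally show ?thesis .
    qed
    show "\<bar>diff2 ?g y z\<bar> \<le> ?C * (norm z)\<^sup>2" for y z
    proof -
      have "diff2 ?g y z = diff2 f ((1 / t) *\<^sub>R (y - x)) ((1 / t) *\<^sub>R z)"
        by (simp add: diff2_def algebra_simps)
      then have "\<bar>diff2 ?g y z\<bar> \<le> C * (norm ((1 / t) *\<^sub>R z))\<^sup>2" using C(6) by metis
      also have "\<dots> = C * (1 / t\<^sup>2) * (norm z)\<^sup>2" using t by (simp add: power_mult_distrib power_divide)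
      also have "\<dots> \<le> ?C * (norm z)\<^sup>2" using C t by (intro mult_right_mono mult_left_mono) auto
      finally show ?thesis .
    qed
  qed simp
qed

lemma testfun_integrable: "testfun f \<Longrightarrow> integrable lborel (\<lambda>x. \<bar>f x\<bar>)"
proof -
  assume f: "testfun f"
  note [measurable] = testfun_measurable[OF f]
  obtain C R where C: "0 \<le> C" "1 \<le> R" "\<And>x. \<bar>f x\<bar> \<le> C" "\<And>x. R \<le> norm x \<Longrightarrow> f x = 0"
    by (rule testfunE[OF f]) (rule that)
  have "integrable lborel (\<lambda>x. C * indicator (ball 0 R) x)"
    by (auto intro!: integrable_mult_right integrable_real_indicator emeasure_bounded_finite)
  then show ?thesis
  proof (rule Bochner_Integration.integrable_bound)
    show "AE x in lborel. norm \<bar>f x\<bar> \<le> norm (C * indicator (ball 0 R) x)"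
      using C by (intro AE_I2) (auto simp: indicator_def)
  qed simp
qed

lemma diff2_kern_integrable:
  assumes f: "testfun f"
  shows "integrable lborel (\<lambda>z. \<bar>diff2 f x z\<bar> * kern z)" "integrable lborel (\<lambda>z. diff2 f x z * kern z)"
proof -
  note [measurable] = testfun_measurable[OF f]
  obtain C where C: "0 \<le> C" "\<And>x z. \<bar>diff2 f x z\<bar> \<le> C * min 1 ((norm z)\<^sup>2)"
    by (rule testfunE[OF f]) (rule that)
  have "\<bar>diff2 f x z\<bar> * kern z \<le> \<bar>C * (min 1 ((norm z)\<^sup>2) * kern z)\<bar>" for z
    using mult_right_mono[OF C(2), of "kern z" x z] by (simp add: mult.assoc)
  then show "integrable lborel (\<lambda>z. \<bar>diff2 f x z\<bar> * kern z)" "integrable lborel (\<lambda>z. diff2 f x z * kern z)"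
    by (auto intro!: Bochner_Integration.integrable_bound[OF integrable_mult_right[OF integrable_levy, of C]] AE_I2 simp: abs_mult)
qed

text \<open>The 4 is 2 times 2: the hypotheses give \<open>norm x \<ge> 1\<close>, so
  \<open>1 + norm x \<le> 2 * norm x\<close>, and \<open>norm x\<close> is at most
  \<open>2 * norm z\<close>.\<close>

lemma kern_far_le:
  fixes x z :: "real^'n"
  assumes "1 \<le> R" "2 * R \<le> norm x" "norm x \<le> 2 * norm z"
  shows "kern z \<le> 4 powr (real CARD('n) + 2 * s) * wt x"
  using assms by (intro kern_le_wt) auto

lemma wt_near_le:
  fixes x :: "real^'n"
  assumes "norm x \<le> R" shows "1 \<le> (1 + R) powr (real CARD('n) + 2 * s) * wt x"
  using wt_scale[of "1 + R" x "0 :: real^'n"] assms by (auto simp: wt_def intro: order_trans[OF norm_ge_zero])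

text \<open>Near the support the integral is bounded by that of \<open>integrable_levy\<close>. Far
  from it \<open>f x\<close> vanishes, and only those \<open>z\<close> contribute for which x + z or
  x - z meets the support; they satisfy \<open>norm x \<le> 2 * norm z\<close>, so the kernel is
  already of size \<open>wt x\<close> and the L^1 norm of \<open>f\<close> remains.\<close>

lemma diff2_kern_tail:
  fixes f :: "real^'n \<Rightarrow> real"
  assumes f: "testfun f"
  obtains C where "0 \<le> C" "\<And>x. (\<integral>z. \<bar>diff2 f x z\<bar> * kern z \<partial>lborel) \<le> C * wt x"
proof -
  note [measurable] = testfun_measurable[OF f]
  obtain C R where C: "0 \<le> C" "1 \<le> R" "\<And>x. \<bar>f x\<bar> \<le> C" "\<And>x. R \<le> norm x \<Longrightarrow> f x = 0"
     "\<And>x z. \<bar>diff2 f x z\<bar> \<le> C * min 1 ((norm z)\<^sup>2)"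
    by (rule testfunE[OF f]) (rule that)
  let ?a = "real CARD('n) + 2 * s"
  let ?J = "\<integral>z. min 1 ((norm z)\<^sup>2) * kern z \<partial>(lborel :: (real^'n) measure)"
  let ?I = "\<integral>y. \<bar>f y\<bar> \<partial>lborel"
  let ?C = "(1 + 2 * R) powr ?a * (C * ?J) + 4 powr ?a * (2 * ?I)"
  have J: "0 \<le> ?J" and I: "0 \<le> ?I" by (auto intro!: Bochner_Integration.integral_nonneg)
  have *: "(\<integral>z. \<bar>diff2 f x z\<bar> * kern z \<partial>lborel) \<le> ?C * wt x" for x
  proof (cases "norm x \<le> 2 * R")
    case True
    have "(\<integral>z. \<bar>diff2 f x z\<bar> * kern z \<partial>lborel) \<le> (\<integral>z. C * (min 1 ((norm z)\<^sup>2) * kern z) \<partial>(lborel :: (real^'n) measure))"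
    proof (intro Bochner_Integration.integral_mono diff2_kern_integrable[OF f] integrable_mult_right integrable_levy)
      fix z :: "real^'n" show "\<bar>diff2 f x z\<bar> * kern z \<le> C * (min 1 ((norm z)\<^sup>2) * kern z)"
        using mult_right_mono[OF C(5), of "kern z" x z] by (simp add: mult.assoc)
    qed
    also have "\<dots> = C * ?J" by simp
    also have "\<dots> \<le> ((1 + 2 * R) powr ?a * wt x) * (C * ?J)"
      using mult_right_mono[OF wt_near_le[OF True], of "C * ?J"] C(1) J by simp
    also have "\<dots> \<le> ?C * wt x" using I by (simp add: distrib_right)
    finally show ?thesis .
  next
    case False
    have int: "integrable lborel (\<lambda>z. \<bar>f (x + z)\<bar>)" "integrable lborel (\<lambda>z. \<bar>f (x - z)\<bar>)"
      using lborel_integral_affine(2)[of "\<lambda>y. \<bar>f y\<bar>" 1 x] lborel_integral_affine(2)[of "\<lambda>y. \<bar>f y\<bar>" "-1" x]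
        testfun_integrable[OF f] by simp_all
    have v: "(\<integral>z. \<bar>f (x + z)\<bar> \<partial>lborel) = ?I" "(\<integral>z. \<bar>f (x - z)\<bar> \<partial>lborel) = ?I"
      using lborel_integral_affine(1)[of "\<lambda>y. \<bar>f y\<bar>" 1 x] lborel_integral_affine(1)[of "\<lambda>y. \<bar>f y\<bar>" "-1" x] by simp_all
    have "\<bar>diff2 f x z\<bar> * kern z \<le> (4 powr ?a * wt x) * (\<bar>f (x + z)\<bar> + \<bar>f (x - z)\<bar>)" for z
    proof -
      have "f x = 0" using C False by auto
      then have d: "\<bar>diff2 f x z\<bar> \<le> \<bar>f (x + z)\<bar> + \<bar>f (x - z)\<bar>" by (simp add: diff2_def)
      show ?thesis
      proof (cases "norm x \<le> 2 * norm z")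
        case True
        have "\<bar>diff2 f x z\<bar> * kern z \<le> (\<bar>f (x + z)\<bar> + \<bar>f (x - z)\<bar>) * (4 powr ?a * wt x)"
          using False True C(2) by (intro mult_mono d kern_far_le[of R]) auto
        then show ?thesis by (simp add: mult.commute)
      next
        case z: False
        have "R \<le> norm (x + z)" "R \<le> norm (x - z)"
          using z False norm_triangle_ineq2[of x z] norm_triangle_ineq2[of x "- z"] by auto
        then show ?thesis using C(4) \<open>f x = 0\<close> by (simp add: diff2_def)
      qed
    qed
    then have "(\<integral>z. \<bar>diff2 f x z\<bar> * kern z \<partial>lborel) \<le> (\<integral>z. (4 powr ?a * wt x) * (\<bar>f (x + z)\<bar> + \<bar>f (x - z)\<bar>) \<partial>lborel)"
      using int by (intro Bochner_Integration.integral_mono diff2_kern_integrable[OF f] integrable_mult_right) auto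
    also have "\<dots> = (4 powr ?a * wt x) * (2 * ?I)" using int by (simp add: v)
    also have "\<dots> \<le> ?C * wt x" using J C by (simp add: distrib_right)
    finally show ?thesis .
  qed
  have "0 \<le> ?C" using I J C by simp
  then show ?thesis using * by (rule that)
qed

section \<open>The operator, its truncations and the bilinear form\<close>

definition Lop :: "(real ^ 'n \<Rightarrow> real) \<Rightarrow> real ^ 'n \<Rightarrow> real" where
  "Lop f x = (\<integral>z. diff2 f x z * kern z \<partial>lborel) / 2"

definition kern_ge :: "real \<Rightarrow> real ^ 'n \<Rightarrow> real" where
  "kern_ge e z = indicator {e..} (norm z) * kern z"

text \<open>Cut off at distance \<open>e\<close>, first differences are absolutely integrable
  against the kernel. \<open>Lop\<close> needs second differences, whose quadratic smallness
  compensates the singularity for every s below 1; it is the fractional Laplacian without its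
  normalising constant, the division by 2 undoing the symmetrisation.\<close>

definition Ltr :: "real \<Rightarrow> (real ^ 'n \<Rightarrow> real) \<Rightarrow> real ^ 'n \<Rightarrow> real" where
  "Ltr e f x = (\<integral>y. (f x - f y) * kern_ge e (x - y) \<partial>lborel)"

lemma kern_ge_measurable[measurable]: "kern_ge e \<in> borel_measurable borel"
  unfolding kern_ge_def[abs_def] by measurable

lemma kern_ge_nonneg[simp]: "0 \<le> kern_ge e z" by (simp add: kern_ge_def)
lemma kern_ge_le: "kern_ge e z \<le> kern z" by (simp add: kern_ge_def indicator_def)
lemma kern_ge_minus[simp]: "kern_ge e (- z) = kern_ge e z" by (simp add: kern_ge_def)
lemma kern_ge_commute: "kern_ge e (x - y) = kern_ge e (y - x)" by (metis kern_ge_minus minus_diff_eq)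

lemma kern_ge_tendsto: "(\<lambda>m. kern_ge (1 / real (Suc m)) z) \<longlonglongrightarrow> kern z"
proof (cases "z = 0")
  case True then show ?thesis by (simp add: kern_ge_def kern_def)
next
  case False
  have "\<forall>\<^sub>F m in sequentially. 1 / real (Suc m) < norm z"
    using order_tendstoD(2)[OF LIMSEQ_inverse_real_of_nat, of "norm z"] False by (simp add: inverse_eq_divide)
  then have "\<forall>\<^sub>F m in sequentially. kern z = kern_ge (1 / real (Suc m)) z"
    by eventually_elim (simp add: kern_ge_def)
  then show ?thesis by (rule Lim_transform_eventually[OF tendsto_const])
qed

lemma Lop_measurable[measurable]: 
  assumes [measurable]: "f \<in> borel_measurable borel"
  shows "Lop f \<in> borel_measurable borel"
  unfolding Lop_def[abs_def] by measurable

lemma Ltr_measurable[measurable]: 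
  assumes [measurable]: "f \<in> borel_measurable borel"
  shows "Ltr e f \<in> borel_measurable borel"
  unfolding Ltr_def[abs_def] by measurable

text \<open>The substitutions y = x + z and y = x - z give the same value because the kernel is
  even, and their sum is the second difference. The truncation lets both integrals converge
  separately.\<close>

lemma Ltr_eq:
  fixes f :: "real^'n \<Rightarrow> real"
  assumes f: "testfun f" and e: "0 < e"
  shows "Ltr e f x = (\<integral>z. diff2 f x z * kern_ge e z \<partial>lborel) / 2"
proof -
  note [measurable] = testfun_measurable[OF f]
  obtain C where C: "0 \<le> C" "\<And>x. \<bar>f x\<bar> \<le> C" by (rule testfunE[OF f]) (rule that)
  have i: "integrable lborel (\<lambda>z. (f x - f (x + c *\<^sub>R z)) * kern_ge e z)" for c
  proof (rule Bochner_Integration.integrable_bound)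
    show "integrable lborel (\<lambda>z::real^'n. (2 * C) * kern_ge e z)"
      unfolding kern_ge_def by (intro integrable_mult_right integrable_kern_far e)
    have "\<bar>f x - f (x + c *\<^sub>R z)\<bar> \<le> 2 * C" for z using C(2)[of x] C(2)[of "x + c *\<^sub>R z"] by linarith
    then show "AE z in lborel. norm ((f x - f (x + c *\<^sub>R z)) * kern_ge e z) \<le> norm (2 * C * kern_ge e z)"
      using C by (intro AE_I2) (auto simp: abs_mult intro!: mult_right_mono)
  qed simp
  have "Ltr e f x = (\<integral>z. (f x - f (x + c *\<^sub>R z)) * kern_ge e z \<partial>lborel)" if "c = 1 \<or> c = -1" for c
  proof -
    have "(\<integral>z. (f x - f (x + c *\<^sub>R z)) * kern_ge e z \<partial>lborel) =
      (\<integral>z. (\<lambda>y. (f x - f y) * kern_ge e (x - y)) (x + c *\<^sub>R z) \<partial>lborel)"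
      using that by (intro Bochner_Integration.integral_cong) auto
    also have "\<dots> = Ltr e f x"
      using that by (subst lborel_integral_affine(1)) (auto simp: Ltr_def)
    finally show ?thesis by simp
  qed
  from this[of 1] this[of "-1"] have "2 * Ltr e f x =
    (\<integral>z. (f x - f (x + 1 *\<^sub>R z)) * kern_ge e z \<partial>lborel) + (\<integral>z. (f x - f (x + (-1) *\<^sub>R z)) * kern_ge e z \<partial>lborel)" by simp
  also have "\<dots> = (\<integral>z. (f x - f (x + 1 *\<^sub>R z)) * kern_ge e z + (f x - f (x + (-1) *\<^sub>R z)) * kern_ge e z \<partial>lborel)"
    by (rule Bochner_Integration.integral_add[symmetric, OF i i])
  also have "\<dots> = (\<integral>z. diff2 f x z * kern_ge e z \<partial>lborel)"
    by (simp add: diff2_def algebra_simps)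
  finally show ?thesis by simp
qed

text \<open>The truncated kernel lies below \<open>kern\<close>, so the absolute second difference
  integral bounds all truncations at once. Uniformity in \<open>e\<close> is what allows the cut-off
  to be removed under the integral sign.\<close>

lemma Ltr_bound:
  fixes f :: "real^'n \<Rightarrow> real"
  assumes f: "testfun f"
  obtains C where "0 \<le> C" "\<And>e x. 0 < e \<Longrightarrow> \<bar>Ltr e f x\<bar> \<le> C * wt x" "\<And>x. \<bar>Lop f x\<bar> \<le> C * wt x"
proof -
  note [measurable] = testfun_measurable[OF f]
  obtain C where C: "0 \<le> C" "\<And>x. (\<integral>z. \<bar>diff2 f x z\<bar> * kern z \<partial>lborel) \<le> C * wt x"
    by (rule diff2_kern_tail[OF f]) (rule that)
  have le: "\<bar>\<integral>z. diff2 f x z * k z \<partial>lborel\<bar> \<le> C * wt x"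
    if [measurable]: "k \<in> borel_measurable borel" and k: "\<And>z. 0 \<le> k z" "\<And>z. k z \<le> kern z" for k x
  proof -
    have "norm (\<integral>z. diff2 f x z * k z \<partial>lborel) \<le> (\<integral>z. \<bar>diff2 f x z\<bar> * kern z \<partial>lborel)"
    proof (rule Bochner_Integration.integral_norm_bound_integral)
      show "integrable lborel (\<lambda>z. diff2 f x z * k z)"
        by (rule Bochner_Integration.integrable_bound[OF diff2_kern_integrable(1)[OF f, of x]])
          (use k in \<open>auto simp: abs_mult intro!: AE_I2 mult_left_mono\<close>)
    qed (use k diff2_kern_integrable(1)[OF f] in \<open>auto simp: abs_mult intro!: mult_left_mono\<close>)
    with C(2)[of x] show ?thesis by simp
  qed
  have h: "\<bar>a / 2\<bar> \<le> b" if "\<bar>a\<bar> \<le> b" for a b :: real using that by simp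
  show ?thesis
    by (rule that[OF C(1)])
      (auto simp: Ltr_eq[OF f] Lop_def kern_ge_le simp del: abs_divide intro!: h le)
qed

lemma Ltr_tendsto:
  assumes f: "testfun f"
  shows "(\<lambda>m. Ltr (1 / real (Suc m)) f x) \<longlonglongrightarrow> Lop f x"
proof -
  note [measurable] = testfun_measurable[OF f]
  have "(\<lambda>m. \<integral>z. diff2 f x z * kern_ge (1 / real (Suc m)) z \<partial>lborel) \<longlonglongrightarrow> (\<integral>z. diff2 f x z * kern z \<partial>lborel)"
    by (rule integral_dominated_convergence[where w="\<lambda>z. \<bar>diff2 f x z\<bar> * kern z"])
      (auto intro!: diff2_kern_integrable f tendsto_mult kern_ge_tendsto AE_I2 mult_left_mono kern_ge_le simp: abs_mult simp del: of_nat_Suc)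
  then show ?thesis by (simp add: Ltr_eq[OF f] Lop_def tendsto_divide)
qed

text \<open>Scalar Borel functions of L^1_2s, with the weight \<open>wt\<close>.\<close>

definition tame :: "(real ^ 'n \<Rightarrow> real) \<Rightarrow> bool" where
  "tame u \<longleftrightarrow> u \<in> borel_measurable borel \<and> integrable lborel (\<lambda>x. u x * wt x)"

lemma tame_measurable[measurable_dest]: "tame u \<Longrightarrow> u \<in> borel_measurable borel"
  by (simp add: tame_def)

lemma tame_integrable_bound:
  assumes u: "tame u" and [measurable]: "g \<in> borel_measurable borel" and g: "\<And>x. \<bar>g x\<bar> \<le> C * wt x"
  shows "integrable lborel (\<lambda>x. u x * g x)"
proof -
  note [measurable] = tame_measurable[OF u]
  have "integrable lborel (\<lambda>x. C * (u x * wt x))" using u by (simp add: tame_def)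
  then show ?thesis
  proof (rule Bochner_Integration.integrable_bound)
    show "AE x in lborel. norm (u x * g x) \<le> norm (C * (u x * wt x))"
    proof (rule AE_I2)
      fix x
      have "\<bar>u x\<bar> * \<bar>g x\<bar> \<le> \<bar>u x\<bar> * (C * wt x)" by (intro mult_left_mono g) auto
      also have "\<dots> \<le> \<bar>C * (u x * wt x)\<bar>" by (simp add: abs_mult) (metis abs_ge_self mult.left_commute mult_right_mono wt_nonneg zero_le_mult_iff abs_ge_zero mult.assoc)
      finally show "norm (u x * g x) \<le> norm (C * (u x * wt x))" by (simp add: abs_mult)
    qed
  qed simp
qed

text \<open>Absolute values destroy the cancellation in first differences, so here the constant may
  depend on \<open>e\<close>. The bound serves only to justify Fubini at a fixed cut-off.\<close>

lemma trunc_abs_bound: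
  fixes f :: "real^'n \<Rightarrow> real"
  assumes f: "testfun f" and e: "0 < e"
  shows "integrable lborel (\<lambda>y. \<bar>f x - f y\<bar> * kern_ge e (x - y))" (is ?I)
    and "\<exists>C. \<forall>x. (\<integral>y. \<bar>f x - f y\<bar> * kern_ge e (x - y) \<partial>lborel) \<le> C * wt x" (is ?B)
proof -
  note [measurable] = testfun_measurable[OF f]
  obtain C R where C: "0 \<le> C" "1 \<le> R" "\<And>x. \<bar>f x\<bar> \<le> C" "\<And>x. R \<le> norm x \<Longrightarrow> f x = 0"
    by (rule testfunE[OF f]) (rule that)
  let ?a = "real CARD('n) + 2 * s"
  let ?K = "\<integral>z. kern_ge e z \<partial>(lborel :: (real^'n) measure)"
  let ?A = "\<integral>y. \<bar>f y\<bar> \<partial>lborel"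
  have K: "integrable lborel (\<lambda>y. kern_ge e (x - y))" "(\<integral>y. kern_ge e (x - y) \<partial>lborel) = ?K" for x :: "real^'n"
    using lborel_integral_affine[of "kern_ge e :: real^'n \<Rightarrow> real" "-1" x] integrable_kern_far[OF e, where 'n='n] by (simp_all add: kern_ge_def[abs_def])
  have d: "\<bar>f x - f y\<bar> \<le> 2 * C" for x y using C(3)[of x] C(3)[of y] by linarith
  show int: "integrable lborel (\<lambda>y. \<bar>f x - f y\<bar> * kern_ge e (x - y))" for x
    by (rule Bochner_Integration.integrable_bound[OF integrable_mult_right[OF K(1)[of x], of "2 * C"]])
      (use C in \<open>auto intro!: AE_I2 mult_right_mono d simp: abs_mult\<close>)
  have nn: "0 \<le> ?K" "0 \<le> ?A" by (auto intro!: Bochner_Integration.integral_nonneg)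
  let ?C = "(1 + 2 * R) powr ?a * (2 * C * ?K) + 4 powr ?a * ?A"
  have "(\<integral>y. \<bar>f x - f y\<bar> * kern_ge e (x - y) \<partial>lborel) \<le> ?C * wt x" for x
  proof (cases "norm x \<le> 2 * R")
    case True
    have "(\<integral>y. \<bar>f x - f y\<bar> * kern_ge e (x - y) \<partial>lborel) \<le> (\<integral>y. (2 * C) * kern_ge e (x - y) \<partial>lborel)"
      by (intro Bochner_Integration.integral_mono int integrable_mult_right K mult_right_mono d) simp
    also have "\<dots> = 2 * C * ?K" by (simp add: K(2))
    also have "\<dots> \<le> ((1 + 2 * R) powr ?a * wt x) * (2 * C * ?K)"
      using mult_right_mono[OF wt_near_le[OF True], of "2 * C * ?K"] C(1) nn by simp
    also have "\<dots> \<le> ?C * wt x" using nn by (simp add: distrib_right)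
    finally show ?thesis .
  next
    case False
    have "\<bar>f x - f y\<bar> * kern_ge e (x - y) \<le> (4 powr ?a * wt x) * \<bar>f y\<bar>" for y
    proof -
      have x: "f x = 0" using C False by auto
      show ?thesis
      proof (cases "norm x \<le> 2 * norm (x - y)")
        case True
        have "\<bar>f y\<bar> * kern_ge e (x - y) \<le> \<bar>f y\<bar> * (4 powr ?a * wt x)"
          using False True C(2) by (intro mult_left_mono order_trans[OF kern_ge_le] kern_far_le[of R]) auto
        then show ?thesis by (simp add: mult.commute x)
      next
        case z: False
        have "R \<le> norm y"
          using z False norm_triangle_ineq2[of x "x - y"] by auto
        then show ?thesis using C(4) x by simp
      qed
    qed
    then have "(\<integral>y. \<bar>f x - f y\<bar> * kern_ge e (x - y) \<partial>lborel) \<le> (\<integral>y. (4 powr ?a * wt x) * \<bar>f y\<bar> \<partial>lborel)"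
      by (intro Bochner_Integration.integral_mono int integrable_mult_right testfun_integrable[OF f]) 
    also have "\<dots> = (4 powr ?a * wt x) * ?A" by simp
    also have "\<dots> \<le> ?C * wt x" using nn C by (simp add: distrib_right)
    finally show ?thesis .
  qed
  then show ?B by blast
qed

text \<open>Expanding \<open>u x - u y\<close> gives two integrals exchanged by swapping the
  variables, hence equal. Each converges on its own because of the cut-off.\<close>

lemma trunc_form_eq:
  assumes u: "tame u" and f: "testfun f" and e: "0 < e"
  shows "(\<integral>(x, y). (u x - u y) * (f x - f y) * kern_ge e (x - y) \<partial>(lborel \<Otimes>\<^sub>M lborel)) = 2 * (\<integral>x. u x * Ltr e f x \<partial>lborel)"
proof -
  note [measurable] = testfun_measurable[OF f] tame_measurable[OF u]
  let ?F = "\<lambda>(x, y). u x * ((f x - f y) * kern_ge e (x - y))"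
  obtain C where C: "\<And>x. (\<integral>y. \<bar>f x - f y\<bar> * kern_ge e (x - y) \<partial>lborel) \<le> C * wt x"
    using trunc_abs_bound(2)[OF f e] by blast
  have F: "integrable (lborel \<Otimes>\<^sub>M lborel) ?F"
  proof (rule lborel_pair.Fubini_integrable)
    show "?F \<in> borel_measurable (lborel \<Otimes>\<^sub>M lborel)" by measurable
    have "integrable lborel (\<lambda>x. u x * (\<integral>y. \<bar>f x - f y\<bar> * kern_ge e (x - y) \<partial>lborel))"
      by (rule tame_integrable_bound[OF u, where C=C]) (use C in \<open>auto simp: Bochner_Integration.integral_nonneg\<close>)
    then have "integrable lborel (\<lambda>x. norm (u x * (\<integral>y. \<bar>f x - f y\<bar> * kern_ge e (x - y) \<partial>lborel)))"
      by (rule integrable_norm)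
    then show "integrable lborel (\<lambda>x. \<integral>y. norm (?F (x, y)) \<partial>lborel)"
      by (simp add: abs_mult Bochner_Integration.integral_nonneg)
    show "AE x in lborel. integrable lborel (\<lambda>y. ?F (x, y))"
    proof (rule AE_I2)
      fix x
      have "integrable lborel (\<lambda>y. (f x - f y) * kern_ge e (x - y))"
        by (rule Bochner_Integration.integrable_bound[OF trunc_abs_bound(1)[OF f e, of x]]) (auto simp: abs_mult)
      then show "integrable lborel (\<lambda>y. ?F (x, y))" by simp
    qed
  qed
  have F': "integrable (lborel \<Otimes>\<^sub>M lborel) (\<lambda>(x, y). ?F (y, x))" using lborel_pair.integrable_product_swap[OF F] .
  have "(\<integral>(x, y). (u x - u y) * (f x - f y) * kern_ge e (x - y) \<partial>(lborel \<Otimes>\<^sub>M lborel)) =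
    (\<integral>w. ?F w + (case w of (x, y) \<Rightarrow> ?F (y, x)) \<partial>(lborel \<Otimes>\<^sub>M lborel))"
    by (intro Bochner_Integration.integral_cong) (auto simp: algebra_simps kern_ge_commute)
  also have "\<dots> = integral\<^sup>L (lborel \<Otimes>\<^sub>M lborel) ?F + integral\<^sup>L (lborel \<Otimes>\<^sub>M lborel) (\<lambda>(x, y). ?F (y, x))"
    by (rule Bochner_Integration.integral_add[OF F F'])
  also have "integral\<^sup>L (lborel \<Otimes>\<^sub>M lborel) (\<lambda>(x, y). ?F (y, x)) = integral\<^sup>L (lborel \<Otimes>\<^sub>M lborel) ?F"
    by (rule lborel_pair.integral_product_swap) measurable
  also have "integral\<^sup>L (lborel \<Otimes>\<^sub>M lborel) ?F = (\<integral>x. (\<integral>y. ?F (x, y) \<partial>lborel) \<partial>lborel)"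
    by (rule lborel_pair.integral_fst'[symmetric, OF F])
  also have "\<dots> = (\<integral>x. u x * Ltr e f x \<partial>lborel)" by (simp add: Ltr_def)
  finally show ?thesis by simp
qed

text \<open>The limit is controlled through \<open>Ltr\<close>, with its bound uniform in the
  cut-off, and not through the double integral. Hence it is available for constants and for
  indicators of balls, which give the integral of \<open>P\<close> and the sign of its integrals
  over balls.\<close>

lemma trunc_form_tendsto:
  assumes u: "tame u" and f: "testfun f"
  shows "(\<lambda>m. \<integral>(x, y). (u x - u y) * (f x - f y) * kern_ge (1 / real (Suc m)) (x - y) \<partial>(lborel \<Otimes>\<^sub>M lborel))
    \<longlonglongrightarrow> 2 * (\<integral>x. u x * Lop f x \<partial>lborel)"
proof -
  note [measurable] = testfun_measurable[OF f] tame_measurable[OF u]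
  obtain C where C: "0 \<le> C" "\<And>e x. 0 < e \<Longrightarrow> \<bar>Ltr e f x\<bar> \<le> C * wt x" "\<And>x. \<bar>Lop f x\<bar> \<le> C * wt x"
    by (rule Ltr_bound[OF f]) (rule that)
  have "(\<lambda>m. \<integral>x. u x * Ltr (1 / real (Suc m)) f x \<partial>lborel) \<longlonglongrightarrow> (\<integral>x. u x * Lop f x \<partial>lborel)"
  proof (rule integral_dominated_convergence[where w="\<lambda>x. \<bar>u x * (C * wt x)\<bar>"])
    show "integrable lborel (\<lambda>x. \<bar>u x * (C * wt x)\<bar>)"
      by (intro integrable_abs tame_integrable_bound[OF u, where C=C]) (auto simp: C abs_mult)
    show "AE x in lborel. norm (u x * Ltr (1 / real (Suc m)) f x) \<le> \<bar>u x * (C * wt x)\<bar>" for m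
      using C by (intro AE_I2) (auto simp: abs_mult intro!: mult_left_mono)
  qed (auto intro!: tendsto_mult Ltr_tendsto f AE_I2 simp del: of_nat_Suc)
  then show ?thesis by (simp add: trunc_form_eq[OF u f] tendsto_mult)
qed

text \<open>Absolute integrability of the full form, which the weak formulation supplies, is the
  majorant that identifies it with the limit of its truncations.\<close>

lemma form_eq:
  assumes u: "tame u" and f: "testfun f"
    and E: "integrable (lborel \<Otimes>\<^sub>M lborel) (\<lambda>(x, y). (u x - u y) * (f x - f y) * kern (x - y))"
  shows "(\<integral>(x, y). (u x - u y) * (f x - f y) * kern (x - y) \<partial>(lborel \<Otimes>\<^sub>M lborel)) = 2 * (\<integral>x. u x * Lop f x \<partial>lborel)"
proof (rule LIMSEQ_unique[OF _ trunc_form_tendsto[OF u f]])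
  note [measurable] = testfun_measurable[OF f] tame_measurable[OF u]
  show "(\<lambda>m. \<integral>(x, y). (u x - u y) * (f x - f y) * kern_ge (1 / real (Suc m)) (x - y) \<partial>(lborel \<Otimes>\<^sub>M lborel))
    \<longlonglongrightarrow> (\<integral>(x, y). (u x - u y) * (f x - f y) * kern (x - y) \<partial>(lborel \<Otimes>\<^sub>M lborel))"
    by (rule integral_dominated_convergence[OF _ _ integrable_norm[OF E]])
      (auto intro!: tendsto_mult kern_ge_tendsto AE_I2 mult_left_mono kern_ge_le simp: abs_mult simp del: of_nat_Suc)
qed

end

section \<open>Smoothness, symmetry and sign of \<open>P\<close>\<close>

context frac_order
begin

text \<open>Second differences commute with differentiation, and those of the partial derivatives
  obey the same bound by \<open>min 1 ((norm z)\<^sup>2)\<close> uniformly in the base point;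
  \<open>integrable_levy\<close> then gives the majorant for differentiating under the
  integral.\<close>

lemma Lop_has_derivative:
  fixes f :: "real^'n \<Rightarrow> real"
  assumes f: "bump f"
  shows "(Lop f has_derivative (\<lambda>v. \<Sum>i\<in>UNIV. v $ i * Lop (pd i f) x)) (at x)"
proof -
  have "\<exists>C. 0 \<le> C \<and> (\<forall>x (z :: real^'n). \<bar>diff2 (pd i f) x z\<bar> \<le> C * min 1 ((norm z)\<^sup>2))" for i
    using testfunE[OF bump_testfun[OF bump_pd[OF f, of i]]] by metis
  then obtain C where C: "\<And>i. 0 \<le> C i" "\<And>i x (z :: real^'n). \<bar>diff2 (pd i f) x z\<bar> \<le> C i * min 1 ((norm z)\<^sup>2)" by metis
  note [measurable] = testfun_measurable[OF bump_testfun[OF f]] testfun_measurable[OF bump_testfun[OF bump_pd[OF f]]]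
  have "((\<lambda>x. \<integral>z. diff2 f x z * kern z \<partial>lborel) has_derivative
    (\<lambda>v. \<Sum>i\<in>UNIV. v $ i *\<^sub>R (\<integral>z. diff2 (pd i f) x z * kern z \<partial>lborel))) (at x)"
  proof (rule has_derivative_integral_param[where r=1 and b="\<lambda>z. (\<Sum>i\<in>UNIV. C i) * (min 1 ((norm z)\<^sup>2) * kern z)"])
    show "integrable lborel (\<lambda>z. diff2 f y z * kern z)" for y
      by (rule diff2_kern_integrable[OF bump_testfun[OF f]])
    show "integrable lborel (\<lambda>z::real^'n. (\<Sum>i\<in>UNIV. C i) * (min 1 ((norm z)\<^sup>2) * kern z))"
      by (intro integrable_mult_right integrable_levy)
    show "norm (diff2 (pd i f) y z * kern z) \<le> (\<Sum>i\<in>UNIV. C i) * (min 1 ((norm z)\<^sup>2) * kern z)" for i y and z :: "real^'n"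
    proof -
      have "\<bar>diff2 (pd i f) y z\<bar> \<le> (\<Sum>i\<in>UNIV. C i) * min 1 ((norm z)\<^sup>2)"
        by (rule order_trans[OF C(2)]) (auto intro!: mult_right_mono member_le_sum C)
      from mult_right_mono[OF this kern_nonneg[of z]] show ?thesis by (simp add: abs_mult mult.assoc)
    qed
    fix y z :: "real^'n"
    note d = bump_has_derivative[OF f]
    have 1: "((\<lambda>x. x + z) has_derivative (\<lambda>v. v)) (at y)" "((\<lambda>x. x - z) has_derivative (\<lambda>v. v)) (at y)"
      by (auto intro!: derivative_eq_intros)
    have "((\<lambda>x. diff2 f x z * kern z) has_derivative (\<lambda>v. (2 * (\<Sum>i\<in>UNIV. v $ i * pd i f y) -
       (\<Sum>i\<in>UNIV. v $ i * pd i f (y + z)) - (\<Sum>i\<in>UNIV. v $ i * pd i f (y - z))) * kern z)) (at y)"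
      unfolding diff2_def
      by (intro has_derivative_mult_left has_derivative_diff has_derivative_mult_right d
          has_derivative_compose[OF 1(1) d] has_derivative_compose[OF 1(2) d])
    then show "((\<lambda>x. diff2 f x z * kern z) has_derivative (\<lambda>v. \<Sum>i\<in>UNIV. v $ i *\<^sub>R (diff2 (pd i f) y z * kern z))) (at y)"
      by (rule has_derivative_eq_rhs)
        (auto simp: fun_eq_iff diff2_def sum_distrib_left sum_distrib_right sum_subtractf sum.distrib algebra_simps)
  qed simp_all
  then have "((\<lambda>x. (\<integral>z. diff2 f x z * kern z \<partial>lborel) / 2) has_derivative
    (\<lambda>v. (\<Sum>i\<in>UNIV. v $ i *\<^sub>R (\<integral>z. diff2 (pd i f) x z * kern z \<partial>lborel)) / 2)) (at x)"
    by (rule bounded_linear.has_derivative[OF bounded_linear_divide])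
  then show ?thesis by (simp add: Lop_def[abs_def] sum_divide_distrib)
qed

lemma pd_Lop: "bump f \<Longrightarrow> pd i (Lop f) = Lop (pd i f)"
  by (rule ext) (rule pd_eq[OF Lop_has_derivative])

lemma pds_Lop: "bump f \<Longrightarrow> pds is (Lop f) = Lop (pds is f)"
  by (induction "is") (auto simp: pd_Lop bump_pds)

text \<open>The unnormalised standard mollifier exp(-1 / (1 - |x|^2)). What matters later is
  smoothness, support in the unit ball, positivity at 0 and radial monotonicity.\<close>

definition chi :: "real^'n \<Rightarrow> real" where
  "chi x = bexp 1 (x \<bullet> x)"

definition P :: "real^'n \<Rightarrow> real" where
  "P = Lop chi"

lemma bump_chi: "bump chi"
  using bump.base[of 1] by (simp add: chi_def[abs_def])

lemma P_has_derivative: "(pds is P has_derivative (\<lambda>v. \<Sum>i\<in>UNIV. v $ i * pds (i # is) P x)) (at x)"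
  unfolding P_def pds.simps pds_Lop[OF bump_chi] pd_Lop[OF bump_pds[OF bump_chi]]
  by (rule Lop_has_derivative[OF bump_pds[OF bump_chi]])

lemma P_bound: obtains C where "0 \<le> C" "\<And>x. \<bar>pds is P x\<bar> \<le> C * wt x"
  unfolding P_def pds_Lop[OF bump_chi] using Ltr_bound[OF bump_testfun[OF bump_pds[OF bump_chi]]] by metis

lemma P_continuous: "continuous_on A (pds is P)"
  by (meson P_has_derivative continuous_at_imp_continuous_on has_derivative_continuous)

lemma P_measurable[measurable]: "pds is P \<in> borel_measurable borel" "P \<in> borel_measurable borel"
  using P_continuous[of UNIV "is"] P_continuous[of UNIV "[]"] by (auto intro: borel_measurable_continuous_onI)

lemma P_integrable: "integrable lborel (P :: real^'n \<Rightarrow> real)"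
proof -
  obtain C where "0 \<le> C" "\<And>x :: real^'n. \<bar>P x\<bar> \<le> C * wt x" using P_bound[of "[]"] by auto
  then show ?thesis
    by (intro Bochner_Integration.integrable_bound[OF integrable_mult_right[OF integrable_wt, of C]])
      (auto intro!: AE_I2)
qed

lemma tame_bounded:
  assumes [measurable]: "u \<in> borel_measurable borel" and "\<And>x. \<bar>u x\<bar> \<le> 1" shows "tame u"
  unfolding tame_def using assms
  by (auto intro!: Bochner_Integration.integrable_bound[OF integrable_wt] AE_I2 mult_left_le_one_le simp: abs_mult)

text \<open>Paired with the constant 1 all truncated forms vanish identically, hence so does their
  limit.\<close>

lemma integral_P: "(\<integral>x. P x \<partial>(lborel :: (real^'n) measure)) = 0"
proof -
  have "tame (\<lambda>x::real^'n. 1)" by (rule tame_bounded) auto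
  from trunc_form_tendsto[OF this bump_testfun[OF bump_chi]] have "2 * (\<integral>x. P (x :: real^'n) \<partial>lborel) = 0"
    by (simp add: P_def LIMSEQ_const_iff case_prod_beta' del: of_nat_Suc)
  then show ?thesis by simp
qed

lemma chi_antimono:
  fixes x y :: "real^'n"
  shows "norm x \<le> norm y \<Longrightarrow> chi y \<le> chi x"
proof -
  assume "norm x \<le> norm y"
  then have xy: "x \<bullet> x \<le> y \<bullet> y" by (simp add: dot_square_norm power_mono)
  show ?thesis
  proof (cases "y \<bullet> y < 1")
    case True
    with xy have "1 / (1 - x \<bullet> x) \<le> 1 / (1 - y \<bullet> y)" by (intro divide_left_mono) auto
    then show ?thesis using True xy by (simp add: chi_def bexp_def)
  qed (simp add: chi_def bexp_def)
qed

lemma integral_ball_P: "0 \<le> (\<integral>x. indicator (cball 0 r) x * P x \<partial>lborel)"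
proof -
  let ?u = "indicator (cball (0::real^'n) r) :: real^'n \<Rightarrow> real"
  have "\<bar>?u x\<bar> \<le> 1" for x by (simp add: indicator_def)
  then have u: "tame ?u" by (intro tame_bounded borel_measurable_indicator) auto
  have nn: "0 \<le> (?u x - ?u y) * (chi x - chi y)" for x y :: "real^'n"
    using chi_antimono[of x y] chi_antimono[of y x] by (auto simp: indicator_def)
  have "0 \<le> 2 * (\<integral>x. ?u x * Lop chi x \<partial>lborel)"
    by (rule LIMSEQ_le_const[OF trunc_form_tendsto[OF u bump_testfun[OF bump_chi]]])
      (auto intro!: exI[of _ 0] Bochner_Integration.integral_nonneg mult_nonneg_nonneg nn)
  then show ?thesis by (simp add: P_def)
qed

text \<open>An orthogonal map carrying \<open>x\<close> to \<open>y\<close> preserves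
  \<open>chi\<close>, the kernel and Lebesgue measure, so it transports one defining integral to the
  other.\<close>

lemma P_radial:
  fixes x y :: "real^'n"
  assumes "norm x = norm y" shows "P x = P y"
proof -
  obtain f where f: "orthogonal_transformation f" "f x = y"
    using orthogonal_transformation_exists[OF assms] by blast
  have lin: "linear f" and nf: "norm (f z) = norm z" for z
    using f by (simp_all add: orthogonal_transformation)
  have [measurable]: "f \<in> borel_measurable borel"
    using lin by (simp add: borel_measurable_continuous_onI linear_continuous_on linear_linear)
  have [measurable]: "chi \<in> borel_measurable borel" by (rule testfun_measurable[OF bump_testfun[OF bump_chi]])
  have chi: "chi (f z) = chi z" for z by (simp add: chi_def dot_square_norm nf)
  have d: "diff2 chi y (f z) = diff2 chi x z" for z
    unfolding diff2_def f(2)[symmetric] linear_add[OF lin, symmetric] linear_diff[OF lin, symmetric] chi ..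
  have "(\<integral>z. diff2 chi y z * kern z \<partial>lborel) = (\<integral>z. diff2 chi y z * kern z \<partial>(distr lborel borel f))"
    by (simp add: lborel_distr_orthogonal[OF f(1)])
  also have "\<dots> = (\<integral>z. diff2 chi y (f z) * kern (f z) \<partial>lborel)"
    by (subst integral_distr) auto
  also have "\<dots> = (\<integral>z. diff2 chi x z * kern z \<partial>lborel)"
    unfolding d by (simp add: kern_def nf)
  finally show ?thesis by (simp add: P_def Lop_def)
qed

text \<open>\<open>chi\<close> has its maximum at 0, so the integrand is nonnegative. For
  \<open>norm z \<ge> 1\<close> it equals twice \<open>chi 0\<close> times the kernel, which is
  positive; a vanishing integral would therefore force almost every point into the unit
  ball.\<close>

lemma P_0_pos: "0 < P (0 :: real^'n)"
proof -
  have [measurable]: "chi \<in> borel_measurable borel" by (rule testfun_measurable[OF bump_testfun[OF bump_chi]])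
  have nn: "0 \<le> diff2 chi 0 z * kern z" for z :: "real^'n"
    using chi_antimono[of 0 z] chi_antimono[of 0 "- z"] unfolding diff2_def by (intro mult_nonneg_nonneg) auto
  have i: "integrable lborel (\<lambda>z :: real^'n. diff2 chi 0 z * kern z)"
    by (rule diff2_kern_integrable[OF bump_testfun[OF bump_chi]])
  have "(\<integral>z. diff2 chi 0 z * kern z \<partial>(lborel :: (real^'n) measure)) \<noteq> 0"
  proof
    assume "(\<integral>z. diff2 chi 0 z * kern z \<partial>(lborel :: (real^'n) measure)) = 0"
    then have "AE z in lborel. diff2 chi 0 (z :: real^'n) * kern z = 0"
      using nn by (subst (asm) integral_nonneg_eq_0_iff_AE[OF i]) auto
    then have "AE z in lborel. norm (z :: real^'n) < 1"
    proof eventually_elim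
      case (elim z)
      show "norm z < 1"
      proof (rule ccontr)
        assume "\<not> norm z < 1"
        then have "chi z = 0" "chi (- z) = 0" "z \<noteq> 0"
          using bump_outside[OF bump_chi, of z] bump_outside[OF bump_chi, of "- z"] by auto
        moreover have "chi (0 :: real^'n) > 0" by (simp add: chi_def bexp_def)
        ultimately show False using elim by (simp add: diff2_def kern_def)
      qed
    qed
    then have "emeasure lborel (UNIV :: (real^'n) set) \<le> emeasure lborel (ball (0::real^'n) 1)"
      by (intro emeasure_mono_AE) (auto simp: dist_norm)
    then show False using emeasure_bounded_finite[OF bounded_ball, of "0::real^'n" 1] by simp
  qed
  moreover have "0 \<le> (\<integral>z. diff2 chi 0 z * kern z \<partial>(lborel :: (real^'n) measure))"
    using nn by (intro Bochner_Integration.integral_nonneg) auto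
  ultimately show ?thesis by (simp add: P_def Lop_def)
qed

section \<open>Weighted averages along rays and the kernel \<open>G\<close>\<close>

definition avg :: "nat \<Rightarrow> (real^'n \<Rightarrow> real) \<Rightarrow> real^'n \<Rightarrow> real" where
  "avg m f x = (\<integral>t. indicator {0..1} t * (t ^ m * f (t *\<^sub>R x)) \<partial>lborel)"

lemma indicator_unit_integrable: "integrable lborel (\<lambda>t::real. indicator {0..1} t * C)" for C :: real
  by (intro integrable_mult_left integrable_real_indicator) auto

lemma avg_integrable:
  fixes f :: "real^'n \<Rightarrow> real"
  assumes [measurable]: "f \<in> borel_measurable borel" and b: "\<And>x. \<bar>f x\<bar> \<le> C"
  shows "integrable lborel (\<lambda>t. indicator {0..1} t * (t ^ m * f (t *\<^sub>R x)))"
proof (rule Bochner_Integration.integrable_bound[OF indicator_unit_integrable[of C]])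
  show "(\<lambda>t. indicator {0..1} t * (t ^ m * f (t *\<^sub>R x))) \<in> borel_measurable lborel" by measurable
  show "AE t in lborel. norm (indicator {0..1} t * (t ^ m * f (t *\<^sub>R x))) \<le> norm (indicator {0..1} t * C)"
  proof (rule AE_I2)
  fix t :: real
  show "norm (indicator {0..1} t * (t ^ m * f (t *\<^sub>R x))) \<le> norm (indicator {0..1} t * C)"
    using b order_trans[OF abs_ge_zero b]
    by (auto intro!: order_trans[OF mult_left_le_one_le] power_le_one simp: indicator_def abs_mult)
  qed
qed

lemma avg_bound:
  assumes [measurable]: "f \<in> borel_measurable borel" and b: "\<And>x. \<bar>f x\<bar> \<le> C"
  shows "\<bar>avg m f x\<bar> \<le> C"
proof -
  have "norm (avg m f x) \<le> (\<integral>t. indicator {0..1} t * C \<partial>(lborel :: real measure))"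
    unfolding avg_def using b order_trans[OF abs_ge_zero b]
    by (intro Bochner_Integration.integral_norm_bound_integral avg_integrable[where C=C] indicator_unit_integrable)
      (auto intro!: order_trans[OF mult_left_le_one_le] power_le_one simp: indicator_def abs_mult)
  then show ?thesis by simp
qed

text \<open>The chain rule pulls a factor t out of f(t x). This raises the exponent of the weight by
  one for each derivative, which is why \<open>avg\<close> carries an arbitrary exponent.\<close>

lemma avg_has_derivative:
  fixes f :: "real^'n \<Rightarrow> real"
  assumes d: "\<And>x. (f has_derivative (\<lambda>v. \<Sum>i\<in>UNIV. v $ i * f' i x)) (at x)"
    and [measurable]: "f \<in> borel_measurable borel" "\<And>i. f' i \<in> borel_measurable borel"
    and b: "\<And>x. \<bar>f x\<bar> \<le> C" "\<And>i x. \<bar>f' i x\<bar> \<le> C"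
  shows "(avg m f has_derivative (\<lambda>v. \<Sum>i\<in>UNIV. v $ i * avg (Suc m) (f' i) x)) (at x)"
proof -
  have "((\<lambda>x. \<integral>t. indicator {0..1} t * (t ^ m * f (t *\<^sub>R x)) \<partial>lborel) has_derivative
    (\<lambda>v. \<Sum>i\<in>UNIV. v $ i *\<^sub>R (\<integral>t. indicator {0..1} t * (t ^ Suc m * f' i (t *\<^sub>R x)) \<partial>lborel))) (at x)"
  proof (rule has_derivative_integral_param[where r=1 and b="\<lambda>t::real. indicator {0..1} t * C"])
    show "integrable lborel (\<lambda>t. indicator {0..1} t * (t ^ m * f (t *\<^sub>R y)))" for y
      by (rule avg_integrable[where C=C]) (auto intro: b)
    show "integrable lborel (\<lambda>t::real. indicator {0..1} t * C)" by (rule indicator_unit_integrable)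
    show "norm (indicator {0..1} t * (t ^ Suc m * f' i (t *\<^sub>R y))) \<le> indicator {0..1} t * C" for i and y :: "real^'n" and t :: real
      using b(2) order_trans[OF abs_ge_zero b(2)]
      by (auto intro!: order_trans[OF mult_left_le_one_le] power_le_one mult_le_one simp: indicator_def abs_mult)
    fix y :: "real^'n" and t :: real
    have 1: "((\<lambda>x. t *\<^sub>R x) has_derivative (\<lambda>v. t *\<^sub>R v)) (at y)"
      by (auto intro!: derivative_eq_intros)
    have "((\<lambda>x. indicator {0..1} t * (t ^ m * f (t *\<^sub>R x))) has_derivative
      (\<lambda>v. indicator {0..1} t * (t ^ m * (\<Sum>i\<in>UNIV. (t *\<^sub>R v) $ i * f' i (t *\<^sub>R y))))) (at y)"
      by (intro has_derivative_mult_right has_derivative_compose[OF 1 d])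
    then show "((\<lambda>x. indicator {0..1} t * (t ^ m * f (t *\<^sub>R x))) has_derivative
      (\<lambda>v. \<Sum>i\<in>UNIV. v $ i *\<^sub>R (indicator {0..1} t * (t ^ Suc m * f' i (t *\<^sub>R y))))) (at y)"
      by (rule has_derivative_eq_rhs) (auto simp: fun_eq_iff sum_distrib_left mult_ac)
  qed simp_all
  then show ?thesis by (simp add: avg_def[abs_def])
qed

definition G :: "real^'n \<Rightarrow> real" where
  "G = avg (CARD('n) - 1) P"

lemma P_bounded: obtains C where "0 \<le> C" "\<And>x. \<bar>pds is P x\<bar> \<le> C"
proof -
  obtain C where C: "0 \<le> C" "\<And>x. \<bar>pds is P x\<bar> \<le> C * wt x" by (rule P_bound) (rule that)
  show ?thesis using C by (intro that[of C]) (auto intro: order_trans[OF C(2)] mult_left_le wt_le_1)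
qed

lemma avg_pds_P:
  "(avg m (pds is P) has_derivative (\<lambda>v. \<Sum>i\<in>UNIV. v $ i * avg (Suc m) (pds (i # is) P) x)) (at x)"
proof -
  have "\<exists>C. 0 \<le> C \<and> (\<forall>x. \<bar>pds (i # is) P x\<bar> \<le> C)" for i using P_bounded[of "i # is"] by metis
  then obtain C where C: "\<And>i. 0 \<le> C i" "\<And>i x. \<bar>pds (i # is) P x\<bar> \<le> C i" by metis
  obtain C0 where C0: "0 \<le> C0" "\<And>x. \<bar>pds is P x\<bar> \<le> C0" by (rule P_bounded) (rule that)
  have m: "pds (i # is) P \<in> borel_measurable borel" for i by (rule P_measurable)
  have S: "0 \<le> (\<Sum>i\<in>UNIV. C i)" using C by (simp add: sum_nonneg)
  have 1: "\<bar>pds is P x\<bar> \<le> C0 + (\<Sum>i\<in>UNIV. C i)" for x using C0(2)[of x] S by linarith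
  have 2: "\<bar>pds (i # is) P x\<bar> \<le> C0 + (\<Sum>i\<in>UNIV. C i)" for i x
    using C(2)[of i x] member_le_sum[of i UNIV C] C(1) C0(1) by auto
  show ?thesis
    by (rule avg_has_derivative[OF P_has_derivative P_measurable(1) m 1 2])
qed

lemma pds_G: "pds is (G :: real^'n \<Rightarrow> real) = avg (CARD('n) - 1 + length is) (pds is P)"
proof (induction "is")
  case (Cons i "is")
  show ?case
  proof
    fix x :: "real^'n"
    show "pds (i # is) G x = avg (CARD('n) - 1 + length (i # is)) (pds (i # is) P) x"
      using pd_eq[OF avg_pds_P[of "CARD('n) - 1 + length is" "is" x], of i] by (simp add: Cons)
  qed
qed (simp add: G_def)

lemma G_has_derivative:
  "(pds is G has_derivative (\<lambda>v. \<Sum>i\<in>UNIV. v $ i * pds (i # is) G x)) (at (x :: real^'n))"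
  using avg_pds_P[of "CARD('n) - 1 + length is" "is" x] by (simp only: pds_G length_Cons add_Suc_right)

lemma G_bounded: obtains C where "0 \<le> C" "\<And>x. \<bar>pds is G x\<bar> \<le> C"
proof -
  obtain C where C: "0 \<le> C" "\<And>x. \<bar>pds is P x\<bar> \<le> C" by (rule P_bounded) (rule that)
  show ?thesis using C by (intro that[of C]) (auto simp: pds_G intro!: avg_bound)
qed

lemma G_continuous: "continuous_on A (pds is G)"
  by (meson G_has_derivative continuous_at_imp_continuous_on has_derivative_continuous)

lemma G_measurable[measurable]: "pds is G \<in> borel_measurable borel" "G \<in> borel_measurable borel"
  using G_continuous[of UNIV "is"] G_continuous[of UNIV "[]"] by (auto intro: borel_measurable_continuous_onI)

end

section \<open>The reproducing kernel\<close>

text \<open>The coefficients are grouped so that they arise from \<open>f\<close> and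
  \<open>D i\<close> by adding, scaling, dividing by \<open>x \<bullet> x\<close>, and multiplying
  such a quotient by a coordinate: the closure operations of \<open>decay_class\<close>.\<close>

lemma has_derivative_coord_over_sq:
  fixes f :: "real ^ 'n \<Rightarrow> real"
  assumes f: "(f has_derivative (\<lambda>v. \<Sum>i\<in>UNIV. v $ i * D i)) (at x)" and x: "x \<noteq> 0"
  shows "((\<lambda>x. f x / (x \<bullet> x)) has_derivative
    (\<lambda>v. \<Sum>i\<in>UNIV. v $ i * (D i / (x \<bullet> x) + (-2) * (x $ i * (f x / (x \<bullet> x) / (x \<bullet> x)))))) (at x)"
proof -
  have q: "((\<lambda>x. 1 / (x \<bullet> x)) has_derivative (\<lambda>v. \<Sum>i\<in>UNIV. v $ i * (2 * (x $ i * (- 1 / ((x \<bullet> x) * (x \<bullet> x))))))) (at x)"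
    using x by (intro has_derivative_radial[of "\<lambda>t. 1 / t"]) (auto intro!: derivative_eq_intros simp: power2_eq_square)
  have "((\<lambda>x. f x * (1 / (x \<bullet> x))) has_derivative
    (\<lambda>v. f x * (\<Sum>i\<in>UNIV. v $ i * (2 * (x $ i * (- 1 / ((x \<bullet> x) * (x \<bullet> x)))))) +
      (\<Sum>i\<in>UNIV. v $ i * D i) * (1 / (x \<bullet> x)))) (at x)"
    by (rule has_derivative_mult[OF f q])
  moreover have "f x * (\<Sum>i\<in>UNIV. v $ i * (2 * (x $ i * (- 1 / ((x \<bullet> x) * (x \<bullet> x)))))) +
      (\<Sum>i\<in>UNIV. v $ i * D i) * (1 / (x \<bullet> x)) =
      (\<Sum>i\<in>UNIV. v $ i * (D i / (x \<bullet> x) + (-2) * (x $ i * (f x / (x \<bullet> x) / (x \<bullet> x)))))" for v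
    unfolding sum_distrib_left sum_distrib_right sum.distrib[symmetric]
    by (intro sum.cong refl) (simp add: divide_inverse algebra_simps)
  ultimately show ?thesis by simp
qed

context frac_order
begin

lemma radial_profile_continuous: "continuous_on A (\<lambda>t. P (t *\<^sub>R e))"
  using P_continuous[of UNIV "[]"] by (intro continuous_on_compose2[of UNIV P A "\<lambda>t. t *\<^sub>R e"]) (auto intro!: continuous_intros)

lemma radial_profile_measurable[measurable]: "(\<lambda>t. P (t *\<^sub>R (e :: real^'n))) \<in> borel_measurable borel"
  by (rule borel_measurable_continuous_onI[OF radial_profile_continuous])

lemma P_profile:
  fixes x e :: "real^'n" assumes "norm e = 1" shows "P x = P (norm x *\<^sub>R e)"
  by (rule P_radial) (simp add: assms)

text \<open>Up to the surface area factor this is the integral of \<open>P\<close> over the ball of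
  radius \<open>r\<close>. Since \<open>P\<close> is radial, any unit vector \<open>e\<close> gives
  the same profile.\<close>

definition mass :: "real^'n \<Rightarrow> real \<Rightarrow> real" where
  "mass e r = (\<integral>t. indicator {0..r} t * (t ^ (CARD('n) - 1) * P (t *\<^sub>R e)) \<partial>lborel)"

lemma G_polar:
  fixes x e :: "real^'n" assumes e: "norm e = 1" and x: "x \<noteq> 0"
  shows "G x = mass e (norm x) / norm x ^ CARD('n)"
proof -
  let ?n = "CARD('n)"
  have "mass e (norm x) = norm x * (\<integral>t. indicator {0..norm x} (norm x * t) * ((norm x * t) ^ (?n - 1) * P ((norm x * t) *\<^sub>R e)) \<partial>lborel)"
    unfolding mass_def using x by (subst lborel_integral_real_affine[of "norm x" _ 0]) auto
  also have "(\<lambda>t. indicator {0..norm x} (norm x * t) * ((norm x * t) ^ (?n - 1) * P ((norm x * t) *\<^sub>R e))) =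
     (\<lambda>t. norm x ^ (?n - 1) * (indicator {0..1} t * (t ^ (?n - 1) * P (t *\<^sub>R x))))"
  proof
    fix t :: real
    show "indicator {0..norm x} (norm x * t) * ((norm x * t) ^ (?n - 1) * P ((norm x * t) *\<^sub>R e)) =
      norm x ^ (?n - 1) * (indicator {0..1} t * (t ^ (?n - 1) * P (t *\<^sub>R x)))"
    proof (cases "0 \<le> t \<and> t \<le> 1")
      case True
      have "P (t *\<^sub>R x) = P ((norm x * t) *\<^sub>R e)"
        by (rule P_radial) (simp add: e abs_mult mult.commute)
      moreover have "norm x * t \<in> {0..norm x}" using True by (auto simp: mult_left_le)
      ultimately show ?thesis using True by (simp add: power_mult_distrib)
    next
      case False
      then have "norm x * t \<notin> {0..norm x}" using x by (auto simp: zero_le_mult_iff)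
      with False show ?thesis by auto
    qed
  qed
  also have "norm x * (\<integral>t. norm x ^ (?n - 1) * (indicator {0..1} t * (t ^ (?n - 1) * P (t *\<^sub>R x))) \<partial>lborel) = norm x ^ ?n * G x"
    by (simp add: G_def avg_def power_eq_if[of _ ?n])
  finally show ?thesis using x by simp
qed

lemma profile_integrable:
  fixes e :: "real^'n" assumes e: "norm e = 1"
  shows "integrable lborel (\<lambda>t. indicator {0..} t * (t ^ (CARD('n) - 1) * P (t *\<^sub>R e)))"
    and "(\<integral>t. indicator {0..} t * (t ^ (CARD('n) - 1) * P (t *\<^sub>R e)) \<partial>lborel) = 0"
proof -
  have *: "(\<lambda>x :: real^'n. P (norm x *\<^sub>R e)) = P" using P_profile[OF e] by auto
  show "integrable lborel (\<lambda>t. indicator {0..} t * (t ^ (CARD('n) - 1) * P (t *\<^sub>R e)))"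
    using integrable_radial_iff[where 'a="real^'n" and f="\<lambda>t. P (t *\<^sub>R e)"] P_integrable[where 'n='n] by (simp add: *)
  have "real CARD('n) * unit_ball_vol (real CARD('n)) * (\<integral>t. indicator {0..} t * (t ^ (CARD('n) - 1) * P (t *\<^sub>R e)) \<partial>lborel) = 0"
    using integral_radial[where 'a="real^'n" and f="\<lambda>t. P (t *\<^sub>R e)"] integral_P[where 'n='n] by (simp add: *)
  then show "(\<integral>t. indicator {0..} t * (t ^ (CARD('n) - 1) * P (t *\<^sub>R e)) \<partial>lborel) = 0"
    using unit_ball_vol_pos[of "real CARD('n)"] by (simp del: unit_ball_vol_pos)
qed

lemma mass_nonneg:
  fixes e :: "real^'n" assumes e: "norm e = 1"
  shows "0 \<le> mass e r"
proof -
  have "0 \<le> (\<integral>x. (indicator {..r} (norm x) * P (norm x *\<^sub>R e)) \<partial>(lborel :: (real^'n) measure))"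
  proof -
    have "(\<lambda>x :: real^'n. indicator {..r} (norm x) * P (norm x *\<^sub>R e)) = (\<lambda>x. indicator (cball 0 r) x * P x)"
      using P_profile[OF e] by (auto simp: indicator_def fun_eq_iff)
    then show ?thesis using integral_ball_P by simp
  qed
  also have "\<dots> = real CARD('n) * unit_ball_vol (real CARD('n)) *
    (\<integral>t. indicator {0..} t * (t ^ (CARD('n) - 1) * (indicator {..r} t * P (t *\<^sub>R e))) \<partial>lborel)"
    by (subst integral_radial) simp_all
  also have "(\<lambda>t. indicator {0..} t * (t ^ (CARD('n) - 1) * (indicator {..r} t * P (t *\<^sub>R e)))) =
    (\<lambda>t. indicator {0..r} t * (t ^ (CARD('n) - 1) * P (t *\<^sub>R e)))"
    by (auto simp: indicator_def fun_eq_iff)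
  also have "(\<integral>t. indicator {0..r} t * (t ^ (CARD('n) - 1) * P (t *\<^sub>R e)) \<partial>lborel) = mass e r"
    by (simp add: mass_def)
  finally have *: "0 \<le> (real CARD('n) * unit_ball_vol (real CARD('n))) * mass e r" .
  have "0 < real CARD('n) * unit_ball_vol (real CARD('n))" by simp
  with * show ?thesis by (simp only: zero_le_mult_iff) linarith
qed

lemma exists_unit_vector: obtains e :: "real^'n" where "norm e = 1"
  using that[of "axis undefined 1"] by (simp add: norm_axis_1)

lemma G_nonneg: "0 \<le> G (x :: real^'n)"
  and G_0_pos: "0 < G (0 :: real^'n)"
proof -
  obtain e :: "real^'n" where e: "norm e = 1" by (rule exists_unit_vector)
  have "G (0 :: real^'n) = P (0 :: real^'n) * (\<integral>t. t ^ (CARD('n) - 1) * indicator {0..1} t \<partial>lborel)"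
    by (simp add: G_def avg_def mult_ac)
  also have "\<dots> > 0" using P_0_pos[where 'n='n] by (subst integral_power) (auto simp: power_0_left)
  finally show 0: "0 < G (0 :: real^'n)" .
  show "0 \<le> G x"
    using 0 mass_nonneg[OF e] by (cases "x = 0") (auto simp: G_polar[OF e])
qed

lemma integral_powr_tail:
  fixes r q :: real assumes "0 < r"
  shows "(\<integral>t. indicator {r..} t * t powr q \<partial>lborel) = r powr (q + 1) * (\<integral>t. indicator {1..} t * t powr q \<partial>lborel)"
proof -
  have "(\<integral>t. indicator {r..} t * t powr q \<partial>lborel) = r * (\<integral>t. indicator {r..} (r * t) * (r * t) powr q \<partial>lborel)"
    using assms by (subst lborel_integral_real_affine[of r _ 0]) auto
  also have "(\<lambda>t. indicator {r..} (r * t) * (r * t) powr q) = (\<lambda>t. r powr q * (indicator {1..} t * t powr q))"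
    using assms by (auto simp: fun_eq_iff indicator_def powr_mult)
  finally show ?thesis using assms by (simp add: powr_add)
qed

lemma mass_decay:
  fixes e :: "real^'n" assumes e: "norm e = 1"
  shows "\<exists>C\<ge>0. \<forall>r>0. \<bar>mass e r\<bar> \<le> C * r powr (- 2 * s)"
proof -
  let ?n = "CARD('n)"
  obtain C where C: "0 \<le> C" "\<And>x :: real^'n. \<bar>P x\<bar> \<le> C * wt x"
    using P_bound[of "[]"] by (metis pds.simps(1))
  let ?f = "\<lambda>t. t ^ (?n - 1) * P (t *\<^sub>R e)"
  \<comment> \<open>The polar weight contributes n - 1 and the decay of \<open>P\<close> contributes
    - n - 2s. Integrating this power beyond \<open>r\<close> leaves r^(-2s).\<close>
  let ?q = "- 1 - 2 * s"
  let ?K = "\<integral>t. indicator {1..} t * t powr ?q \<partial>lborel"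
  have K: "0 \<le> ?K" by (intro Bochner_Integration.integral_nonneg) auto
  have "\<bar>mass e r\<bar> \<le> C * ?K * r powr (- 2 * s)" if r: "0 < r" for r
  proof -
    have sub: "integrable lborel (\<lambda>t. indicator A t * ?f t)" if "A \<subseteq> {0..}" "A \<in> sets borel" for A
      using that by (intro Bochner_Integration.integrable_bound[OF profile_integrable(1)[OF e]] AE_I2)
        (auto simp: indicator_def)
    \<comment> \<open>The profile has total integral 0, so the mass inside radius \<open>r\<close>
      is minus the mass outside, where the decay of \<open>P\<close> can be used.\<close>
    have "0 = (\<integral>t. indicator {0..} t * ?f t \<partial>lborel)"
      using profile_integrable(2)[OF e] by simp
    also have "\<dots> = (\<integral>t. indicator {0..r} t * ?f t + indicator {r<..} t * ?f t \<partial>lborel)"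
      using r
      by (intro Bochner_Integration.integral_cong) (auto simp: indicator_def)
    also have "\<dots> = mass e r + (\<integral>t. indicator {r<..} t * ?f t \<partial>lborel)"
      unfolding mass_def using r by (intro Bochner_Integration.integral_add sub) auto
    finally have "\<bar>mass e r\<bar> = norm (\<integral>t. indicator {r<..} t * ?f t \<partial>lborel)" by simp
    also have "\<dots> \<le> (\<integral>t. C * (indicator {r..} t * t powr ?q) \<partial>lborel)"
    proof (rule Bochner_Integration.integral_norm_bound_integral)
      show "integrable lborel (\<lambda>t. indicator {r<..} t * ?f t)" using r by (intro sub) auto
      show "integrable lborel (\<lambda>t. C * (indicator {r..} t * t powr ?q))"
        using r s_pos by (intro integrable_mult_right integrable_lborel_powr_to_inf) auto
      fix t :: real
      show "norm (indicator {r<..} t * ?f t) \<le> C * (indicator {r..} t * t powr ?q)"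
      proof (cases "r < t")
        case True
        then have t: "0 < t" using r by simp
        have n: "real (?n - 1) = real ?n - 1"
          by (simp add: of_nat_diff Suc_leI)
        have "\<bar>P (t *\<^sub>R e)\<bar> \<le> C * kern (t *\<^sub>R e)"
          using e t C(1) by (intro order_trans[OF C(2)] mult_left_mono wt_le_kern) auto
        then have "t ^ (?n - 1) * \<bar>P (t *\<^sub>R e)\<bar> \<le> t ^ (?n - 1) * (C * t powr - (real ?n + 2 * s))"
          using e t by (intro mult_left_mono) (auto simp: kern_def)
        also have tp: "t ^ (?n - 1) = t powr (real ?n - 1)"
          using powr_realpow[OF t, of "?n - 1"] n by simp
        also have "t powr (real ?n - 1) * (C * t powr - (real ?n + 2 * s)) = C * (t powr (real ?n - 1) * t powr - (real ?n + 2 * s))"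
          by (rule mult.left_commute)
        also have "\<dots> = C * t powr ?q"
          by (simp only: powr_add[symmetric]) (simp add: algebra_simps)
        finally show ?thesis using True t tp by (simp add: abs_mult)
      qed (use C in auto)
    qed
    also have "\<dots> = C * ?K * r powr (- 2 * s)"
      using integral_powr_tail[OF r, of ?q] by simp
    finally show ?thesis .
  qed
  then show ?thesis using C(1) K by (intro exI[of _ "C * ?K"]) auto
qed

lemma bounded_decay_wt:
  fixes f :: "real^'n \<Rightarrow> real"
  assumes "0 \<le> A" "\<And>x. \<bar>f x\<bar> \<le> A" "0 \<le> B" "\<And>x. 1 \<le> norm x \<Longrightarrow> \<bar>f x\<bar> \<le> B * kern x"
  shows "\<bar>f x\<bar> \<le> (A + B) * (2 powr (real CARD('n) + 2 * s)) * wt x"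
proof (cases "1 \<le> norm x")
  case True
  have "\<bar>f x\<bar> \<le> B * kern x" using assms True by simp
  also have "\<dots> \<le> B * (2 powr (real CARD('n) + 2 * s) * wt x)"
    using True assms(3) by (intro mult_left_mono kern_le_wt) auto
  also have "\<dots> \<le> (A + B) * (2 powr (real CARD('n) + 2 * s) * wt x)"
    using assms by (intro mult_right_mono) auto
  finally show ?thesis by (simp add: mult.assoc)
next
  case False
  have "\<bar>f x\<bar> \<le> A * 1" using assms by simp
  also have "\<dots> \<le> A * ((1 + 1) powr (real CARD('n) + 2 * s) * wt x)"
    using False assms(1) by (intro mult_left_mono wt_near_le) auto
  also have "\<dots> \<le> (A + B) * (2 powr (real CARD('n) + 2 * s) * wt x)"
    using assms by (simp add: distrib_right)
  finally show ?thesis by (simp add: mult.assoc)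
qed

lemma G_decay: obtains C where "0 \<le> C" "\<And>x :: real^'n. 1 \<le> norm x \<Longrightarrow> \<bar>G x\<bar> \<le> C * kern x"
proof -
  obtain e :: "real^'n" where e: "norm e = 1" by (rule exists_unit_vector)
  obtain C where C: "0 \<le> C" "\<And>r. r > 0 \<Longrightarrow> \<bar>mass e r\<bar> \<le> C * r powr (- 2 * s)"
    using mass_decay[OF e] by blast
  show ?thesis
  proof (rule that[OF C(1)])
    fix x :: "real^'n" assume x: "1 \<le> norm x"
    then have x0: "0 < norm x" by linarith
    have "\<bar>G x\<bar> = \<bar>mass e (norm x)\<bar> / norm x ^ CARD('n)" using x0 by (simp add: G_polar[OF e])
    also have "\<dots> \<le> C * norm x powr (- 2 * s) / norm x ^ CARD('n)"
      using x0 by (intro divide_right_mono C) auto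
    also have "\<dots> = C * kern x"
      using x0 by (simp add: kern_def powr_diff powr_realpow[symmetric] field_simps)
        (simp add: powr_add[symmetric])
    finally show "\<bar>G x\<bar> \<le> C * kern x" .
  qed
qed

text \<open>The derivative of \<open>mass e\<close> at r is r^(n-1) P(r e), so the quotient in
  \<open>G_polar\<close> has radial derivative (P - n G) / r. It is viewed as a function of
  \<open>x \<bullet> x\<close>, through a square root that is differentiable off the origin, so that
  \<open>has_derivative_radial\<close> delivers the partial derivatives.\<close>

lemma G_gradient:
  fixes x :: "real^'n" assumes x: "x \<noteq> 0"
  shows "(G has_derivative (\<lambda>v. \<Sum>i\<in>UNIV. v $ i * (x $ i * ((P x + (- real CARD('n)) * G x) / (x \<bullet> x))))) (at x)"
proof -
  let ?n = "CARD('n)"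
  obtain e :: "real^'n" where e: "norm e = 1" by (rule exists_unit_vector)
  let ?f = "\<lambda>t. t ^ (?n - 1) * P (t *\<^sub>R e)"
  have cont: "continuous_on A ?f" for A by (intro continuous_intros radial_profile_continuous)
  have mass: "mass e r = integral {0..r} ?f" for r
    using set_borel_integral_eq_integral(2)[OF borel_integrable_atLeastAtMost'[OF cont], of 0 r]
    by (simp add: mass_def set_lebesgue_integral_def)
  define \<rho> where "\<rho> = norm x"
  have \<rho>: "0 < \<rho>" "sqrt (x \<bullet> x) = \<rho>" "x \<bullet> x = \<rho> * \<rho>" using x by (auto simp: \<rho>_def norm_eq_sqrt_inner)
  have dm: "(mass e has_real_derivative ?f \<rho>) (at \<rho>)"
  proof -
    have "((\<lambda>r. integral {0..r} ?f) has_real_derivative ?f \<rho>) (at \<rho> within {0..\<rho> + 1})"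
      using \<rho> by (intro integral_has_real_derivative cont) auto
    moreover have "at \<rho> within {0..\<rho> + 1} = at \<rho>" using \<rho> by (intro at_within_interior) auto
    ultimately show ?thesis by (simp add: mass[abs_def])
  qed
  let ?b = "\<lambda>t. mass e (sqrt t) / sqrt t ^ ?n"
  let ?d = "(?f \<rho> * \<rho> ^ ?n - mass e \<rho> * (real ?n * \<rho> ^ (?n - 1))) / (\<rho> ^ ?n * \<rho> ^ ?n) / (2 * \<rho>)"
  have "((\<lambda>r. mass e r / r ^ ?n) has_real_derivative
     (?f \<rho> * \<rho> ^ ?n - mass e \<rho> * (real ?n * \<rho> ^ (?n - 1))) / (\<rho> ^ ?n * \<rho> ^ ?n)) (at (sqrt (x \<bullet> x)))"
    unfolding \<rho>(2) using \<rho>(1) by (intro DERIV_divide dm) (auto intro!: derivative_eq_intros)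
  moreover have "(sqrt has_real_derivative inverse (sqrt (x \<bullet> x)) / 2) (at (x \<bullet> x))"
    using x by (intro DERIV_real_sqrt) simp
  ultimately have "(?b has_real_derivative (?f \<rho> * \<rho> ^ ?n - mass e \<rho> * (real ?n * \<rho> ^ (?n - 1))) / (\<rho> ^ ?n * \<rho> ^ ?n) * (inverse (sqrt (x \<bullet> x)) / 2)) (at (x \<bullet> x))"
    by (rule DERIV_chain2)
  moreover have "q * (inverse \<rho> / 2) = q / (2 * \<rho>)" for q by (simp add: field_simps)
  ultimately have b: "(?b has_real_derivative ?d) (at (x \<bullet> x))"
    by (simp only: \<rho>(2))
  have "2 * ?d = (P x + (- real ?n) * G x) / (x \<bullet> x)"
  proof -
    have Pn: "P x = P (\<rho> *\<^sub>R e)" using P_profile[OF e, of x] by (simp add: \<rho>_def)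
    have Gm: "mass e \<rho> = G x * \<rho> ^ ?n" using G_polar[OF e x] x by (simp add: \<rho>_def)
    have n: "\<rho> ^ ?n = \<rho> * \<rho> ^ (?n - 1)" by (simp add: power_eq_if)
    define m where "m = \<rho> ^ (?n - 1)"
    have m: "m \<noteq> 0" using \<rho>(1) by (simp add: m_def)
    have 1: "m * P x * (\<rho> * m) - G x * (\<rho> * m) * (real ?n * m) = (\<rho> * m * m) * (P x + (- real ?n) * G x)"
      by (simp add: algebra_simps)
    have 2: "2 * ((\<rho> * m * m) * w / (\<rho> * m * (\<rho> * m)) / (2 * \<rho>)) = w / (\<rho> * \<rho>)" for w
      using \<rho>(1) m by (simp add: field_simps)
    show ?thesis unfolding Gm Pn[symmetric] \<rho>(3) n m_def[symmetric] 1 by (rule 2)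
  qed
  then have eq: "2 * (x $ i * ?d) = x $ i * ((P x + (- real ?n) * G x) / (x \<bullet> x))" for i
    by (simp only: mult.left_commute[of 2 "x $ i" ?d])
  have "((\<lambda>x. ?b (x \<bullet> x)) has_derivative (\<lambda>v. \<Sum>i\<in>UNIV. v $ i * (x $ i * ((P x + (- real CARD('n)) * G x) / (x \<bullet> x))))) (at x)"
    using has_derivative_radial[OF b] unfolding eq .
  then show ?thesis
    by (rule has_derivative_transform_within_open[of _ _ _ UNIV "- {0}"])
      (use x in \<open>auto simp: G_polar[OF e] norm_eq_sqrt_inner\<close>)
qed

text \<open>
  By \<open>G_gradient\<close> this class is closed under partial differentiation off the origin, and each member
  decays like \<open>kern\<close>; so all derivatives of \<open>G\<close> decay without any homogeneous estimate for those of \<open>P\<close>.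
\<close>

inductive decay_class :: "(real ^ 'n::finite \<Rightarrow> real) \<Rightarrow> bool" where
  decay_class_G: "decay_class G"
| decay_class_P: "decay_class (pds is P)"
| add: "decay_class f \<Longrightarrow> decay_class g \<Longrightarrow> decay_class (\<lambda>x. f x + g x)"
| scale: "decay_class f \<Longrightarrow> decay_class (\<lambda>x. c * f x)"
| quot: "decay_class f \<Longrightarrow> decay_class (\<lambda>x. f x / (x \<bullet> x))"
| coord: "decay_class f \<Longrightarrow> decay_class (\<lambda>x. x $ i * (f x / (x \<bullet> x)))"

lemma decay_class_zero: "decay_class (\<lambda>x. 0)"
  using decay_class.scale[OF decay_class_G, of 0] by simp

text \<open>Outside the unit ball neither dividing by \<open>x \<bullet> x\<close> nor multiplying
  by \<open>x $ i / (x \<bullet> x)\<close> increases the absolute value; the remaining cases rest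
  on the decay of \<open>G\<close> and of the derivatives of \<open>P\<close>.\<close>

lemma decay_class_bound:
  fixes f :: "real^'n \<Rightarrow> real"
  shows "decay_class f \<Longrightarrow> \<exists>C\<ge>0. \<forall>x. 1 \<le> norm x \<longrightarrow> \<bar>f x\<bar> \<le> C * kern x"
proof (induction rule: decay_class.induct)
  case decay_class_G
  show ?case using G_decay[where 'n='n] by metis
next
  case (decay_class_P "is")
  obtain C where C: "0 \<le> C" "\<And>x :: real^'n. \<bar>pds is P x\<bar> \<le> C * wt x" using P_bound by metis
  show ?case using C by (intro exI[of _ C]) (auto intro!: order_trans[OF C(2)] mult_left_mono wt_le_kern)
next
  case (add f g)
  then obtain C D where "0 \<le> C" "0 \<le> D" "\<And>x. 1 \<le> norm x \<Longrightarrow> \<bar>f x\<bar> \<le> C * kern x" "\<And>x. 1 \<le> norm x \<Longrightarrow> \<bar>g x\<bar> \<le> D * kern x" by metis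
  then show ?case by (intro exI[of _ "C + D"]) (force simp: distrib_right intro: order_trans[OF abs_triangle_ineq] add_mono)
next
  case (scale f c)
  then obtain C where "0 \<le> C" "\<And>x. 1 \<le> norm x \<Longrightarrow> \<bar>f x\<bar> \<le> C * kern x" by metis
  then show ?case by (intro exI[of _ "\<bar>c\<bar> * C"]) (auto simp: abs_mult mult.assoc intro: mult_left_mono)
next
  case (quot f)
  then obtain C where C: "0 \<le> C" "\<And>x. 1 \<le> norm x \<Longrightarrow> \<bar>f x\<bar> \<le> C * kern x" by metis
  have "\<bar>f x / (x \<bullet> x)\<bar> \<le> C * kern x" if x: "1 \<le> norm x" for x
  proof -
    have "1 \<le> x \<bullet> x" using x by (simp add: dot_square_norm)
    then have "\<bar>f x / (x \<bullet> x)\<bar> \<le> \<bar>f x\<bar>" by (simp add: abs_divide divide_le_eq mult_left_le) (metis abs_ge_zero mult.right_neutral mult_left_mono)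
    then show ?thesis using C(2)[OF x] by linarith
  qed
  then show ?case using C by blast
next
  case (coord f i)
  then obtain C where C: "0 \<le> C" "\<And>x. 1 \<le> norm x \<Longrightarrow> \<bar>f x\<bar> \<le> C * kern x" by metis
  have "\<bar>x $ i * (f x / (x \<bullet> x))\<bar> \<le> C * kern x" if x: "1 \<le> norm x" for x
  proof -
    have "\<bar>x $ i\<bar> \<le> norm x" by (rule component_le_norm_cart)
    also have "\<dots> \<le> x \<bullet> x" using x by (simp add: dot_square_norm power2_eq_square mult_left_mono[of 1 "norm x" "norm x", simplified])
    finally have 1: "\<bar>x $ i\<bar> \<le> x \<bullet> x" .
    have "\<bar>x $ i * (f x / (x \<bullet> x))\<bar> = (\<bar>x $ i\<bar> / (x \<bullet> x)) * \<bar>f x\<bar>" by (simp add: abs_mult)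
    also have "\<dots> \<le> 1 * \<bar>f x\<bar>" using 1 by (intro mult_right_mono) (auto simp: divide_le_eq)
    finally show ?thesis using C(2)[OF x] by linarith
  qed
  then show ?case using C by blast
qed

lemma decay_class_derivative:
  fixes f :: "real^'n \<Rightarrow> real"
  shows "decay_class f \<Longrightarrow> \<exists>D. (\<forall>i. decay_class (D i)) \<and> (\<forall>x. x \<noteq> 0 \<longrightarrow> (f has_derivative (\<lambda>v. \<Sum>i\<in>UNIV. v $ i * D i x)) (at x))"
proof (induction rule: decay_class.induct)
  case decay_class_G
  have "decay_class (\<lambda>x. x $ i * ((P x + (- real CARD('n)) * G x) / (x \<bullet> x)))" for i :: 'n
    by (rule decay_class.coord[OF decay_class.add[OF decay_class_P[of "[]", unfolded pds.simps] decay_class.scale[OF decay_class.decay_class_G]]])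
  then show ?case using G_gradient
    by (intro exI[of _ "\<lambda>i x. x $ i * ((P x + (- real CARD('n)) * G x) / (x \<bullet> x))"] conjI allI impI)
next
  case (decay_class_P "is")
  show ?case using P_has_derivative decay_class.decay_class_P by (intro exI[of _ "\<lambda>i. pds (i # is) P"]) blast
next
  case (add f g)
  then obtain D E where "\<forall>i. decay_class (D i)" "\<forall>x. x \<noteq> 0 \<longrightarrow> (f has_derivative (\<lambda>v. \<Sum>i\<in>UNIV. v $ i * D i x)) (at x)"
    "\<forall>i. decay_class (E i)" "\<forall>x. x \<noteq> 0 \<longrightarrow> (g has_derivative (\<lambda>v. \<Sum>i\<in>UNIV. v $ i * E i x)) (at x)" by blast
  then show ?case
    by (intro exI[of _ "\<lambda>i x. D i x + E i x"] conjI allI impI decay_class.add)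
      (auto dest: has_derivative_add simp: distrib_left sum.distrib)
next
  case (scale f c)
  then obtain D where D: "\<forall>i. decay_class (D i)" "\<forall>x. x \<noteq> 0 \<longrightarrow> (f has_derivative (\<lambda>v. \<Sum>i\<in>UNIV. v $ i * D i x)) (at x)" by blast
  have "((\<lambda>x. c * f x) has_derivative (\<lambda>v. \<Sum>i\<in>UNIV. v $ i * (c * D i x))) (at x)" if "x \<noteq> 0" for x
    using has_derivative_mult_right[OF D(2)[rule_format, OF that], of c] by (simp add: sum_distrib_left mult.left_commute)
  with D(1) show ?case
    by (intro exI[of _ "\<lambda>i x. c * D i x"] conjI allI impI decay_class.scale) auto
next
  case (quot f)
  then obtain D where D: "\<forall>i. decay_class (D i)" "\<forall>x. x \<noteq> 0 \<longrightarrow> (f has_derivative (\<lambda>v. \<Sum>i\<in>UNIV. v $ i * D i x)) (at x)" by blast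
  show ?case
    by (intro exI[of _ "\<lambda>i x. D i x / (x \<bullet> x) + (-2) * (x $ i * (f x / (x \<bullet> x) / (x \<bullet> x)))"] conjI allI impI
        decay_class.add decay_class.scale decay_class.coord decay_class.quot D(1)[rule_format] quot.hyps has_derivative_coord_over_sq D(2)[rule_format])
next
  case (coord f j)
  then obtain D where D: "\<forall>i. decay_class (D i)" "\<forall>x. x \<noteq> 0 \<longrightarrow> (f has_derivative (\<lambda>v. \<Sum>i\<in>UNIV. v $ i * D i x)) (at x)" by blast
  \<comment> \<open>The product rule. In the last term one coordinate is grouped with each division
    by \<open>x \<bullet> x\<close>, so that \<open>coord\<close> applies twice; multiplication by a
    coordinate alone would spoil the decay.\<close>
  let ?E = "\<lambda>i x. (if i = j then f x / (x \<bullet> x) else 0) +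
     (x $ j * (D i x / (x \<bullet> x)) + (-2) * (x $ j * ((x $ i * (f x / (x \<bullet> x))) / (x \<bullet> x))))"
  have "decay_class (?E i)" for i
  proof -
    have "decay_class (\<lambda>x. if i = j then f x / (x \<bullet> x) else 0)"
      using decay_class_zero decay_class.quot[OF coord.hyps] by (cases "i = j") simp_all
    then show ?thesis
      by (rule decay_class.add[OF _ decay_class.add[OF decay_class.coord[OF D(1)[rule_format]] decay_class.scale[OF decay_class.coord[OF decay_class.coord[OF coord.hyps]]]]])
  qed
  moreover have "((\<lambda>x. x $ j * (f x / (x \<bullet> x))) has_derivative (\<lambda>v. \<Sum>i\<in>UNIV. v $ i * ?E i x)) (at x)" if "x \<noteq> 0" for x
    by (rule has_derivative_eq_rhs[OF has_derivative_coord_mult[OF has_derivative_coord_over_sq[OF D(2)[rule_format, OF that] that], of j]])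
      (auto simp: fun_eq_iff algebra_simps intro!: sum.cong)
  ultimately show ?case by (intro exI[of _ ?E]) blast
qed

text \<open>The gradient formula divides by \<open>x \<bullet> x\<close>, so agreement with a member
  of the class is obtained off the origin. That set is open, hence the identity can be
  differentiated again.\<close>

lemma pds_G_decay_class: "\<exists>f. decay_class f \<and> (\<forall>x. x \<noteq> 0 \<longrightarrow> pds is G x = f x)"
proof (induction "is")
  case Nil
  show ?case using decay_class_G by auto
next
  case (Cons i "is")
  then obtain f where f: "decay_class f" "\<And>x. x \<noteq> 0 \<Longrightarrow> pds is G x = f x" by blast
  from decay_class_derivative[OF f(1)] obtain D where D: "\<forall>i. decay_class (D i)" "\<forall>x. x \<noteq> 0 \<longrightarrow> (f has_derivative (\<lambda>v. \<Sum>i\<in>UNIV. v $ i * D i x)) (at x)"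
    by (elim exE conjE) (rule that)
  have "pds (i # is) G x = D i x" if x: "x \<noteq> 0" for x
  proof -
    have "(pds is G has_derivative (\<lambda>v. \<Sum>i\<in>UNIV. v $ i * D i x)) (at x)"
      by (rule has_derivative_transform_within_open[of f _ _ UNIV "- {0}"]) (use x D(2) f(2) in auto)
    then show ?thesis by (simp add: pd_eq)
  qed
  then show ?case using D(1) by blast
qed

lemma G_bound: obtains C where "0 \<le> C" "\<And>x :: real^'n. \<bar>pds is G x\<bar> \<le> C * wt x"
proof -
  obtain A where A: "0 \<le> A" "\<And>x :: real^'n. \<bar>pds is G x\<bar> \<le> A" by (rule G_bounded) (rule that)
  obtain f where f: "decay_class f" "\<And>x :: real^'n. x \<noteq> 0 \<Longrightarrow> pds is G x = f x" using pds_G_decay_class by blast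
  obtain B where B: "0 \<le> B" "\<And>x. 1 \<le> norm x \<Longrightarrow> \<bar>f x\<bar> \<le> B * kern x" using decay_class_bound[OF f(1)] by blast
  have "\<bar>pds is G x\<bar> \<le> B * kern x" if "1 \<le> norm x" for x
    using B(2)[OF that] f(2)[of x] that by (cases "x = 0") auto
  from bounded_decay_wt[OF A B(1) this] show ?thesis
    using A(1) B(1) by (intro that[of "(A + B) * 2 powr (real CARD('n) + 2 * s)"]) auto
qed

lemma G_integrable: "integrable lborel (G :: real^'n \<Rightarrow> real)"
proof -
  obtain C where "0 \<le> C" "\<And>x :: real^'n. \<bar>G x\<bar> \<le> C * wt x" using G_bound[of "[]"] by auto
  then show ?thesis
    by (intro Bochner_Integration.integrable_bound[OF integrable_mult_right[OF integrable_wt, of C]])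
      (auto intro!: AE_I2)
qed

text \<open>A nonnegative continuous function with integral 0 vanishes everywhere, which is
  incompatible with the positive value of \<open>G\<close> at 0.\<close>

lemma integral_G_pos: "0 < (\<integral>x. G x \<partial>(lborel :: (real^'n) measure))"
proof -
  have "(\<integral>x. G x \<partial>(lborel :: (real^'n) measure)) \<noteq> 0"
  proof
    assume "(\<integral>x. G x \<partial>(lborel :: (real^'n) measure)) = 0"
    then have "AE x in lborel. G (x :: real^'n) = 0"
      by (subst (asm) integral_nonneg_eq_0_iff_AE[OF G_integrable]) (auto simp: G_nonneg)
    then have "AE x in lebesgue. (x :: real^'n) \<in> {x. G x = 0}" by (auto intro: AE_completion)
    moreover have "closed {x :: real^'n. G x = 0}"
      using G_continuous[of UNIV "[]"] by (intro closed_Collect_eq continuous_intros) auto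
    ultimately have "G (0 :: real^'n) = 0" using mem_closed_if_AE_lebesgue by blast
    then show False using G_0_pos[where 'n='n] by simp
  qed
  moreover have "0 \<le> (\<integral>x. G x \<partial>(lborel :: (real^'n) measure))"
    by (intro Bochner_Integration.integral_nonneg G_nonneg)
  ultimately show ?thesis by simp
qed

lemma G_radial:
  fixes x y :: "real^'n"
  assumes "norm x = norm y" shows "G x = G y"
proof -
  obtain e :: "real^'n" where e: "norm e = 1" by (rule exists_unit_vector)
  show ?thesis
    using assms by (cases "x = 0"; cases "y = 0") (auto simp: G_polar[OF e])
qed

end

section \<open>Reproduction of solutions almost everywhere\<close>

lemma integrable_pair_mult:
  fixes f :: "'a::euclidean_space \<Rightarrow> real" and g :: "'b::euclidean_space \<Rightarrow> real"
  assumes f: "integrable lborel f" and g: "integrable lborel g"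
  shows "integrable (lborel \<Otimes>\<^sub>M lborel) (\<lambda>(x, y). f x * g y)"
proof -
  note [measurable] = borel_measurable_integrable[OF f] borel_measurable_integrable[OF g]
  show ?thesis
  proof (rule lborel_pair.Fubini_integrable)
    show "(\<lambda>(x, y). f x * g y) \<in> borel_measurable (lborel \<Otimes>\<^sub>M lborel)"
      using f g by measurable
    show "integrable lborel (\<lambda>x. \<integral>y. norm (case (x, y) of (x, y) \<Rightarrow> f x * g y) \<partial>lborel)"
      using f by (simp add: abs_mult)
    show "AE x in lborel. integrable lborel (\<lambda>y. case (x, y) of (x, y) \<Rightarrow> f x * g y)"
      using g by simp
  qed
qed

text \<open>Inside one box, boxes form an intersection-stable generator, so vanishing integrals
  extend to all Borel subsets and the density is zero almost everywhere. An open set is a countable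
  union of boxes.\<close>

lemma box_integrals_zero_imp_AE_zero:
  fixes f :: "'a::euclidean_space \<Rightarrow> real"
  assumes B: "open B"
    and int: "\<And>a b. box a b \<subseteq> B \<Longrightarrow> integrable lborel (\<lambda>x. indicator (box a b) x * f x)"
    and zero: "\<And>a b. box a b \<subseteq> B \<Longrightarrow> (\<integral>x. indicator (box a b) x * f x \<partial>lborel) = 0"
  shows "AE x in lborel. x \<in> B \<longrightarrow> f x = 0"
proof -
  have box: "AE x in lborel. x \<in> box a b \<longrightarrow> f x = 0" if ab: "box a b \<subseteq> B" for a b
  proof -
    let ?g = "\<lambda>x. indicator (box a b) x * f x"
    have gi: "integrable lborel ?g" by (rule int[OF ab])
    have si: "set_integrable lborel A ?g" if "A \<in> sets borel" for A
      unfolding set_integrable_def using gi that by (intro integrable_mult_indicator) auto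
    have "set_lebesgue_integral lborel A ?g = 0" if "A \<in> sets borel" for A
    proof -
      let ?E = "range (\<lambda>(a, b). box a b :: 'a set)"
      have "Int_stable ?E" by (auto simp: Int_stable_def box_Int_box)
      moreover have "?E \<subseteq> Pow UNIV" by simp
      moreover have "A \<in> sigma_sets UNIV ?E" using that by (simp add: borel_eq_box)
      ultimately show ?thesis
      proof (induction rule: sigma_sets_induct_disjoint)
        case (basic A)
        then obtain c d where A: "A = box c d" by auto
        obtain p q where pq: "box c d \<inter> box a b = box p q" by (auto simp: box_Int_box)
        have "(\<integral>x. indicator (box p q) x * f x \<partial>lborel) = 0"
          using pq ab by (intro zero) blast
        then show ?case unfolding set_lebesgue_integral_def A pq[symmetric]
          by (simp add: indicator_inter_arith mult.assoc)
      next
        case empty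
        then show ?case by (simp add: set_lebesgue_integral_def)
      next
        case (compl A)
        have A: "A \<in> sets borel" using compl.hyps by (simp add: borel_eq_box)
        have "(\<integral>x. ?g x \<partial>lborel) = set_lebesgue_integral lborel A ?g + set_lebesgue_integral lborel (UNIV - A) ?g"
          using set_integral_Un[of A "UNIV - A" lborel ?g] si[of A] si[of "UNIV - A"] A
          by (simp add: set_lebesgue_integral_def[of _ UNIV])
        then show ?case using compl.IH zero[OF ab] by simp
      next
        case (union A)
        have A: "A i \<in> sets borel" for i using union.hyps by (auto simp: borel_eq_box)
        have "set_lebesgue_integral lborel (\<Union>i. A i) ?g = (\<Sum>i. set_lebesgue_integral lborel (A i) ?g)"
          using A union.hyps by (intro lebesgue_integral_countable_add si) (auto simp: disjoint_family_on_def)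
        then show ?case using union.IH by simp
      qed
    qed
    then have "AE x in lborel. ?g x = 0" by (intro sigma_finite_measure.density_zero[OF sigma_finite_lborel gi]) auto
    then show ?thesis by eventually_elim (auto simp: indicator_def)
  qed
  obtain \<D> where D: "countable \<D>" "\<And>X. X \<in> \<D> \<Longrightarrow> \<exists>a b. X = box a b" "\<Union>\<D> = B"
    using open_countable_Union_open_box[OF B] by metis
  have "AE x in lborel. \<forall>X\<in>\<D>. x \<in> X \<longrightarrow> f x = 0"
  proof (rule AE_ball_countable'[OF _ D(1)])
    fix X assume X: "X \<in> \<D>"
    then obtain a b where "X = box a b" using D(2) by blast
    then show "AE x in lborel. x \<in> X \<longrightarrow> f x = 0" using box[of a b] D(3) X by auto
  qed
  then show ?thesis unfolding D(3)[symmetric] by eventually_elim blast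
qed

lemma inverse_le_of_less: "0 < (e::real) \<Longrightarrow> 1 / e < t \<Longrightarrow> 0 < t \<and> 1 / t \<le> e"
  using less_trans[of 0 "1 / e" t] by (simp add: pos_divide_less_eq pos_divide_le_eq mult.commute)

lemma powr_scale_minus: "0 < d \<Longrightarrow> 0 \<le> q \<Longrightarrow> (q / d) powr - a = d powr a * q powr - (a::real)"
  by (simp add: powr_divide powr_minus_divide)

context frac_order
begin

definition Gs :: "real \<Rightarrow> real ^ 'n \<Rightarrow> real" where
  "Gs d z = G ((1 / d) *\<^sub>R z) / d ^ CARD('n)"

lemma Gs_measurable[measurable]: "Gs d \<in> borel_measurable borel"
  unfolding Gs_def[abs_def] by measurable

lemma wt_affine_le:
  fixes x y :: "real^'n"
  assumes d: "0 < d" "1 + norm x + d \<le> c"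
  shows "wt ((1 / d) *\<^sub>R (y - x)) \<le> c powr (real CARD('n) + 2 * s) * wt y"
proof (rule wt_scale)
  show "1 \<le> c" using d norm_ge_zero[of x] by linarith
  let ?q = "norm ((1 / d) *\<^sub>R (y - x))"
  have q: "norm (y - x) = d * ?q" using d by simp
  have "1 + norm y \<le> 1 + norm x + d * ?q" using norm_triangle_ineq[of x "y - x", simplified] q by linarith
  also have "\<dots> \<le> c + c * ?q"
    by (intro add_mono mult_right_mono norm_ge_zero) (use d norm_ge_zero[of x] in linarith)+
  finally show "1 + norm y \<le> c * (1 + ?q)" by (simp add: algebra_simps)
qed

text \<open>Substitution moves the scale from the argument into the limit of integration, so that
  two dilates differ by an integral over an interval. The variable t is the reciprocal of a
  scale.\<close>

lemma Gs_eq: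
  fixes z :: "real^'n"
  assumes d: "0 < d"
  shows "Gs d z = (\<integral>t. indicator {0..1 / d} t * (t ^ (CARD('n) - 1) * P (t *\<^sub>R z)) \<partial>lborel)"
proof -
  let ?n = "CARD('n)"
  have "(\<integral>t. indicator {0..1 / d} t * (t ^ (?n - 1) * P (t *\<^sub>R z)) \<partial>lborel) =
     (1 / d) * (\<integral>t. indicator {0..1 / d} ((1 / d) * t) * (((1 / d) * t) ^ (?n - 1) * P (((1 / d) * t) *\<^sub>R z)) \<partial>lborel)"
    using d by (subst lborel_integral_real_affine[of "1 / d" _ 0]) auto
  also have "(\<lambda>t. indicator {0..1 / d} ((1 / d) * t) * (((1 / d) * t) ^ (?n - 1) * P (((1 / d) * t) *\<^sub>R z))) =
     (\<lambda>t. (1 / d) ^ (?n - 1) * (indicator {0..1} t * (t ^ (?n - 1) * P (t *\<^sub>R ((1 / d) *\<^sub>R z)))))"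
    using d by (auto simp: fun_eq_iff indicator_def power_mult_distrib power_divide field_simps)
  also have "(1 / d) * (\<integral>t. (1 / d) ^ (?n - 1) * (indicator {0..1} t * (t ^ (?n - 1) * P (t *\<^sub>R ((1 / d) *\<^sub>R z)))) \<partial>lborel)
     = (1 / d) ^ ?n * G ((1 / d) *\<^sub>R z)"
    by (simp add: G_def avg_def power_eq_if[of _ ?n] power_divide)
  finally show ?thesis by (simp add: Gs_def power_divide)
qed

lemma P_scaled_integrable:
  fixes z :: "real^'n"
  assumes "A \<in> sets borel" "A \<subseteq> {a..b}"
  shows "integrable lborel (\<lambda>t. indicator A t * (t ^ (CARD('n) - 1) * P (t *\<^sub>R z)))"
proof -
  have "set_integrable lborel {a..b} (\<lambda>t. t ^ (CARD('n) - 1) * P (t *\<^sub>R z))"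
    by (intro borel_integrable_atLeastAtMost' continuous_intros radial_profile_continuous)
  then have "set_integrable lborel A (\<lambda>t. t ^ (CARD('n) - 1) * P (t *\<^sub>R z))"
    by (rule set_integrable_subset) (use assms in auto)
  then show ?thesis by (simp add: set_integrable_def)
qed

lemma Gs_diff:
  fixes z :: "real^'n"
  assumes d: "0 < d" "d \<le> e"
  shows "Gs d z - Gs e z = (\<integral>t. indicator {1 / e<..1 / d} t * (t ^ (CARD('n) - 1) * P (t *\<^sub>R z)) \<partial>lborel)"
proof -
  let ?f = "\<lambda>t. t ^ (CARD('n) - 1) * P (t *\<^sub>R z)"
  have le: "1 / e \<le> 1 / d" "0 < e" "0 < 1 / e" using d by (auto intro!: divide_left_mono)
  have pos: "0 \<le> t" if "1 / e < t" for t using less_trans[OF le(3) that] by simp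
  have "Gs d z = (\<integral>t. indicator {0..1 / e} t * ?f t + indicator {1 / e<..1 / d} t * ?f t \<partial>lborel)"
    unfolding Gs_eq[OF d(1)]
  proof (intro Bochner_Integration.integral_cong refl)
    fix t :: real
    show "indicator {0..1 / d} t * ?f t = indicator {0..1 / e} t * ?f t + indicator {1 / e<..1 / d} t * ?f t"
      using le(1) pos[of t] by (cases "1 / e < t") (auto simp: indicator_def simp del: le_divide_eq_1 zero_less_divide_1_iff)
  qed
  also have "\<dots> = Gs e z + (\<integral>t. indicator {1 / e<..1 / d} t * ?f t \<partial>lborel)"
    unfolding Gs_eq[OF le(2)]
    by (intro Bochner_Integration.integral_add P_scaled_integrable[of "{0..1 / e}" 0 "1 / e"]
        P_scaled_integrable[of "{1 / e<..1 / d}" "1 / e" "1 / d"]) auto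
  finally show ?thesis by simp
qed

text \<open>The interval \<open>{1 / e<..1 / d}\<close> is bounded and stays away from 0, so one
  integrable majorant serves all its t and Fubini applies. The inner integral then vanishes by
  \<open>H\<close> at the scale \<open>1 / t\<close>, which is at most \<open>e\<close>.\<close>

lemma integral_Gs_eq:
  fixes u :: "real^'n \<Rightarrow> real"
  assumes u: "tame u"
    and H: "\<And>t. 0 < t \<Longrightarrow> t \<le> e \<Longrightarrow> (\<integral>y. u y * P ((1 / t) *\<^sub>R (y - x)) \<partial>lborel) = 0"
    and d: "0 < d" "d \<le> e"
  shows "(\<integral>y. u y * Gs d (y - x) \<partial>lborel) = (\<integral>y. u y * Gs e (y - x) \<partial>lborel)"
proof -
  note [measurable] = tame_measurable[OF u]
  let ?n = "CARD('n)" and ?a = "real CARD('n) + 2 * s"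
  let ?I = "indicator {1 / e<..1 / d} :: real \<Rightarrow> real"
  obtain C where C: "0 \<le> C" "\<And>x :: real^'n. \<bar>P x\<bar> \<le> C * wt x" using P_bound[of "[]"] by (metis pds.simps(1))
  obtain C' where C': "0 \<le> C'" "\<And>x :: real^'n. \<bar>G x\<bar> \<le> C' * wt x" using G_bound[of "[]"] by (metis pds.simps(1))
  have Gi: "integrable lborel (\<lambda>y. u y * Gs d' (y - x))" if "0 < d'" for d'
  proof (rule tame_integrable_bound[OF u])
    show "\<bar>Gs d' (y - x)\<bar> \<le> (C' * (1 + norm x + d') powr ?a / d' ^ ?n) * wt y" for y
    proof -
      have "\<bar>G ((1 / d') *\<^sub>R (y - x))\<bar> \<le> C' * wt ((1 / d') *\<^sub>R (y - x))" by (rule C')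
      also have "\<dots> \<le> C' * ((1 + norm x + d') powr ?a * wt y)"
        using that C'(1) by (intro mult_left_mono wt_affine_le) auto
      finally show ?thesis using that by (simp add: Gs_def divide_right_mono)
    qed
  qed measurable
  have e: "0 < e" using d by simp
  have fin: "emeasure lborel {1 / e<..1 / d} < \<infinity>"
    by (rule emeasure_bounded_finite) (rule bounded_subset[of "{1 / e..1 / d}"], auto)
  let ?F = "\<lambda>(y, t). u y * (?I t * (t ^ (?n - 1) * P (t *\<^sub>R (y - x))))"
  \<comment> \<open>\<open>wt_affine_le\<close> at the scale \<open>1 / t \<le> e\<close> produces
    the power of \<open>1 + norm x + e\<close>; the factor \<open>t ^ (?n - 1)\<close> is at most
    its value at \<open>t = 1 / d\<close>.\<close>
  let ?K = "C * ((1 + norm x + e) powr ?a) * (1 / d) ^ (?n - 1)"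
  have F: "integrable (lborel \<Otimes>\<^sub>M lborel) ?F"
  proof (rule Bochner_Integration.integrable_bound)
    show "integrable (lborel \<Otimes>\<^sub>M lborel) (\<lambda>(y, t). (u y * wt y) * (?I t * ?K))"
      using u by (intro integrable_pair_mult integrable_mult_left integrable_real_indicator fin) (auto simp: tame_def)
    show "?F \<in> borel_measurable (lborel \<Otimes>\<^sub>M lborel)" by measurable
    have "\<bar>?F (y, t)\<bar> \<le> \<bar>(u y * wt y) * (?I t * ?K)\<bar>" for y t
    proof (cases "t \<in> {1 / e<..1 / d}")
      case True
      then have t: "0 < t" "t \<le> 1 / d" "1 / t \<le> e" using inverse_le_of_less[OF e] by auto
      have "\<bar>P (t *\<^sub>R (y - x))\<bar> \<le> C * wt ((1 / (1 / t)) *\<^sub>R (y - x))" using C(2) by simp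
      also have "\<dots> \<le> C * ((1 + norm x + e) powr ?a * wt y)"
        using t C(1) by (intro mult_left_mono wt_affine_le) auto
      finally have "t ^ (?n - 1) * \<bar>P (t *\<^sub>R (y - x))\<bar> \<le> (1 / d) ^ (?n - 1) * (C * ((1 + norm x + e) powr ?a * wt y))"
        using t d by (intro mult_mono power_mono) auto
      also have "\<dots> = wt y * ?K" by (simp add: mult_ac)
      finally have "\<bar>u y\<bar> * (t ^ (?n - 1) * \<bar>P (t *\<^sub>R (y - x))\<bar>) \<le> \<bar>u y\<bar> * (wt y * ?K)"
        by (rule mult_left_mono) simp
      then show ?thesis using True t C(1) d by (simp add: abs_mult mult.assoc)
    qed auto
    then show "AE w in lborel \<Otimes>\<^sub>M lborel. norm (?F w) \<le> norm (case w of (y, t) \<Rightarrow> (u y * wt y) * (?I t * ?K))"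
      by (intro AE_I2) auto
  qed
  have "(\<integral>y. u y * Gs d (y - x) \<partial>lborel) - (\<integral>y. u y * Gs e (y - x) \<partial>lborel) =
    (\<integral>y. u y * (Gs d (y - x) - Gs e (y - x)) \<partial>lborel)"
    using Gi[OF d(1)] Gi[OF e] by (simp add: right_diff_distrib)
  also have "\<dots> = (\<integral>y. (\<integral>t. ?F (y, t) \<partial>lborel) \<partial>lborel)"
    by (simp add: Gs_diff[OF d])
  also have "\<dots> = (\<integral>t. (\<integral>y. ?F (y, t) \<partial>lborel) \<partial>lborel)"
    using lborel_pair.Fubini_integral[of "\<lambda>y t. ?F (y, t)"] F by simp
  also have "\<dots> = (\<integral>t. 0 \<partial>(lborel :: real measure))"
  proof (rule Bochner_Integration.integral_cong[OF refl])
    fix t :: real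
    show "(\<integral>y. ?F (y, t) \<partial>lborel) = 0"
    proof (cases "t \<in> {1 / e<..1 / d}")
      case True
      then have t: "0 < t" "1 / t \<le> e" using inverse_le_of_less[OF e] by auto
      have "(\<integral>y. ?F (y, t) \<partial>lborel) = (\<integral>y. t ^ (?n - 1) * (u y * P ((1 / (1 / t)) *\<^sub>R (y - x))) \<partial>lborel)"
        using True by (intro Bochner_Integration.integral_cong) (auto simp: mult_ac)
      also have "\<dots> = 0" using H[of "1 / t"] t by simp
      finally show ?thesis .
    qed auto
  qed
  finally show ?thesis by simp
qed

lemma integral_G_shift:
  fixes y :: "real^'n"
  assumes A[measurable]: "A \<in> sets borel" and d: "0 < d"
  shows "(\<integral>x. indicator A x * Gs d (y - x) \<partial>lborel) = (\<integral>z. indicator A (y - d *\<^sub>R z) * G z \<partial>lborel)"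
proof -
  have "(\<integral>z. (\<lambda>x. indicator A x * Gs d (y - x)) (y + (- d) *\<^sub>R z) \<partial>lborel) =
     (\<integral>x. indicator A x * Gs d (y - x) \<partial>lborel) / \<bar>- d\<bar> ^ DIM(real^'n)"
    using d by (intro lborel_integral_affine(1)) auto
  moreover have "(\<lambda>z. (\<lambda>x. indicator A x * Gs d (y - x)) (y + (- d) *\<^sub>R z)) = (\<lambda>z. (indicator A (y - d *\<^sub>R z) * G z) / d ^ CARD('n))"
    using d by (auto simp: Gs_def fun_eq_iff)
  ultimately show ?thesis using d by simp
qed

lemma integral_G_shift_tendsto:
  fixes y :: "real^'n"
  assumes A[measurable]: "A \<in> sets borel" and y: "y \<notin> frontier A" and e: "0 < e"
  shows "(\<lambda>m. \<integral>x. indicator A x * Gs (e / real (Suc m)) (y - x) \<partial>lborel) \<longlonglongrightarrow> indicator A y * (\<integral>z. G z \<partial>(lborel :: (real^'n) measure))"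
proof -
  have "(\<lambda>m. \<integral>z. indicator A (y - (e / real (Suc m)) *\<^sub>R z) * G z \<partial>lborel) \<longlonglongrightarrow> (\<integral>z. indicator A y * G z \<partial>(lborel :: (real^'n) measure))"
  proof (rule integral_dominated_convergence[OF _ _ integrable_abs[OF G_integrable]])
    show "AE z in lborel. (\<lambda>m. indicator A (y - (e / real (Suc m)) *\<^sub>R z) * G z) \<longlonglongrightarrow> indicator A y * G z"
    proof (intro AE_I2 tendsto_mult tendsto_const)
      fix z :: "real^'n"
      have "isCont (indicator A :: real^'n \<Rightarrow> real) y" using y isCont_indicator[of y A] by simp
      moreover have "(\<lambda>m. y - (e / real (Suc m)) *\<^sub>R z) \<longlonglongrightarrow> y"
        using tendsto_diff[OF tendsto_const[of y] tendsto_scaleR[OF LIMSEQ_Suc[OF lim_const_over_n[of e]] tendsto_const[of z]]]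
        by (simp del: of_nat_Suc)
      ultimately show "(\<lambda>m. indicator A (y - (e / real (Suc m)) *\<^sub>R z) :: real) \<longlonglongrightarrow> indicator A y"
        by (rule isCont_tendsto_compose)
    qed
    show "AE z in lborel. norm (indicator A (y - (e / real (Suc m)) *\<^sub>R z) * G z) \<le> \<bar>G z\<bar>" for m
      by (intro AE_I2) (auto simp: indicator_def)
  qed auto
  then show ?thesis using e by (simp add: integral_G_shift del: of_nat_Suc)
qed

text \<open>The majorant for the passage d -> 0. For \<open>y\<close> near \<open>A\<close> the
  integral is bounded by that of |G|, by scaling. For \<open>y\<close> far away the decay of
  \<open>G\<close> gives d^(-n) (d / |y - x|)^(n + 2s) = d^(2s) |y - x|^(-n-2s), and d^(2s) is at
  most e^(2s).\<close>

lemma integral_G_shift_bound: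
  fixes A :: "(real^'n) set"
  assumes A[measurable]: "A \<in> sets borel" and R: "1 \<le> R" "A \<subseteq> ball 0 R" and e: "0 < e"
  obtains K where "\<And>d y. 0 < d \<Longrightarrow> d \<le> e \<Longrightarrow> \<bar>\<integral>x. indicator A x * Gs d (y - x) \<partial>lborel\<bar> \<le> K * wt y"
proof -
  let ?n = "CARD('n)" and ?a = "real CARD('n) + 2 * s"
  obtain C where C: "0 \<le> C" "\<And>x :: real^'n. \<bar>G x\<bar> \<le> C * wt x" using G_bound[of "[]"] by (metis pds.simps(1))
  let ?I = "\<integral>z. \<bar>G z\<bar> \<partial>(lborel :: (real^'n) measure)"
  let ?m = "measure lborel A"
  have fin: "emeasure lborel A < \<infinity>" using R(2) by (metis bounded_ball bounded_subset emeasure_bounded_finite)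
  let ?K = "(1 + 2 * R) powr ?a * ?I + C * e powr (2 * s) * 4 powr ?a * ?m"
  have nn: "0 \<le> ?I" "0 \<le> C * e powr (2 * s) * 4 powr ?a * ?m" using C(1) by (auto intro!: Bochner_Integration.integral_nonneg mult_nonneg_nonneg)
  show ?thesis
  proof (rule that[of ?K])
    fix d and y :: "real^'n" assume d: "0 < d" "d \<le> e"
    show "\<bar>\<integral>x. indicator A x * Gs d (y - x) \<partial>lborel\<bar> \<le> ?K * wt y"
    proof (cases "norm y \<le> 2 * R")
      case True
      have "norm (\<integral>z. indicator A (y - d *\<^sub>R z) * G z \<partial>lborel) \<le> ?I"
        by (rule Bochner_Integration.integral_norm_bound_integral[OF Bochner_Integration.integrable_bound[OF G_integrable]])
          (auto intro!: integrable_abs G_integrable AE_I2 simp: indicator_def)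
      then have "\<bar>\<integral>x. indicator A x * Gs d (y - x) \<partial>lborel\<bar> \<le> 1 * ?I"
        using integral_G_shift[OF A d(1), of y] by simp
      also have "\<dots> \<le> ((1 + 2 * R) powr ?a * wt y) * ?I"
        using True nn by (intro mult_right_mono wt_near_le) auto
      also have "\<dots> \<le> ?K * wt y" using nn(2) by (simp add: distrib_right mult_ac)
      finally show ?thesis .
    next
      case False
      have b: "\<bar>Gs d (y - x)\<bar> \<le> C * e powr (2 * s) * 4 powr ?a * wt y" if x: "x \<in> A" for x
      proof -
        have nx: "norm x < R" using R x by auto
        have xy: "norm y \<le> 2 * norm (y - x)" using nx False norm_triangle_ineq2[of y x] by linarith
        then have yx: "0 < norm (y - x)" using False R by linarith
        have "\<bar>G ((1 / d) *\<^sub>R (y - x))\<bar> \<le> C * kern ((1 / d) *\<^sub>R (y - x))"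
          using yx d C(1) by (intro order_trans[OF C(2)] mult_left_mono wt_le_kern) auto
        also have "kern ((1 / d) *\<^sub>R (y - x)) = d powr ?a * kern (y - x)"
          using powr_scale_minus[OF d(1) norm_ge_zero[of "y - x"], of ?a] d(1) by (simp add: kern_def)
        finally have "\<bar>Gs d (y - x)\<bar> \<le> C * (d powr ?a * kern (y - x)) / d ^ ?n"
          using d by (simp add: Gs_def divide_right_mono)
        also have "\<dots> = C * d powr (2 * s) * kern (y - x)"
          using d by (simp add: powr_add powr_realpow)
        also have "\<dots> \<le> C * e powr (2 * s) * (4 powr ?a * wt y)"
          using d C(1) s_pos False R xy by (intro mult_mono powr_mono2 kern_far_le[of R]) auto
        finally show ?thesis by (simp add: mult.assoc)
      qed
      have "norm (\<integral>x. indicator A x * Gs d (y - x) \<partial>lborel) \<le> (\<integral>x. indicator A x * (C * e powr (2 * s) * 4 powr ?a * wt y) \<partial>lborel)"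
      proof (rule Bochner_Integration.integral_norm_bound_integral)
        show i: "integrable lborel (\<lambda>x. indicator A x * (C * e powr (2 * s) * 4 powr ?a * wt y))"
          using fin by (intro integrable_mult_left integrable_real_indicator) auto
        have le: "norm (indicator A x * Gs d (y - x)) \<le> indicator A x * (C * e powr (2 * s) * 4 powr ?a * wt y)" for x
          using b[of x] by (auto simp: indicator_def)
        then show "\<And>x. norm (indicator A x * Gs d (y - x)) \<le> indicator A x * (C * e powr (2 * s) * 4 powr ?a * wt y)" .
        show "integrable lborel (\<lambda>x. indicator A x * Gs d (y - x))"
          by (rule Bochner_Integration.integrable_bound[OF i], measurable, rule AE_I2, rule order_trans[OF le], simp)
      qed
      also have "\<dots> = ?m * (C * e powr (2 * s) * 4 powr ?a * wt y)" using fin by simp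
      also have "\<dots> \<le> ?K * wt y" using nn(1) by (simp add: distrib_right mult_ac)
      finally show ?thesis by simp
    qed
  qed
qed

definition conv :: "real \<Rightarrow> (real^'n \<Rightarrow> real) \<Rightarrow> real^'n \<Rightarrow> real" where
  "conv e u x = (\<integral>y. u y * Gs e (y - x) \<partial>lborel)"

lemma conv_kernel_bound:
  obtains C where "0 \<le> C" "\<And>d c x y. 0 < d \<Longrightarrow> 1 + norm x + d \<le> c \<Longrightarrow> \<bar>Gs d (y - x)\<bar> \<le> C / d ^ CARD('n) * c powr (real CARD('n) + 2 * s) * wt (y :: real^'n)"
proof -
  obtain C where C: "0 \<le> C" "\<And>x :: real^'n. \<bar>G x\<bar> \<le> C * wt x" using G_bound[of "[]"] by (metis pds.simps(1))
  show ?thesis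
  proof (rule that[OF C(1)])
    fix d c :: real and x y :: "real^'n" assume d: "0 < d" "1 + norm x + d \<le> c"
    have "\<bar>G ((1 / d) *\<^sub>R (y - x))\<bar> \<le> C * wt ((1 / d) *\<^sub>R (y - x))" by (rule C)
    also have "\<dots> \<le> C * (c powr (real CARD('n) + 2 * s) * wt y)"
      using d C(1) by (intro mult_left_mono wt_affine_le) auto
    finally show "\<bar>Gs d (y - x)\<bar> \<le> C / d ^ CARD('n) * c powr (real CARD('n) + 2 * s) * wt y"
      using d by (simp add: Gs_def divide_right_mono mult.assoc)
  qed
qed

lemma integral_conv:
  fixes u :: "real^'n \<Rightarrow> real"
  assumes u: "tame u" and A[measurable]: "A \<in> sets borel" and R: "1 \<le> R" "A \<subseteq> ball 0 R" and d: "0 < d"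
  shows "integrable lborel (\<lambda>x. indicator A x * conv d u x)"
    and "(\<integral>x. indicator A x * conv d u x \<partial>lborel) = (\<integral>y. u y * (\<integral>x. indicator A x * Gs d (y - x) \<partial>lborel) \<partial>lborel)"
proof -
  note [measurable] = tame_measurable[OF u]
  obtain C where C: "0 \<le> C" "\<And>d c x y. 0 < d \<Longrightarrow> 1 + norm x + d \<le> c \<Longrightarrow> \<bar>Gs d (y - x)\<bar> \<le> C / d ^ CARD('n) * c powr (real CARD('n) + 2 * s) * wt (y :: real^'n)"
    by (rule conv_kernel_bound) (rule that)
  have fin: "emeasure lborel A < \<infinity>" using R(2) by (metis bounded_ball bounded_subset emeasure_bounded_finite)
  let ?K = "C / d ^ CARD('n) * (1 + R + d) powr (real CARD('n) + 2 * s)"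
  let ?F = "\<lambda>(x, y). indicator A x * (u y * Gs d (y - x))"
  have F: "integrable (lborel \<Otimes>\<^sub>M lborel) ?F"
  proof (rule Bochner_Integration.integrable_bound)
    show "integrable (lborel \<Otimes>\<^sub>M lborel) (\<lambda>(x, y). (indicator A x * ?K) * (u y * wt y))"
      using u fin by (intro integrable_pair_mult integrable_mult_left integrable_real_indicator) (auto simp: tame_def)
    show "?F \<in> borel_measurable (lborel \<Otimes>\<^sub>M lborel)" by measurable
    have "\<bar>?F (x, y)\<bar> \<le> \<bar>(indicator A x * ?K) * (u y * wt y)\<bar>" for x y
    proof (cases "x \<in> A")
      case True
      then have "norm x < R" using R by auto
      then have "\<bar>Gs d (y - x)\<bar> \<le> ?K * wt y" using d by (intro C) auto
      then have "\<bar>u y\<bar> * \<bar>Gs d (y - x)\<bar> \<le> \<bar>u y\<bar> * (?K * wt y)" by (rule mult_left_mono) simp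
      then show ?thesis using True C(1) d R by (simp add: abs_mult mult_ac)
    qed auto
    then show "AE w in lborel \<Otimes>\<^sub>M lborel. norm (?F w) \<le> norm (case w of (x, y) \<Rightarrow> (indicator A x * ?K) * (u y * wt y))"
      by (intro AE_I2) auto
  qed
  have c: "(\<integral>y. ?F (x, y) \<partial>lborel) = indicator A x * conv d u x" for x by (simp add: conv_def)
  show "integrable lborel (\<lambda>x. indicator A x * conv d u x)"
    using lborel_pair.integrable_fst'[OF F] unfolding c .
  have "(\<integral>x. indicator A x * conv d u x \<partial>lborel) = (\<integral>y. (\<integral>x. ?F (x, y) \<partial>lborel) \<partial>lborel)"
    using lborel_pair.Fubini_integral[of "\<lambda>x y. ?F (x, y)"] F by (simp add: conv_def)
  also have "\<dots> = (\<integral>y. u y * (\<integral>x. indicator A x * Gs d (y - x) \<partial>lborel) \<partial>lborel)"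
    by (simp add: mult.left_commute)
  finally show "(\<integral>x. indicator A x * conv d u x \<partial>lborel) = (\<integral>y. u y * (\<integral>x. indicator A x * Gs d (y - x) \<partial>lborel) \<partial>lborel)" .
qed

text \<open>\<open>u\<close> is merely integrable, so no pointwise limit is available. Integrated
  over a box, the convolution is moved onto the indicator, where it converges off the null frontier
  under a fixed majorant. By \<open>integral_Gs_eq\<close> these box integrals are independent of
  the scale, so the limit is an identity on every box.\<close>

lemma conv_eq_AE:
  fixes u :: "real^'n \<Rightarrow> real"
  assumes u: "tame u" and e: "0 < e" and B: "open B" "bounded B"
    and H: "\<And>x t. x \<in> B \<Longrightarrow> 0 < t \<Longrightarrow> t \<le> e \<Longrightarrow> (\<integral>y. u y * P ((1 / t) *\<^sub>R (y - x)) \<partial>lborel) = 0"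
  shows "AE x in lborel. x \<in> B \<longrightarrow> conv e u x = (\<integral>z. G z \<partial>(lborel :: (real^'n) measure)) * u x"
proof -
  note [measurable] = tame_measurable[OF u]
  let ?c = "\<integral>z. G z \<partial>(lborel :: (real^'n) measure)"
  obtain R0 where "0 < R0" "\<forall>x\<in>B. norm x \<le> R0" using B(2) bounded_pos by metis
  then obtain R where R: "1 \<le> R" "B \<subseteq> ball 0 R"
    by (intro that[of "R0 + 1"]) (auto intro: le_less_trans)
  have "AE x in lborel. x \<in> B \<longrightarrow> conv e u x - ?c * u x = 0"
  proof (rule box_integrals_zero_imp_AE_zero[OF B(1)])
    fix a b assume ab: "box a b \<subseteq> B"
    let ?A = "box a b"
    have AR: "?A \<subseteq> ball 0 R" using ab R by blast
    have b: "\<bar>indicator ?A y\<bar> \<le> (1 + R) powr (real CARD('n) + 2 * s) * wt y" for y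
      using wt_near_le[of y R] AR R by (auto simp: indicator_def intro: less_imp_le)
    have iu: "integrable lborel (\<lambda>x. u x * indicator ?A x)"
      by (rule tame_integrable_bound[OF u _ b]) measurable
    have i: "integrable lborel (\<lambda>x. indicator ?A x * conv e u x)" "integrable lborel (\<lambda>x. ?c * (u x * indicator ?A x))"
      using iu by (auto intro!: integral_conv(1)[OF u _ R(1) AR e])
    have eq: "(\<lambda>x. indicator ?A x * (conv e u x - ?c * u x)) = (\<lambda>x. indicator ?A x * conv e u x - ?c * (u x * indicator ?A x))"
      by (auto simp: fun_eq_iff algebra_simps)
    show "integrable lborel (\<lambda>x. indicator ?A x * (conv e u x - ?c * u x))"
      unfolding eq using i by (rule Bochner_Integration.integrable_diff)
    obtain K where K: "\<And>d y. 0 < d \<Longrightarrow> d \<le> e \<Longrightarrow> \<bar>\<integral>x. indicator ?A x * Gs d (y - x) \<partial>lborel\<bar> \<le> K * wt y"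
      by (rule integral_G_shift_bound[OF _ R(1) AR e]) (auto intro: that)
    let ?w = "\<lambda>m y. \<integral>x. indicator ?A x * Gs (e / real (Suc m)) (y - x) \<partial>lborel"
    have em: "0 < e / real (Suc m)" "e / real (Suc m) \<le> e" for m using e by (auto simp: field_simps)
    have "(\<lambda>m. \<integral>y. u y * ?w m y \<partial>lborel) \<longlonglongrightarrow> (\<integral>y. u y * (indicator ?A y * ?c) \<partial>lborel)"
    proof (rule integral_dominated_convergence[where w="\<lambda>y. \<bar>u y * (K * wt y)\<bar>"])
      have K0: "0 \<le> K"
      proof (rule ccontr)
        assume "\<not> 0 \<le> K"
        then have "K * wt (0 :: real^'n) < 0" by (intro mult_neg_pos) auto
        with order_trans[OF abs_ge_zero K[OF em, of 0 0]] show False by linarith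
      qed
      show "integrable lborel (\<lambda>y. \<bar>u y * (K * wt y)\<bar>)"
        using K0 by (intro integrable_abs tame_integrable_bound[OF u, where C=K]) (auto simp: abs_mult)
      show "AE y in lborel. norm (u y * ?w m y) \<le> \<bar>u y * (K * wt y)\<bar>" for m
        using K[OF em] K0 by (intro AE_I2) (auto simp: abs_mult intro!: mult_left_mono simp del: of_nat_Suc)
      have "AE y in lborel. y \<notin> frontier ?A"
      proof (rule AE_not_in)
        have "frontier ?A \<in> null_sets lebesgue"
          using negligible_convex_frontier[OF convex_box(2), of a b] unfolding negligible_iff_null_sets .
        then show "frontier ?A \<in> null_sets lborel" by (subst (asm) null_sets_completion_iff) auto
      qed
      then show "AE y in lborel. (\<lambda>m. u y * ?w m y) \<longlonglongrightarrow> u y * (indicator ?A y * ?c)"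
        by eventually_elim (intro tendsto_mult tendsto_const integral_G_shift_tendsto e, auto)
    qed measurable
    moreover have "(\<integral>y. u y * ?w m y \<partial>lborel) = (\<integral>x. indicator ?A x * conv e u x \<partial>lborel)" for m
    proof -
      have "(\<integral>y. u y * ?w m y \<partial>lborel) = (\<integral>x. indicator ?A x * conv (e / real (Suc m)) u x \<partial>lborel)"
        by (rule integral_conv(2)[OF u _ R(1) AR em(1), symmetric]) simp
      also have "\<dots> = (\<integral>x. indicator ?A x * conv e u x \<partial>lborel)"
      proof (intro Bochner_Integration.integral_cong refl)
        fix x
        show "indicator ?A x * conv (e / real (Suc m)) u x = indicator ?A x * conv e u x"
          using integral_Gs_eq[OF u H em, of x] ab by (auto simp: conv_def indicator_def simp del: of_nat_Suc)
      qed
      finally show ?thesis .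
    qed
    ultimately have "(\<integral>x. indicator ?A x * conv e u x \<partial>lborel) = (\<integral>y. u y * (indicator ?A y * ?c) \<partial>lborel)"
      by (simp add: LIMSEQ_const_iff)
    also have "\<dots> = (\<integral>y. ?c * (u y * indicator ?A y) \<partial>lborel)"
      by (intro Bochner_Integration.integral_cong) (auto simp: mult_ac)
    finally show "(\<integral>x. indicator ?A x * (conv e u x - ?c * u x) \<partial>lborel) = 0"
      unfolding eq by (subst Bochner_Integration.integral_diff[OF i]) simp
  qed
  then show ?thesis by eventually_elim auto
qed

end

section \<open>Smoothness and the representation of solutions\<close>

lemma lborel_eq_distr_lebesgue: "distr lebesgue lborel (\<lambda>x. x) = (lborel :: 'a::euclidean_space measure)"
proof (rule measure_eqI)
  fix A assume "A \<in> sets (distr lebesgue lborel (\<lambda>x::'a. x))"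
  then have A: "A \<in> sets borel" by simp
  have "(\<lambda>x::'a. x) \<in> lebesgue \<rightarrow>\<^sub>M lborel"
    using id_borel_measurable_lebesgue by (simp add: id_def)
  then show "emeasure (distr lebesgue lborel (\<lambda>x. x)) A = emeasure lborel A"
    using A by (subst emeasure_distr) auto
qed simp

lemma measurable_pair_lebesgue:
  "(\<lambda>w. w) \<in> (lebesgue :: 'a::euclidean_space measure) \<Otimes>\<^sub>M (lebesgue :: 'b::euclidean_space measure) \<rightarrow>\<^sub>M lborel \<Otimes>\<^sub>M lborel"
proof -
  have 1: "(\<lambda>x::'a. x) \<in> lebesgue \<rightarrow>\<^sub>M lborel" "(\<lambda>x::'b. x) \<in> lebesgue \<rightarrow>\<^sub>M lborel"
    using id_borel_measurable_lebesgue[where 'a='a] id_borel_measurable_lebesgue[where 'a='b] by (simp_all add: id_def)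
  have "(\<lambda>w. (fst w, snd w)) \<in> (lebesgue :: 'a measure) \<Otimes>\<^sub>M (lebesgue :: 'b measure) \<rightarrow>\<^sub>M lborel \<Otimes>\<^sub>M lborel"
    by (intro measurable_Pair measurable_compose[OF measurable_fst 1(1)] measurable_compose[OF measurable_snd 1(2)])
  then show ?thesis by simp
qed

text \<open>The weak formulation integrates over a product of completed measures, the Fubini
  arguments over the product of the Borel ones. The identity map carries the first measure to the
  second, so integrals of Borel functions agree.\<close>

lemma lborel_pair_eq_distr_lebesgue:
  "distr (lebesgue \<Otimes>\<^sub>M lebesgue) (lborel \<Otimes>\<^sub>M lborel) (\<lambda>w. w) =
    (lborel :: 'a::euclidean_space measure) \<Otimes>\<^sub>M (lborel :: 'b::euclidean_space measure)"
proof -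
  have 1: "(\<lambda>x::'a. x) \<in> lebesgue \<rightarrow>\<^sub>M lborel" "(\<lambda>x::'b. x) \<in> lebesgue \<rightarrow>\<^sub>M lborel"
    using id_borel_measurable_lebesgue[where 'a='a] id_borel_measurable_lebesgue[where 'a='b] by (simp_all add: id_def)
  have "sigma_finite_measure (distr lebesgue lborel (\<lambda>x::'b. x))"
    by (simp add: lborel_eq_distr_lebesgue sigma_finite_lborel)
  from pair_measure_distr[OF 1 this] show ?thesis
    by (simp add: lborel_eq_distr_lebesgue case_prod_beta')
qed

lemma integrable_lebesgue_pair_iff:
  fixes f :: "'a::euclidean_space \<times> 'b::euclidean_space \<Rightarrow> real"
  assumes "f \<in> borel_measurable (lborel \<Otimes>\<^sub>M lborel)"
  shows "integrable (lebesgue \<Otimes>\<^sub>M lebesgue) f \<longleftrightarrow> integrable (lborel \<Otimes>\<^sub>M lborel) f"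
    and "integral\<^sup>L (lebesgue \<Otimes>\<^sub>M lebesgue) f = integral\<^sup>L (lborel \<Otimes>\<^sub>M lborel) f"
  using integrable_distr_eq[OF measurable_pair_lebesgue assms] integral_distr[OF measurable_pair_lebesgue assms]
  by (simp_all add: lborel_pair_eq_distr_lebesgue)

lemma AE_lebesgue_pair:
  fixes Q :: "'a::euclidean_space \<Rightarrow> bool"
  assumes "AE x in lborel. Q x"
  shows "AE (x, y) in (lebesgue :: 'a measure) \<Otimes>\<^sub>M (lebesgue :: 'a measure). Q x \<and> Q y"
proof -
  obtain N where N: "N \<in> null_sets lborel" "{x. \<not> Q x} \<subseteq> N"
    using assms by (auto simp: eventually_ae_filter)
  have 1: "N \<times> UNIV \<in> null_sets ((lborel :: 'a measure) \<Otimes>\<^sub>M (lborel :: 'a measure))"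
    using lborel.times_in_null_sets1[OF N(1), of UNIV] by simp
  have 2: "UNIV \<times> N \<in> null_sets ((lborel :: 'a measure) \<Otimes>\<^sub>M (lborel :: 'a measure))"
    using lborel.times_in_null_sets2[OF _ N(1), of UNIV lborel] by simp
  have "AE w in (lborel :: 'a measure) \<Otimes>\<^sub>M (lborel :: 'a measure). Q (fst w) \<and> Q (snd w)"
    using AE_not_in[OF 1] AE_not_in[OF 2] by eventually_elim (use N(2) in auto)
  then have "AE w in distr (lebesgue \<Otimes>\<^sub>M lebesgue) (lborel \<Otimes>\<^sub>M lborel) (\<lambda>w. w). Q (fst w) \<and> Q (snd w :: 'a)"
    by (simp only: lborel_pair_eq_distr_lebesgue)
  from AE_distrD[OF measurable_pair_lebesgue this] show ?thesis by (simp add: case_prod_beta')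
qed

lemma borel_version_exists:
  fixes h :: "'a::euclidean_space \<Rightarrow> real ^ 'm"
  assumes h: "h \<in> borel_measurable lebesgue"
  obtains h' where "h' \<in> borel_measurable borel" "AE x in lborel. h x = h' x"
proof -
  have "\<exists>g\<in>borel_measurable lborel. (AE x in lborel. h x $ j = g x)" for j
  proof (rule completion_ex_borel_measurable_real)
    show "(\<lambda>x. h x $ j) \<in> borel_measurable lebesgue"
      by (rule measurable_compose[OF h borel_measurable_continuous_onI]) (intro continuous_intros)
  qed
  then obtain g where g: "\<And>j. g j \<in> borel_measurable lborel" "\<And>j. AE x in lborel. h x $ j = g j x" by metis
  show ?thesis
  proof (rule that)
    show "(\<lambda>x. \<chi> j. g j x) \<in> borel_measurable borel"
      using g(1) by (auto simp: borel_measurable_euclidean_space[where 'c="real^'m"] Basis_vec_def inner_axis)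
    have "AE x in lborel. \<forall>j\<in>UNIV. h x $ j = g j x"
      using g(2) by (intro AE_finite_allI) auto
    then show "AE x in lborel. h x = (\<chi> j. g j x)"
      by eventually_elim (simp add: vec_eq_iff)
  qed
qed

section \<open>Convolution with derivatives of the kernel\<close>

context frac_order
begin

lemma kern_eq_divide: "kern (z :: real^'n) = 1 / norm z powr (real CARD('n) + 2 * s)"
  by (simp only: kern_def powr_minus_divide)

definition tamev :: "(real^'n \<Rightarrow> real^'m) \<Rightarrow> bool" where
  "tamev h \<longleftrightarrow> h \<in> borel_measurable borel \<and> integrable lborel (\<lambda>y. norm (h y) * wt y)"

text \<open>Convolution of \<open>h\<close> with an iterated derivative of the dilate of
  \<open>G\<close>: each derivative contributes a factor \<open>1 / e\<close>, hence the exponent.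
  The argument is x - y, so that differentiating in x creates no signs.\<close>

definition kernel_conv :: "real \<Rightarrow> 'n list \<Rightarrow> (real^'n \<Rightarrow> real^'m) \<Rightarrow> real^'n \<Rightarrow> real^'m" where
  "kernel_conv e is h x = (\<integral>y. (pds is G ((1 / e) *\<^sub>R (x - y)) / e ^ (CARD('n) + length is)) *\<^sub>R h y \<partial>lborel)"

lemma tamev_measurable: "tamev h \<Longrightarrow> h \<in> borel_measurable borel"
  by (simp add: tamev_def)

lemma kernel_conv_has_derivative:
  fixes h :: "real^'n \<Rightarrow> real^'m"
  assumes h: "tamev h" and e: "0 < e"
  shows "(kernel_conv e is h has_derivative (\<lambda>v. \<Sum>i\<in>UNIV. v $ i *\<^sub>R kernel_conv e (i # is) h x0)) (at x0)"
proof -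
  note [measurable] = tamev_measurable[OF h]
  let ?k = "\<lambda>is x y. (pds is G ((1 / e) *\<^sub>R (x - y)) / e ^ (CARD('n) + length is)) *\<^sub>R h y"
  let ?c = "(1 + (norm x0 + 1) + e) powr (real CARD('n) + 2 * s)"
  have "\<exists>C. 0 \<le> C \<and> (\<forall>x. \<bar>pds is G x\<bar> \<le> C * wt (x :: real^'n))" for "is" using G_bound[of "is"] by metis
  then obtain C where C: "\<And>is. 0 \<le> C is" "\<And>is x. \<bar>pds is G x\<bar> \<le> C is * wt (x :: real^'n)" by metis
  have wt_le: "wt ((1 / e) *\<^sub>R (x - y)) \<le> ?c * wt y" if x: "x \<in> ball x0 1" for x y
  proof -
    have "norm x \<le> norm x0 + 1" using x norm_triangle_ineq2[of x x0] by (simp add: dist_norm norm_minus_commute)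
    then have "wt ((1 / e) *\<^sub>R (y - x)) \<le> ?c * wt y" using e by (intro wt_affine_le) auto
    then show ?thesis by (simp add: wt_def norm_minus_commute)
  qed
  have bound: "norm (?k is x y) \<le> (C is / e ^ (CARD('n) + length is) * ?c) * (norm (h y) * wt y)" if x: "x \<in> ball x0 1" for "is" x y
  proof -
    have "\<bar>pds is G ((1 / e) *\<^sub>R (x - y))\<bar> \<le> C is * (?c * wt y)"
      using C(1) by (intro order_trans[OF C(2)] mult_left_mono wt_le[OF x])
    then have "\<bar>pds is G ((1 / e) *\<^sub>R (x - y))\<bar> / e ^ (CARD('n) + length is) * norm (h y) \<le>
        C is * (?c * wt y) / e ^ (CARD('n) + length is) * norm (h y)"
      using e by (intro mult_right_mono divide_right_mono) auto
    then show ?thesis using e by (simp add: mult_ac)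
  qed
  have wi: "integrable lborel (\<lambda>y. K * (norm (h y) * wt y))" for K
    using h by (simp add: tamev_def)
  have ki: "integrable lborel (?k is x)" if x: "x \<in> ball x0 1" for "is" x
    by (rule Bochner_Integration.integrable_bound[OF wi[of "C is / e ^ (CARD('n) + length is) * ?c"]], measurable,
        rule AE_I2, rule order_trans[OF bound[OF x]], subst real_norm_def, rule abs_ge_self)
  let ?K = "\<Sum>i\<in>UNIV. C (i # is) / e ^ (CARD('n) + length (i # is)) * ?c"
  have "((\<lambda>x. \<integral>y. ?k is x y \<partial>lborel) has_derivative (\<lambda>v. \<Sum>i\<in>UNIV. v $ i *\<^sub>R (\<integral>y. ?k (i # is) x0 y \<partial>lborel))) (at x0)"
  proof (rule has_derivative_integral_param[where r=1 and b="\<lambda>y. ?K * (norm (h y) * wt y)"])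
    show "integrable lborel (?k is x)" if "x \<in> ball x0 1" for x by (rule ki[OF that])
    show "norm (?k (i # is) x y) \<le> ?K * (norm (h y) * wt y)" if "x \<in> ball x0 1" for i x y
      using e C(1) by (intro order_trans[OF bound[OF that]] mult_right_mono member_le_sum) auto
    show "integrable lborel (\<lambda>y. ?K * (norm (h y) * wt y))" by (rule wi)
    fix x y :: "real^'n"
    have 1: "((\<lambda>x. (1 / e) *\<^sub>R (x - y)) has_derivative (\<lambda>v. (1 / e) *\<^sub>R v)) (at x)"
      by (auto intro!: derivative_eq_intros)
    have "((\<lambda>x. ?k is x y) has_derivative
      (\<lambda>v. ((\<Sum>i\<in>UNIV. ((1 / e) *\<^sub>R v) $ i * pds (i # is) G ((1 / e) *\<^sub>R (x - y))) / e ^ (CARD('n) + length is)) *\<^sub>R h y)) (at x)"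
      by (intro has_derivative_scaleR_left bounded_linear.has_derivative[OF bounded_linear_divide]
          has_derivative_compose[OF 1 G_has_derivative])
    then show "((\<lambda>x. ?k is x y) has_derivative (\<lambda>v. \<Sum>i\<in>UNIV. v $ i *\<^sub>R ?k (i # is) x y)) (at x)"
      by (rule has_derivative_eq_rhs)
        (auto simp: fun_eq_iff scaleR_sum_left sum_divide_distrib mult_ac intro!: sum.cong)
    show "?k (i # is) x0 \<in> borel_measurable lborel" for i by measurable
  qed simp
  then show ?thesis by (simp add: kernel_conv_def[abs_def])
qed

lemma kernel_conv_continuous: "tamev h \<Longrightarrow> 0 < e \<Longrightarrow> continuous_on A (kernel_conv e is h)"
  by (meson kernel_conv_has_derivative continuous_at_imp_continuous_on has_derivative_continuous)

lemma partials_eq_kernel_conv: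
  fixes h :: "real^'n \<Rightarrow> real^'m"
  assumes h: "tamev h" and e: "0 < e" and S: "open S" and eq: "\<And>x. x \<in> S \<Longrightarrow> f x = c *\<^sub>R kernel_conv e [] h x"
  shows "x \<in> S \<Longrightarrow> partials is f x = c *\<^sub>R kernel_conv e is h x"
    and "x \<in> S \<Longrightarrow> partials is f differentiable (at x)"
proof -
  have step: "(partials is f has_derivative (\<lambda>v. \<Sum>i\<in>UNIV. v $ i *\<^sub>R (c *\<^sub>R kernel_conv e (i # is) h x))) (at x)"
    if "\<forall>x\<in>S. partials is f x = c *\<^sub>R kernel_conv e is h x" "x \<in> S" for x "is"
  proof -
    have "((\<lambda>x. c *\<^sub>R kernel_conv e is h x) has_derivative (\<lambda>v. c *\<^sub>R (\<Sum>i\<in>UNIV. v $ i *\<^sub>R kernel_conv e (i # is) h x))) (at x)"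
      by (intro has_derivative_scaleR_right kernel_conv_has_derivative h e)
    then have "((\<lambda>x. c *\<^sub>R kernel_conv e is h x) has_derivative (\<lambda>v. \<Sum>i\<in>UNIV. v $ i *\<^sub>R (c *\<^sub>R kernel_conv e (i # is) h x))) (at x)"
      by (rule has_derivative_eq_rhs) (auto simp: fun_eq_iff scaleR_sum_right mult.commute)
    then show ?thesis
      by (rule has_derivative_transform_within_open[OF _ S that(2)]) (use that(1) in auto)
  qed
  have *: "\<forall>x\<in>S. partials is f x = c *\<^sub>R kernel_conv e is h x" for "is"
  proof (induction "is")
    case (Cons i "is")
    then show ?case using frechet_derivative_axis[OF step] by simp
  qed (use eq in simp)
  show "x \<in> S \<Longrightarrow> partials is f x = c *\<^sub>R kernel_conv e is h x" using * by blast
  show "x \<in> S \<Longrightarrow> partials is f differentiable (at x)"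
    using step[OF *] unfolding differentiable_def by blast
qed

section \<open>Admissibility and scaling of the test functions\<close>

lemma integrable_levy_shift:
  fixes x :: "real^'n"
  shows "integrable lborel (\<lambda>y. min 1 ((norm (x - y))\<^sup>2) * kern (x - y))"
    and "(\<integral>y. min 1 ((norm (x - y))\<^sup>2) * kern (x - y) \<partial>lborel) = (\<integral>z. min 1 ((norm z)\<^sup>2) * kern z \<partial>(lborel :: (real^'n) measure))"
  using lborel_integral_affine[of "\<lambda>z::real^'n. min 1 ((norm z)\<^sup>2) * kern z" "-1" x] integrable_levy[where 'n='n]
  by simp_all

text \<open>A pair contributes only if one of its points lies in the support ball. There
  \<open>f x - f y\<close> is bounded by \<open>2 * C\<close> and by
  \<open>C * norm (x - y)\<close>, which produces the integrand of \<open>integrable_levy\<close>;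
  integrating it over the ball in the other variable gives a finite value.\<close>

lemma testfun_energy:
  fixes f :: "real^'n \<Rightarrow> real"
  assumes f: "testfun f"
  shows "integrable (lborel \<Otimes>\<^sub>M lborel) (\<lambda>(x, y). (f x - f y)\<^sup>2 * kern (x - y))"
proof -
  note [measurable] = testfun_measurable[OF f]
  obtain C R where C: "0 \<le> C" "1 \<le> R" "\<And>x. \<bar>f x\<bar> \<le> C" "\<And>x. R \<le> norm x \<Longrightarrow> f x = 0"
    "\<And>x y. \<bar>f x - f y\<bar> \<le> C * norm (x - y)"
    by (rule testfunE[OF f]) (rule that)
  let ?J = "\<lambda>z :: real^'n. min 1 ((norm z)\<^sup>2) * kern z"
  let ?B = "ball (0::real^'n) R"
  let ?F = "\<lambda>(x, y). indicator ?B x * ?J (x - y)"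
  have [measurable]: "?B \<in> sets borel" by simp
  have F: "integrable (lborel \<Otimes>\<^sub>M lborel) ?F"
  proof (rule lborel_pair.Fubini_integrable)
    show "?F \<in> borel_measurable (lborel \<Otimes>\<^sub>M lborel)" by measurable
    have "integrable lborel (\<lambda>x. indicator ?B x * integral\<^sup>L lborel ?J)"
      by (intro integrable_mult_left integrable_real_indicator emeasure_bounded_finite) auto
    then show "integrable lborel (\<lambda>x. \<integral>y. norm (?F (x, y)) \<partial>lborel)"
      by (simp add: abs_mult integrable_levy_shift(2))
    show "AE x in lborel. integrable lborel (\<lambda>y. ?F (x, y))"
      by (auto intro!: AE_I2 integrable_mult_right integrable_levy_shift(1))
  qed
  have F': "integrable (lborel \<Otimes>\<^sub>M lborel) (\<lambda>(x, y). ?F (y, x))" by (rule lborel_pair.integrable_product_swap[OF F])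
  have "integrable (lborel \<Otimes>\<^sub>M lborel) (\<lambda>w. (4 * C\<^sup>2) * (?F w + (case w of (x, y) \<Rightarrow> ?F (y, x))))"
    by (intro integrable_mult_right Bochner_Integration.integrable_add F F')
  then show ?thesis
  proof (rule Bochner_Integration.integrable_bound)
    show "(\<lambda>(x, y). (f x - f y)\<^sup>2 * kern (x - y)) \<in> borel_measurable (lborel \<Otimes>\<^sub>M lborel)" by measurable
    have "(f x - f y)\<^sup>2 * kern (x - y) \<le> (4 * C\<^sup>2) * (indicator ?B x * ?J (x - y) + indicator ?B y * ?J (y - x))" for x y
    proof (cases "x \<in> ?B \<or> y \<in> ?B")
      case True
      have "\<bar>f x - f y\<bar> \<le> 2 * C" using C(3)[of x] C(3)[of y] by linarith
      then have 1: "(f x - f y)\<^sup>2 \<le> (2 * C)\<^sup>2" by (metis abs_le_square_iff abs_of_nonneg C(1) mult_nonneg_nonneg zero_le_numeral)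
      have "(f x - f y)\<^sup>2 \<le> (C * norm (x - y))\<^sup>2"
        using C(5)[of x y] C(1) by (metis abs_le_square_iff abs_of_nonneg mult_nonneg_nonneg norm_ge_zero)
      also have "\<dots> \<le> (2 * C)\<^sup>2 * (norm (x - y))\<^sup>2" by (simp add: power_mult_distrib mult_right_mono)
      finally have "(f x - f y)\<^sup>2 \<le> (2 * C)\<^sup>2 * min 1 ((norm (x - y))\<^sup>2)"
        using 1 by (simp add: min_def)
      then have "(f x - f y)\<^sup>2 * kern (x - y) \<le> (4 * C\<^sup>2) * ?J (x - y)"
        using mult_right_mono[of _ _ "kern (x - y)"] by (force simp: power_mult_distrib mult.assoc)
      also have "\<dots> \<le> (4 * C\<^sup>2) * (indicator ?B x * ?J (x - y) + indicator ?B y * ?J (y - x))"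
      proof (rule mult_left_mono)
        have J: "?J (y - x) = ?J (x - y)" by (simp add: kern_def norm_minus_commute)
        have J0: "0 \<le> ?J (x - y)" by simp
        show "?J (x - y) \<le> indicator ?B x * ?J (x - y) + indicator ?B y * ?J (y - x)"
          using True J0 unfolding J by (cases "x \<in> ?B"; cases "y \<in> ?B") simp_all
      qed simp
      finally show ?thesis .
    next
      case False
      then have "f x = 0" "f y = 0" using C(4)[of x] C(4)[of y] by auto
      then show ?thesis by (auto intro!: mult_nonneg_nonneg add_nonneg_nonneg)
    qed
    then show "AE w in lborel \<Otimes>\<^sub>M lborel. norm (case w of (x, y) \<Rightarrow> (f x - f y)\<^sup>2 * kern (x - y)) \<le>
       norm ((4 * C\<^sup>2) * (?F w + (case w of (x, y) \<Rightarrow> ?F (y, x))))"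
      by (intro AE_I2) (auto intro: order_trans[OF _ abs_ge_self])
  qed
qed

lemma testfun_frac_sobolev:
  fixes f :: "real^'n \<Rightarrow> real" and \<xi> :: "real^'m"
  assumes f: "testfun f"
  shows "(\<lambda>y. f y *\<^sub>R \<xi>) \<in> frac_sobolev s UNIV"
proof -
  note [measurable] = testfun_measurable[OF f]
  obtain C where C: "0 \<le> C" "\<And>x. \<bar>f x\<bar> \<le> C" by (rule testfunE[OF f]) (rule that)
  have m: "(\<lambda>y. f y *\<^sub>R \<xi>) \<in> borel_measurable lborel" by measurable
  have "integrable lborel (\<lambda>x. (f x)\<^sup>2)"
  proof (rule Bochner_Integration.integrable_bound[OF integrable_mult_right[OF testfun_integrable[OF f], of C]])
    have "(f x)\<^sup>2 \<le> C * \<bar>f x\<bar>" for x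
      using mult_right_mono[OF C(2)[of x] abs_ge_zero[of "f x"]] by (simp add: power2_eq_square)
    then show "AE x in lborel. norm ((f x)\<^sup>2) \<le> norm (C * \<bar>f x\<bar>)" using C(1) by (intro AE_I2) (simp add: abs_mult)
  qed measurable
  then have "integrable lborel (\<lambda>x. (norm \<xi>)\<^sup>2 * (f x)\<^sup>2)" by simp
  then have 1: "integrable lebesgue (\<lambda>x. (norm (f x *\<^sub>R \<xi>))\<^sup>2)"
    by (subst integrable_completion) (auto simp: power_mult_distrib mult.commute)
  have k: "\<And>x y. (norm (f x *\<^sub>R \<xi> - f y *\<^sub>R \<xi>))\<^sup>2 / norm (x - y) powr (real CARD('n) + 2 * s) =
    (norm \<xi>)\<^sup>2 * ((f x - f y)\<^sup>2 * kern (x - y))"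
    by (simp add: kern_eq_divide power_mult_distrib flip: scaleR_left_diff_distrib)
  have "integrable (lborel \<Otimes>\<^sub>M lborel) (\<lambda>w. (norm \<xi>)\<^sup>2 * (case w of (x, y) \<Rightarrow> (f x - f y)\<^sup>2 * kern (x - y)))"
    by (intro integrable_mult_right testfun_energy[OF f])
  then have "integrable (lborel \<Otimes>\<^sub>M lborel) (\<lambda>(x, y). (norm (f x *\<^sub>R \<xi> - f y *\<^sub>R \<xi>))\<^sup>2 / norm (x - y) powr (real CARD('n) + 2 * s))"
    unfolding k by (simp add: case_prod_beta')
  then have 2: "integrable (lebesgue \<Otimes>\<^sub>M lebesgue) (\<lambda>(x, y). (norm (f x *\<^sub>R \<xi> - f y *\<^sub>R \<xi>))\<^sup>2 / norm (x - y) powr (real CARD('n) + 2 * s))"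
    by (subst integrable_lebesgue_pair_iff(1)) measurable
  have "(\<lambda>y. f y *\<^sub>R \<xi>) \<in> borel_measurable lebesgue" using m by (simp add: measurable_completion)
  then show ?thesis using 1 2
    by (simp add: frac_sobolev_def set_borel_measurable_def set_integrable_def)
qed

text \<open>Homogeneity of order 2s: the substitution contributes t^n and the kernel
  t^(-n-2s).\<close>

lemma Lop_affine:
  fixes f :: "real^'n \<Rightarrow> real"
  assumes [measurable]: "f \<in> borel_measurable borel" and t: "0 < t"
  shows "Lop (\<lambda>y. f ((1 / t) *\<^sub>R (y - x))) y = t powr (- 2 * s) * Lop f ((1 / t) *\<^sub>R (y - x))"
proof -
  let ?g = "\<lambda>y. f ((1 / t) *\<^sub>R (y - x))" and ?y = "(1 / t) *\<^sub>R (y - x)"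
  define X where "X = (\<integral>z. diff2 ?g y z * kern z \<partial>lborel)"
  define I where "I = (\<integral>w. diff2 f ?y w * kern w \<partial>lborel)"
  have A: "(\<integral>w. (\<lambda>z. diff2 ?g y z * kern z) (0 + t *\<^sub>R w) \<partial>lborel) = (\<integral>z. diff2 ?g y z * kern z \<partial>lborel) / \<bar>t\<bar> ^ DIM(real^'n)"
    using t by (intro lborel_integral_affine(1)) auto
  have B: "(\<lambda>w. (\<lambda>z. diff2 ?g y z * kern z) (0 + t *\<^sub>R w)) = (\<lambda>w. t powr - (real CARD('n) + 2 * s) * (diff2 f ?y w * kern w))"
  proof
    fix w :: "real^'n"
    have "(1 / t) *\<^sub>R (y + t *\<^sub>R w - x) = ?y + w" "(1 / t) *\<^sub>R (y - t *\<^sub>R w - x) = ?y - w"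
      using t by (simp_all add: algebra_simps)
    then have "diff2 ?g y (t *\<^sub>R w) = diff2 f ?y w" unfolding diff2_def by simp
    moreover have "kern (t *\<^sub>R w) = t powr - (real CARD('n) + 2 * s) * kern w"
      using t by (simp add: kern_def powr_mult)
    ultimately show "(\<lambda>z. diff2 ?g y z * kern z) (0 + t *\<^sub>R w) = t powr - (real CARD('n) + 2 * s) * (diff2 f ?y w * kern w)"
      by simp
  qed
  have "t powr - (real CARD('n) + 2 * s) * I = X / t ^ CARD('n)"
    using A[unfolded B] t unfolding X_def I_def by simp
  then have "X = (t ^ CARD('n) * t powr - (real CARD('n) + 2 * s)) * I"
    using t by (simp add: nonzero_eq_divide_eq mult_ac)
  also have "t ^ CARD('n) * t powr - (real CARD('n) + 2 * s) = t powr (- 2 * s)"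
    using t powr_realpow[OF t, of "CARD('n)", symmetric] by (simp only: powr_add[symmetric]) simp
  finally show ?thesis unfolding X_def I_def by (simp add: Lop_def)
qed

end

lemma AE_eq_on_open_imp_eq:
  fixes f g :: "'a::euclidean_space \<Rightarrow> 'b::real_normed_vector"
  assumes "continuous_on UNIV f" "continuous_on UNIV g" "open S"
    and "AE x in lborel. x \<in> S \<longrightarrow> f x = g x" "x \<in> S"
  shows "f x = g x"
proof -
  have "closed {x. f x = g x}" using assms by (intro closed_Collect_eq)
  moreover have "AE x\<in>S in lebesgue. x \<in> {x. f x = g x}" using AE_completion[OF assms(4)] by simp
  ultimately show ?thesis using mem_closed_if_AE_lebesgue_open[OF assms(3)] assms(5) by blast
qed

lemma integral_lebesgue_cong_borel:
  fixes f g :: "'a::euclidean_space \<Rightarrow> real"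
  assumes g: "g \<in> borel_measurable borel" and f: "f \<in> borel_measurable lebesgue" and eq: "AE x in lborel. f x = g x"
  shows "integral\<^sup>L lebesgue f = integral\<^sup>L lborel g" and "integrable lebesgue f \<longleftrightarrow> integrable lborel g"
proof -
  have gl: "g \<in> borel_measurable lebesgue" using g by (simp add: measurable_completion)
  have "integral\<^sup>L lebesgue f = integral\<^sup>L lebesgue g"
    by (rule integral_cong_AE[OF f gl AE_completion[OF eq]])
  then show "integral\<^sup>L lebesgue f = integral\<^sup>L lborel g" using g by (simp add: integral_completion)
  have "integrable lebesgue f \<longleftrightarrow> integrable lebesgue g"
    by (rule integrable_cong_AE[OF f gl AE_completion[OF eq]])
  then show "integrable lebesgue f \<longleftrightarrow> integrable lborel g" using g by (simp add: integrable_completion)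
qed

text \<open>The variance is nonnegative. The estimate for the kernel produces the mean of |h|, the
  theorem asks for the quadratic mean.\<close>

lemma mean_le_sqrt_mean_square:
  fixes f :: "'a \<Rightarrow> real"
  assumes A: "A \<in> sets M" "emeasure M A < \<infinity>" "0 < measure M A"
    and f: "integrable M (\<lambda>x. indicator A x * f x)" and f2: "integrable M (\<lambda>x. indicator A x * (f x)\<^sup>2)"
  shows "(\<integral>x. indicator A x * f x \<partial>M) / measure M A \<le> sqrt ((\<integral>x. indicator A x * (f x)\<^sup>2 \<partial>M) / measure M A)"
proof -
  define V where "V = measure M A"
  define m where "m = (\<integral>x. indicator A x * f x \<partial>M) / V"
  have V: "0 < V" using A by (simp add: V_def)
  have I: "(\<integral>x. indicator A x * f x \<partial>M) = m * V" using V by (simp add: m_def)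
  have ind: "integrable M (indicator A :: 'a \<Rightarrow> real)" using A by (intro integrable_real_indicator)
  have "0 \<le> (\<integral>x. indicator A x * (f x - m)\<^sup>2 \<partial>M)" by (intro Bochner_Integration.integral_nonneg) auto
  also have "(\<lambda>x. indicator A x * (f x - m)\<^sup>2) = (\<lambda>x. indicator A x * (f x)\<^sup>2 - 2 * m * (indicator A x * f x) + m\<^sup>2 * indicator A x)"
    by (auto simp: fun_eq_iff power2_eq_square algebra_simps)
  also have "(\<integral>x. indicator A x * (f x)\<^sup>2 - 2 * m * (indicator A x * f x) + m\<^sup>2 * indicator A x \<partial>M) =
    (\<integral>x. indicator A x * (f x)\<^sup>2 \<partial>M) - 2 * m * (\<integral>x. indicator A x * f x \<partial>M) + m\<^sup>2 * V"
  proof -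
    have "(\<integral>x. indicator A x * (f x)\<^sup>2 - 2 * m * (indicator A x * f x) + m\<^sup>2 * indicator A x \<partial>M) =
      (\<integral>x. indicator A x * (f x)\<^sup>2 - 2 * m * (indicator A x * f x) \<partial>M) + (\<integral>x. m\<^sup>2 * indicator A x \<partial>M)"
      using f f2 ind by (intro Bochner_Integration.integral_add Bochner_Integration.integrable_diff integrable_mult_right)
    also have "(\<integral>x. indicator A x * (f x)\<^sup>2 - 2 * m * (indicator A x * f x) \<partial>M) =
      (\<integral>x. indicator A x * (f x)\<^sup>2 \<partial>M) - (\<integral>x. 2 * m * (indicator A x * f x) \<partial>M)"
      using f f2 by (intro Bochner_Integration.integral_diff integrable_mult_right)
    finally show ?thesis using sets.sets_into_space[OF A(1)] by (simp add: V_def Int_absorb2)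
  qed
  also have "\<dots> = (\<integral>x. indicator A x * (f x)\<^sup>2 \<partial>M) - m\<^sup>2 * V" unfolding I by (simp add: power2_eq_square)
  finally have "m\<^sup>2 \<le> (\<integral>x. indicator A x * (f x)\<^sup>2 \<partial>M) / V" using V by (simp add: pos_le_divide_eq)
  then have "m \<le> sqrt ((\<integral>x. indicator A x * (f x)\<^sup>2 \<partial>M) / V)" by (rule real_le_rsqrt)
  then show ?thesis by (simp add: m_def V_def)
qed

section \<open>From weak solutions to the representation formula\<close>

context frac_order
begin

lemma kernel_integrable:
  fixes h :: "real^'n \<Rightarrow> real^'m"
  assumes h: "tamev h" and [measurable]: "k \<in> borel_measurable borel" and C: "\<And>z. \<bar>k z\<bar> \<le> C * wt z" and e: "0 < e"
  shows "integrable lborel (\<lambda>y. k ((1 / e) *\<^sub>R (y - x)) *\<^sub>R h y)"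
proof -
  note [measurable] = tamev_measurable[OF h]
  let ?c = "(1 + norm x + e) powr (real CARD('n) + 2 * s)"
  have C0: "0 \<le> C" using order_trans[OF abs_ge_zero C[of 0]] by (simp add: wt_def)
  have "integrable lborel (\<lambda>y. (C * ?c) * (norm (h y) * wt y))" using h by (simp add: tamev_def)
  then show ?thesis
  proof (rule Bochner_Integration.integrable_bound)
    show "AE y in lborel. norm (k ((1 / e) *\<^sub>R (y - x)) *\<^sub>R h y) \<le> norm ((C * ?c) * (norm (h y) * wt y))"
    proof (rule AE_I2)
      fix y
      have "\<bar>k ((1 / e) *\<^sub>R (y - x))\<bar> \<le> C * (?c * wt y)"
        using C0 e by (intro order_trans[OF C] mult_left_mono wt_affine_le) auto
      from mult_right_mono[OF this norm_ge_zero[of "h y"]]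
      show "norm (k ((1 / e) *\<^sub>R (y - x)) *\<^sub>R h y) \<le> norm ((C * ?c) * (norm (h y) * wt y))"
        using C0 by (simp add: abs_mult mult_ac)
    qed
  qed measurable
qed

text \<open>Integrability is given over compact sets, so global measurability comes from cut-offs to
  growing balls.\<close>

lemma tail_space_measurable:
  fixes h :: "real^'n \<Rightarrow> real^'m"
  assumes h: "h \<in> tail_space s" shows "h \<in> borel_measurable lebesgue"
proof (rule borel_measurable_LIMSEQ_metric)
  fix i :: nat
  have "set_integrable lebesgue (cball 0 (real i)) h"
    using h compact_cball unfolding tail_space_def by blast
  then show "(\<lambda>x. indicator (cball 0 (real i)) x *\<^sub>R h x) \<in> borel_measurable lebesgue"
    unfolding set_integrable_def by auto
next
  fix x :: "real^'n"
  obtain k where k: "norm x \<le> real k" using real_arch_simple by blast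
  have "\<forall>\<^sub>F i in sequentially. h x = indicator (cball 0 (real i)) x *\<^sub>R h x"
    using eventually_ge_at_top[of k] by eventually_elim (use k in \<open>auto simp: indicator_def\<close>)
  then show "(\<lambda>i. indicator (cball 0 (real i)) x *\<^sub>R h x) \<longlonglongrightarrow> h x"
    by (rule Lim_transform_eventually[OF tendsto_const])
qed

lemma wt_le_tail_weight:
  fixes x :: "real^'n"
  shows "wt x \<le> 2 * (1 / (1 + norm x powr (real CARD('n) + 2 * s)))"
proof -
  let ?a = "real CARD('n) + 2 * s"
  have a: "0 \<le> ?a" using s_pos by simp
  have "1 \<le> (1 + norm x) powr ?a" using a by (intro ge_one_powr_ge_zero) auto
  moreover have "norm x powr ?a \<le> (1 + norm x) powr ?a" using a by (intro powr_mono2) auto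
  ultimately have le: "1 + norm x powr ?a \<le> 2 * (1 + norm x) powr ?a" by linarith
  have "0 < 1 + norm x powr ?a" by (simp add: add_pos_nonneg)
  moreover have "0 < (1 + norm x) powr ?a" using \<open>1 \<le> (1 + norm x) powr ?a\<close> by linarith
  ultimately have "1 / (1 + norm x) powr ?a \<le> 2 / (1 + norm x powr ?a)"
    using le by (simp add: divide_simps)
  then show ?thesis unfolding wt_def powr_minus_divide by simp
qed

lemma tail_space_tamev:
  fixes h :: "real^'n \<Rightarrow> real^'m"
  assumes h: "h \<in> tail_space s"
  obtains h' where "tamev h'" "AE x in lborel. h x = h' x"
proof -
  have hm: "h \<in> borel_measurable lebesgue" by (rule tail_space_measurable[OF h])
  obtain h' where h': "h' \<in> borel_measurable borel" "AE x in lborel. h x = h' x"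
    by (rule borel_version_exists[OF hm]) (rule that)
  note [measurable] = h'(1)
  let ?w = "\<lambda>x :: real^'n. 1 + norm x powr (real CARD('n) + 2 * s)"
  have "integrable lebesgue (\<lambda>x. norm (h x) / ?w x)" using h by (simp add: tail_space_def)
  moreover have "integrable lebesgue (\<lambda>x. norm (h x) / ?w x) \<longleftrightarrow> integrable lborel (\<lambda>x. norm (h' x) / ?w x)"
    by (rule integral_lebesgue_cong_borel(2)) (use calculation h'(2) in \<open>measurable, auto\<close>)
  ultimately have "integrable lborel (\<lambda>x. norm (h' x) / ?w x)" by simp
  then have "integrable lborel (\<lambda>x. 2 * (norm (h' x) / ?w x))" by (rule integrable_mult_right)
  then have "integrable lborel (\<lambda>x. norm (h' x) * wt x)"
  proof (rule Bochner_Integration.integrable_bound)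
    show "AE x in lborel. norm (norm (h' x) * wt x) \<le> norm (2 * (norm (h' x) / ?w x))"
    proof (rule AE_I2)
      fix x
      have "0 < ?w x" by (simp add: add_pos_nonneg)
      then show "norm (norm (h' x) * wt x) \<le> norm (2 * (norm (h' x) / ?w x))"
        using mult_left_mono[OF wt_le_tail_weight[of x] norm_ge_zero[of "h' x"]] by (simp add: abs_mult mult.commute)
    qed
  qed measurable
  then show ?thesis using h' by (intro that[of h']) (auto simp: tamev_def)
qed

text \<open>For a fixed vector \<open>\<xi>\<close> the system tested with f times
  \<open>\<xi>\<close> is a scalar identity for u = (a h') . \<open>\<xi>\<close>. Collecting these
  over all \<open>\<xi>\<close> shows that \<open>a *v W\<close> is orthogonal to everything, where
  \<open>W\<close> is the vector integral in question; taking \<open>W\<close> itself as the test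
  vector, ellipticity gives W = 0.\<close>

lemma weak_solution_P_zero:
  fixes h h' :: "real^'n \<Rightarrow> real^'m" and a :: "real^'m^'m"
  assumes h': "tamev h'" and ae: "AE x in lborel. h x = h' x"
    and weak: "weak_solution s a B h"
    and ell: "\<And>\<xi>. (norm \<xi>)\<^sup>2 / \<Lambda> \<le> (a *v \<xi>) \<bullet> \<xi>" and \<Lambda>: "0 < \<Lambda>"
    and t: "0 < t" and sub: "cball x t \<subseteq> B"
  shows "(\<integral>y. P ((1 / t) *\<^sub>R (y - x)) *\<^sub>R h' y \<partial>lborel) = 0"
proof -
  note [measurable] = tamev_measurable[OF h']
  let ?a = "real CARD('n) + 2 * s"
  define f where "f = (\<lambda>y. chi ((1 / t) *\<^sub>R (y - x)))"
  have f: "testfun f" unfolding f_def by (rule testfun_affine[OF bump_testfun[OF bump_chi] t])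
  note [measurable] = testfun_measurable[OF f] testfun_measurable[OF bump_testfun[OF bump_chi]]
  define W where "W = (\<integral>y. P ((1 / t) *\<^sub>R (y - x)) *\<^sub>R h' y \<partial>lborel)"
  obtain C where C: "0 \<le> C" "\<And>z :: real^'n. \<bar>P z\<bar> \<le> C * wt z" using P_bound[of "[]"] by (metis pds.simps(1))
  have int: "integrable lborel (\<lambda>y. P ((1 / t) *\<^sub>R (y - x)) *\<^sub>R h' y)"
    by (rule kernel_integrable[OF h' _ C(2) t]) measurable
  have "(a *v W) \<bullet> \<xi> = 0" for \<xi>
  proof -
    define u where "u y = (a *v h' y) \<bullet> \<xi>" for y
    have bl: "bounded_linear (\<lambda>w. (a *v w) \<bullet> \<xi>)"
      by (rule bounded_linear_compose[OF bounded_linear_inner_left matrix_vector_mul_bounded_linear])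
    then obtain K where K: "\<And>w. norm ((a *v w) \<bullet> \<xi>) \<le> norm w * K" using bounded_linear.bounded by metis
    have [measurable]: "u \<in> borel_measurable borel"
      unfolding u_def by (rule measurable_compose[OF _ borel_measurable_continuous_onI[OF linear_continuous_on[OF bl]]]) measurable
    have u: "tame u"
      unfolding tame_def
    proof
      have "integrable lborel (\<lambda>y. K * (norm (h' y) * wt y))" using h' by (simp add: tamev_def)
      then show "integrable lborel (\<lambda>y. u y * wt y)"
      proof (rule Bochner_Integration.integrable_bound)
        show "AE y in lborel. norm (u y * wt y) \<le> norm (K * (norm (h' y) * wt y))"
        proof (rule AE_I2)
          fix y
          have "norm (u y * wt y) \<le> (norm (h' y) * K) * wt y"
            using K[of "h' y"] by (simp add: u_def abs_mult mult_right_mono)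
          also have "\<dots> = K * (norm (h' y) * wt y)" by (simp add: mult_ac)
          also have "\<dots> \<le> norm (K * (norm (h' y) * wt y))" by simp
          finally show "norm (u y * wt y) \<le> norm (K * (norm (h' y) * wt y))" .
        qed
      qed measurable
    qed measurable
    let ?\<phi> = "\<lambda>y. f y *\<^sub>R \<xi>"
    have "{y. ?\<phi> y \<noteq> 0} \<subseteq> cball x t"
    proof
      fix y assume "y \<in> {y. ?\<phi> y \<noteq> 0}"
      then have "\<not> 1 \<le> norm ((1 / t) *\<^sub>R (y - x))"
        using bump_outside[OF bump_chi, of "(1 / t) *\<^sub>R (y - x)"] by (auto simp: f_def simp del: norm_scaleR)
      then have "norm (y - x) / t < 1" using t by simp
      then show "y \<in> cball x t" using t by (simp add: pos_divide_less_eq dist_norm norm_minus_commute)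
    qed
    then have cl: "closure {y. ?\<phi> y \<noteq> 0} \<subseteq> cball x t" by (rule closure_minimal) simp
    moreover have "compact (closure {y. ?\<phi> y \<noteq> 0})"
      using cl bounded_subset[OF bounded_cball] by (simp add: compact_eq_bounded_closed)
    ultimately have "compact_support_in B ?\<phi>" using sub by (auto simp: compact_support_in_def)
    with weak testfun_frac_sobolev[OF f, of \<xi>] have hb: "has_bochner_integral (lebesgue \<Otimes>\<^sub>M lebesgue)
          (\<lambda>(x, y). ((a *v (h x - h y)) \<bullet> (?\<phi> x - ?\<phi> y)) / norm (x - y) powr ?a) 0" (is "has_bochner_integral _ ?F 0")
      unfolding weak_solution_def by blast
    let ?F' = "\<lambda>(x, y). (u x - u y) * (f x - f y) * kern (x - y)"
    have m: "?F' \<in> borel_measurable (lborel \<Otimes>\<^sub>M lborel)" by measurable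
    have m': "?F' \<in> borel_measurable (lebesgue \<Otimes>\<^sub>M lebesgue)"
      using measurable_compose[OF measurable_pair_lebesgue m] .
    have FF': "AE w in lebesgue \<Otimes>\<^sub>M lebesgue. ?F w = ?F' w"
      using AE_lebesgue_pair[OF ae]
    proof eventually_elim
      case (elim w)
      obtain p q where w: "w = (p, q)" by fastforce
      have "(a *v (h' p - h' q)) \<bullet> (?\<phi> p - ?\<phi> q) = (u p - u q) * (f p - f q)"
        by (simp add: u_def matrix_vector_mult_diff_distrib inner_diff_left mult.commute flip: scaleR_left_diff_distrib)
      with elim show ?case by (simp add: w kern_eq_divide)
    qed
    have "has_bochner_integral (lebesgue \<Otimes>\<^sub>M lebesgue) ?F' 0"
      using hb has_bochner_integral_cong_AE[OF borel_measurable_has_bochner_integral[OF hb] m' FF'] by blast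
    then have i: "integrable (lborel \<Otimes>\<^sub>M lborel) ?F'" and z: "integral\<^sup>L (lborel \<Otimes>\<^sub>M lborel) ?F' = 0"
      using integrable_lebesgue_pair_iff[OF m] by (auto simp: has_bochner_integral_iff)
    have "2 * (\<integral>y. u y * Lop f y \<partial>lborel) = 0" using form_eq[OF u f i] z by simp
    then have "(\<integral>y. t powr (- 2 * s) * (u y * P ((1 / t) *\<^sub>R (y - x))) \<partial>lborel) = 0"
      using t by (simp add: f_def Lop_affine P_def mult.left_commute)
    then have 0: "(\<integral>y. u y * P ((1 / t) *\<^sub>R (y - x)) \<partial>lborel) = 0" using t by simp
    have "(a *v W) \<bullet> \<xi> = (\<integral>y. (a *v (P ((1 / t) *\<^sub>R (y - x)) *\<^sub>R h' y)) \<bullet> \<xi> \<partial>lborel)"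
      unfolding W_def by (rule integral_bounded_linear[OF bl int, symmetric])
    also have "\<dots> = (\<integral>y. u y * P ((1 / t) *\<^sub>R (y - x)) \<partial>lborel)"
      by (simp add: u_def matrix_vector_mult_scaleR mult.commute)
    finally show ?thesis using 0 by simp
  qed
  then have "(norm W)\<^sup>2 / \<Lambda> \<le> 0" using ell[of W] by simp
  then have "W = 0" using \<Lambda> by (simp add: divide_le_0_iff)
  then show ?thesis by (simp add: W_def)
qed

text \<open>The integral depends on the dimension alone, which is carried by the
  \<open>itself\<close> argument where no vector is at hand.\<close>

definition G_mass :: "'n::finite itself \<Rightarrow> real" where
  "G_mass _ = (\<integral>x. G x \<partial>(lborel :: (real^'n) measure))"

lemma G_mass_pos: "0 < G_mass TYPE('n::finite)"
  unfolding G_mass_def by (rule integral_G_pos)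

text \<open>For \<open>x\<close> in the shrunken ball all closed balls about \<open>x\<close> of
  radius at most \<open>e\<close> stay inside the domain, so each component of \<open>h'\<close>
  satisfies the hypothesis of \<open>conv_eq_AE\<close>. Radial symmetry of \<open>G\<close>
  reconciles x - y in \<open>kernel_conv\<close> with y - x in \<open>conv\<close>.\<close>

lemma representation:
  fixes h h' :: "real^'n \<Rightarrow> real^'m" and a :: "real^'m^'m"
  assumes h': "tamev h'" and ae: "AE x in lborel. h x = h' x"
    and weak: "weak_solution s a (ball x0 r) h"
    and ell: "\<And>\<xi>. (norm \<xi>)\<^sup>2 / \<Lambda> \<le> (a *v \<xi>) \<bullet> \<xi>" and \<Lambda>: "0 < \<Lambda>"
    and e: "0 < e"
  shows "AE x in lborel. x \<in> ball x0 (r - e) \<longrightarrow> (1 / G_mass TYPE('n)) *\<^sub>R kernel_conv e [] h' x = h x"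
proof -
  note [measurable] = tamev_measurable[OF h']
  have nth[measurable]: "(\<lambda>y. h' y $ j) \<in> borel_measurable borel" for j
    by (rule measurable_compose[OF tamev_measurable[OF h'] borel_measurable_continuous_onI]) (intro continuous_intros)
  obtain C where C: "0 \<le> C" "\<And>z :: real^'n. \<bar>P z\<bar> \<le> C * wt z" using P_bound[of "[]"] by (metis pds.simps(1))
  obtain D where D: "0 \<le> D" "\<And>z :: real^'n. \<bar>G z\<bar> \<le> D * wt z" using G_bound[of "[]"] by (metis pds.simps(1))
  have tame: "tame (\<lambda>y. h' y $ j)" for j
    unfolding tame_def
  proof
    show "integrable lborel (\<lambda>y. h' y $ j * wt y)"
    proof (rule Bochner_Integration.integrable_bound)
      show "integrable lborel (\<lambda>y. norm (h' y) * wt y)" using h' by (simp add: tamev_def)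
      show "AE y in lborel. norm (h' y $ j * wt y) \<le> norm (norm (h' y) * wt y)"
        by (intro AE_I2) (simp add: abs_mult mult_right_mono component_le_norm_cart)
    qed measurable
  qed measurable
  have H: "(\<integral>y. h' y $ j * P ((1 / t) *\<^sub>R (y - x)) \<partial>lborel) = 0"
    if x: "x \<in> ball x0 (r - e)" and t: "0 < t" "t \<le> e" for x t j
  proof -
    have sub: "cball x t \<subseteq> ball x0 r"
    proof
      fix y assume "y \<in> cball x t"
      then show "y \<in> ball x0 r" using x t dist_triangle[of x0 y x] by (auto simp: dist_commute)
    qed
    have int: "integrable lborel (\<lambda>y. P ((1 / t) *\<^sub>R (y - x)) *\<^sub>R h' y)"
      by (rule kernel_integrable[OF h' _ C(2) t(1)]) measurable
    have "(\<integral>y. (P ((1 / t) *\<^sub>R (y - x)) *\<^sub>R h' y) $ j \<partial>lborel) = 0"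
      using integral_bounded_linear[OF bounded_linear_vec_nth int, of j]
        weak_solution_P_zero[OF h' ae weak ell \<Lambda> t(1) sub] by simp
    then show ?thesis by (simp add: mult.commute)
  qed
  have comp: "kernel_conv e [] h' x $ j = conv e (\<lambda>y. h' y $ j) x" for x j
  proof -
    have G: "G ((1 / e) *\<^sub>R (x - y)) = G ((1 / e) *\<^sub>R (y - x))" for y
      by (rule G_radial) (simp add: norm_minus_commute)
    have "integrable lborel (\<lambda>y. (1 / e ^ CARD('n)) *\<^sub>R (G ((1 / e) *\<^sub>R (y - x)) *\<^sub>R h' y))"
      by (intro integrable_scaleR_right kernel_integrable[OF h' _ D(2) e]) measurable
    then have int: "integrable lborel (\<lambda>y. (G ((1 / e) *\<^sub>R (y - x)) / e ^ CARD('n)) *\<^sub>R h' y)" by simp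
    show ?thesis
      using integral_bounded_linear[OF bounded_linear_vec_nth int, of j]
      by (simp add: kernel_conv_def conv_def Gs_def G mult.commute)
  qed
  have "AE x in lborel. \<forall>j\<in>UNIV. x \<in> ball x0 (r - e) \<longrightarrow> conv e (\<lambda>y. h' y $ j) x = G_mass TYPE('n) * h' x $ j"
    unfolding G_mass_def by (intro AE_finite_allI conv_eq_AE tame e H) auto
  with ae show ?thesis
  proof eventually_elim
    case (elim x)
    then show ?case using G_mass_pos[where 'n='n] by (auto simp: vec_eq_iff comp)
  qed
qed

text \<open>On the half ball the scale r / 2 is admissible. Points y inside the ball are weighted by
  at most 1 and give the mean; outside, y is seen from x and from the centre at comparable
  distances, so the weight becomes the tail kernel. The factor 2^(n + length) stems from the scale r
  / 2, and the volume of the unit ball from replacing r^n by the measure of the ball.\<close>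

lemma kernel_conv_estimate:
  "\<exists>C\<ge>0. \<forall>x0 r (h :: real^'n \<Rightarrow> real^'m) x. 0 < r \<longrightarrow> tamev h \<longrightarrow> x \<in> ball x0 (r / 2) \<longrightarrow>
    norm (kernel_conv (r / 2) is h x) \<le> C / r ^ length is *
      ((\<integral>y. indicator (ball x0 r) y * norm (h y) \<partial>lborel) / measure lborel (ball x0 r) +
       r powr (2 * s) * (\<integral>y. indicator (- ball x0 r) y * (norm (h y) * kern (y - x0)) \<partial>lborel))"
proof -
  let ?n = "CARD('n)" and ?l = "length is" and ?a = "real CARD('n) + 2 * s"
  obtain C where C: "0 \<le> C" "\<And>z :: real^'n. \<bar>pds is G z\<bar> \<le> C * wt z" using G_bound[of "is"] by metis
  let ?\<omega> = "unit_ball_vol (real ?n)"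
  let ?K = "C * 2 ^ (?n + ?l) * (?\<omega> + 1)"
  have w: "0 \<le> ?\<omega>" by simp
  have "norm (kernel_conv (r / 2) is h x) \<le> ?K / r ^ ?l *
      ((\<integral>y. indicator (ball x0 r) y * norm (h y) \<partial>lborel) / measure lborel (ball x0 r) +
       r powr (2 * s) * (\<integral>y. indicator (- ball x0 r) y * (norm (h y) * kern (y - x0)) \<partial>lborel))"
    if r: "0 < r" and h: "tamev h" and x: "x \<in> ball x0 (r / 2)" for x0 r x and h :: "real^'n \<Rightarrow> real^'m"
  proof -
    note [measurable] = tamev_measurable[OF h]
    let ?B = "ball x0 r"
    have [measurable]: "?B \<in> sets borel" "- ?B \<in> sets borel" by auto
    have hi: "integrable lborel (\<lambda>y. c * (norm (h y) * wt y))" for c using h by (simp add: tamev_def)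
    have i1: "integrable lborel (\<lambda>y. indicator ?B y * norm (h y))"
    proof (rule Bochner_Integration.integrable_bound[OF hi])
      let ?c = "(1 + (norm x0 + r)) powr ?a"
      show "AE y in lborel. norm (indicator ?B y * norm (h y)) \<le> norm (?c * (norm (h y) * wt y))"
      proof (rule AE_I2)
        fix y
        show "norm (indicator ?B y * norm (h y)) \<le> norm (?c * (norm (h y) * wt y))"
        proof (cases "y \<in> ?B")
          case True
          then have "norm y \<le> norm x0 + r" using norm_triangle_ineq2[of y x0] by (simp add: dist_norm norm_minus_commute)
          from mult_right_mono[OF wt_near_le[OF this] norm_ge_zero[of "h y"]]
          show ?thesis using True by (simp add: abs_mult mult_ac)
        qed auto
      qed
    qed measurable
    have i2: "integrable lborel (\<lambda>y. indicator (- ?B) y * (norm (h y) * kern (y - x0)))"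
    proof (rule Bochner_Integration.integrable_bound[OF hi])
      let ?c = "((1 + norm x0) / r + 1) powr ?a"
      show "AE y in lborel. norm (indicator (- ?B) y * (norm (h y) * kern (y - x0))) \<le> norm (?c * (norm (h y) * wt y))"
      proof (rule AE_I2)
        fix y
        show "norm (indicator (- ?B) y * (norm (h y) * kern (y - x0))) \<le> norm (?c * (norm (h y) * wt y))"
        proof (cases "y \<in> ?B")
          case False
          then have ry: "r \<le> norm (y - x0)" by (simp add: dist_norm norm_minus_commute)
          have "1 + norm y \<le> (1 + norm x0) * 1 + norm (y - x0)" using norm_triangle_ineq[of x0 "y - x0"] by simp
          also have "\<dots> \<le> (1 + norm x0) * (norm (y - x0) / r) + norm (y - x0)"
            using ry r by (intro add_right_mono mult_left_mono) (auto simp: pos_le_divide_eq)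
          also have "\<dots> = ((1 + norm x0) / r + 1) * norm (y - x0)" by (simp add: algebra_simps)
          finally have "kern (y - x0) \<le> ?c * wt y" using r by (intro kern_le_wt) auto
          from mult_right_mono[OF this norm_ge_zero[of "h y"]]
          show ?thesis using False by (simp add: abs_mult mult_ac)
        qed auto
      qed
    qed measurable
    let ?I = "\<integral>y. indicator ?B y * norm (h y) \<partial>lborel"
    let ?T = "\<integral>y. indicator (- ?B) y * (norm (h y) * kern (y - x0)) \<partial>lborel"
    have nn: "0 \<le> ?I" "0 \<le> ?T" by (auto intro!: Bochner_Integration.integral_nonneg)
    let ?D = "C / (r / 2) ^ (?n + ?l)"
    have D: "0 \<le> ?D" using C(1) r by simp
    let ?b = "\<lambda>y. ?D * (indicator ?B y * norm (h y) + r powr ?a * (indicator (- ?B) y * (norm (h y) * kern (y - x0))))"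
    have wt: "wt ((1 / (r / 2)) *\<^sub>R (x - y)) \<le> indicator ?B y + r powr ?a * (indicator (- ?B) y * kern (y - x0))" for y
    proof (cases "y \<in> ?B")
      case True then show ?thesis by (simp add: wt_le_1)
    next
      case False
      \<comment> \<open>\<open>x\<close> is within r / 2 of the centre, which is at most half of
        \<open>norm (y - x0)\<close>.\<close>
      have xy: "norm (y - x0) \<le> 2 * norm (x - y)"
        using False x norm_triangle_ineq2[of "y - x0" "x - x0"]
        by (simp add: dist_norm norm_minus_commute)
      have yx0: "0 < norm (y - x0)" using False r by (auto simp: dist_norm norm_minus_commute)
      have "wt ((1 / (r / 2)) *\<^sub>R (x - y)) \<le> (norm ((1 / (r / 2)) *\<^sub>R (x - y))) powr - ?a"
        using wt_le_kern[of "(1 / (r / 2)) *\<^sub>R (x - y)"] xy yx0 r by (force simp: kern_def)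
      also have "norm ((1 / (r / 2)) *\<^sub>R (x - y)) = 2 * norm (x - y) / r"
        unfolding norm_scaleR using r by simp
      also have "(2 * norm (x - y) / r) powr - ?a \<le> (norm (y - x0) / r) powr - ?a"
        using xy yx0 r s_pos by (intro powr_mono2' divide_right_mono) auto
      also have "\<dots> = r powr ?a * kern (y - x0)" using powr_scale_minus[OF r norm_ge_zero] by (simp only: kern_def)
      finally show ?thesis using False by simp
    qed
    have kb: "norm ((pds is G ((1 / (r / 2)) *\<^sub>R (x - y)) / (r / 2) ^ (?n + ?l)) *\<^sub>R h y) \<le> ?b y" for y
    proof -
      have "\<bar>pds is G ((1 / (r / 2)) *\<^sub>R (x - y))\<bar> \<le> C * (indicator ?B y + r powr ?a * (indicator (- ?B) y * kern (y - x0)))"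
        using C(1) by (intro order_trans[OF C(2)] mult_left_mono wt)
      then have "\<bar>pds is G ((1 / (r / 2)) *\<^sub>R (x - y))\<bar> / (r / 2) ^ (?n + ?l) * norm (h y) \<le>
        C * (indicator ?B y + r powr ?a * (indicator (- ?B) y * kern (y - x0))) / (r / 2) ^ (?n + ?l) * norm (h y)"
        using r by (intro mult_right_mono divide_right_mono) auto
      also have "\<dots> = ?b y" by (simp add: algebra_simps add_divide_distrib)
      finally show ?thesis using r by (simp add: abs_mult abs_divide)
    qed
    have bi: "integrable lborel ?b"
      by (intro integrable_mult_right Bochner_Integration.integrable_add i1 i2)
    have "norm (kernel_conv (r / 2) is h x) \<le> (\<integral>y. ?b y \<partial>lborel)"
      unfolding kernel_conv_def
    proof (rule Bochner_Integration.integral_norm_bound_integral[OF _ bi kb])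
      show "integrable lborel (\<lambda>y. (pds is G ((1 / (r / 2)) *\<^sub>R (x - y)) / (r / 2) ^ (?n + ?l)) *\<^sub>R h y)"
        by (rule Bochner_Integration.integrable_bound[OF bi], measurable, rule AE_I2,
            rule order_trans[OF kb], subst real_norm_def, rule abs_ge_self)
    qed
    also have "\<dots> = ?D * (?I + r powr ?a * ?T)"
      using i1 i2 by simp
    also have "\<dots> = C * 2 ^ (?n + ?l) / r ^ ?l * (?\<omega> * (?I / measure lborel ?B) + r powr (2 * s) * ?T)"
    proof -
      have m: "measure lborel ?B = ?\<omega> * r ^ ?n" using content_ball[of r x0] r by simp
      have p: "r powr ?a = r ^ ?n * r powr (2 * s)" using r by (simp add: powr_add powr_realpow)
      have w0: "?\<omega> \<noteq> 0" using unit_ball_vol_pos[of "real ?n"] by (simp del: unit_ball_vol_pos)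
      have 1: "?\<omega> * (?I / measure lborel ?B) = ?I / r ^ ?n" unfolding m using w0 by simp
      have 2: "?D = C * 2 ^ (?n + ?l) / (r ^ ?n * r ^ ?l)" by (simp add: power_divide power_add)
      show ?thesis unfolding 1 2 p using r by (simp add: field_simps)
    qed
    also have "\<dots> \<le> C * 2 ^ (?n + ?l) / r ^ ?l * ((?\<omega> + 1) * (?I / measure lborel ?B + r powr (2 * s) * ?T))"
    proof (rule mult_left_mono)
      have gen: "0 \<le> p \<Longrightarrow> 0 \<le> q \<Longrightarrow> 0 \<le> w * q \<Longrightarrow> w * p + q \<le> (w + 1) * (p + q)" for p q w :: real
        by (simp add: algebra_simps)
      have "0 \<le> ?I / measure lborel ?B" using nn by simp
      moreover have "0 \<le> r powr (2 * s) * ?T" using nn by simp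
      moreover have "0 \<le> ?\<omega> * (r powr (2 * s) * ?T)" using nn w by (intro mult_nonneg_nonneg) auto
      ultimately show "?\<omega> * (?I / measure lborel ?B) + r powr (2 * s) * ?T \<le> (?\<omega> + 1) * (?I / measure lborel ?B + r powr (2 * s) * ?T)"
        by (rule gen)
      show "0 \<le> C * 2 ^ (?n + ?l) / r ^ ?l" using C(1) r by simp
    qed
    finally show ?thesis by (simp add: mult_ac)
  qed
  moreover have "0 \<le> ?K" using C(1) w by simp
  ultimately show ?thesis by blast
qed

end

section \<open>The regularity estimate\<close>

text \<open>The constant is chosen before the matrix, the ball and the solution. Since
  \<open>h\<close> is determined only up to null sets, smoothness is asserted of a representative
  \<open>g\<close>, and the same \<open>g\<close> serves every \<open>h0\<close>.\<close>

theorem proposition4p4: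
  fixes s \<Lambda> :: real and k :: nat
  assumes "CARD('n::finite) \<ge> 2" and "0 < s" and "s < 1" and "\<Lambda> \<ge> 1"
  shows "\<exists>c>0. \<forall>(a0 :: real ^ 'm ^ 'm) (x0 :: real ^ 'n) r (h :: real ^ 'n \<Rightarrow> real ^ 'm).
    (\<forall>\<xi>. (norm \<xi>)\<^sup>2 / \<Lambda> \<le> (a0 *v \<xi>) \<bullet> \<xi>) \<longrightarrow>
    norm a0 \<le> \<Lambda> \<longrightarrow>
    r > 0 \<longrightarrow>
    h \<in> frac_sobolev s (ball x0 r) \<inter> tail_space s \<longrightarrow>
    weak_solution s a0 (ball x0 r) h \<longrightarrow>
    (\<exists>g. (AE x\<in>ball x0 r in lebesgue. h x = g x) \<and>
         smooth_on (ball x0 r) g \<and>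
         (\<forall>h0.
            ereal (measure lebesgue (ball x0 r) powr (real k / real CARD('n))) *
              Linf_norm (ball x0 (r / 2)) (norm_D k (\<lambda>x. g x - h0))
            \<le> ereal (c *
                (sqrt (1 / measure lebesgue (ball x0 r) *
                       (LINT x:ball x0 r|lebesgue. (norm (h x - h0))\<^sup>2))
                 + tail s (\<lambda>x. h x - h0) x0 r))))"
proof -
  interpret frac_order s using assms by unfold_locales
  let ?n = "CARD('n)"
  let ?L = "{is :: 'n list. length is = k}"
  let ?\<omega> = "unit_ball_vol (real ?n)"
  define c0 where "c0 = G_mass TYPE('n)"
  have c0: "0 < c0" unfolding c0_def by (rule G_mass_pos)
  define avg1 where "avg1 = (\<lambda>(w :: real^'n \<Rightarrow> real^'m) x0 r. (\<integral>y. indicator (ball x0 r) y * norm (w y) \<partial>lborel) / measure lborel (ball x0 r))"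
  define far where "far = (\<lambda>(w :: real^'n \<Rightarrow> real^'m) x0 r. r powr (2 * s) * (\<integral>y. indicator (- ball x0 r) y * (norm (w y) * kern (y - x0)) \<partial>lborel))"
  have "\<exists>C. 0 \<le> C \<and> (\<forall>x0 r (w :: real^'n \<Rightarrow> real^'m) x. 0 < r \<longrightarrow> tamev w \<longrightarrow> x \<in> ball x0 (r / 2) \<longrightarrow>
    norm (kernel_conv (r / 2) is w x) \<le> C / r ^ length is * (avg1 w x0 r + far w x0 r))" for "is" :: "'n list"
    using kernel_conv_estimate[where 'm='m, of "is"] unfolding avg1_def far_def by blast
  then obtain C where C: "\<And>is. 0 \<le> C is" "\<And>is x0 r (w :: real^'n \<Rightarrow> real^'m) x. 0 < r \<Longrightarrow> tamev w \<Longrightarrow> x \<in> ball x0 (r / 2) \<Longrightarrow>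
    norm (kernel_conv (r / 2) is w x) \<le> C is / r ^ length is * (avg1 w x0 r + far w x0 r)" by metis
  \<comment> \<open>The Euclidean norm of the tensor is at most the sum of the norms of its entries,
    hence the sum of the constants over all index lists of length \<open>k\<close>.\<close>
  define S where "S = (\<Sum>is\<in>?L. C is)"
  have S: "0 \<le> S" unfolding S_def by (intro sum_nonneg C)
  \<comment> \<open>The measure of the ball to the power k / n equals
    \<open>?\<omega> powr (real k / real ?n)\<close> times r^k, which cancels the r^(-k) of the
    derivative estimate; \<open>c0\<close> normalises the kernel. The added 1 keeps \<open>c\<close>
    positive even if \<open>S\<close> vanishes.\<close>
  define c where "c = ?\<omega> powr (real k / real ?n) * (S / c0) + 1"
  have c: "0 < c" unfolding c_def using S c0 by (intro add_nonneg_pos mult_nonneg_nonneg) auto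
  show ?thesis
  proof (intro exI[of _ c] conjI c allI impI)
    fix a0 :: "real^'m^'m" and x0 :: "real^'n" and r :: real and h :: "real^'n \<Rightarrow> real^'m"
    assume ell: "\<forall>\<xi>. (norm \<xi>)\<^sup>2 / \<Lambda> \<le> (a0 *v \<xi>) \<bullet> \<xi>" and r: "0 < r"
      and hh: "h \<in> frac_sobolev s (ball x0 r) \<inter> tail_space s" and weak: "weak_solution s a0 (ball x0 r) h"
    have \<Lambda>: "0 < \<Lambda>" using assms(4) by simp
    let ?B = "ball x0 r"
    have [measurable]: "?B \<in> sets borel" "- ?B \<in> sets borel" by auto
    have hm: "h \<in> borel_measurable lebesgue" using hh by (intro tail_space_measurable) auto
    obtain h' where h': "tamev h'" "AE x in lborel. h x = h' x"
      using hh by (auto intro: tail_space_tamev)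
    note [measurable] = tamev_measurable[OF h'(1)]
    have rep: "AE x in lborel. x \<in> ball x0 (r - e) \<longrightarrow> (1 / c0) *\<^sub>R kernel_conv e [] h' x = h x" if "0 < e" for e
      unfolding c0_def using ell by (intro representation[OF h' weak _ \<Lambda> that]) auto
    \<comment> \<open>A fixed scale represents \<open>h\<close> only on a smaller concentric ball.
      Half the distance to the boundary is admissible at every point, and \<open>g_eq\<close> shows
      that the choice of scale does not affect the value.\<close>
    define g where "g x = (1 / c0) *\<^sub>R kernel_conv ((r - dist x0 x) / 2) [] h' x" for x
    have g_eq: "g x = (1 / c0) *\<^sub>R kernel_conv e [] h' x" if e: "0 < e" and x: "x \<in> ball x0 (r - e)" for e x
    proof -
      define e' where "e' = (r - dist x0 x) / 2"
      have e': "0 < e'" using x e by (simp add: e'_def)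
      show ?thesis
        unfolding g_def e'_def[symmetric]
      \<comment> \<open>With both scales frozen, the two convolutions are continuous and agree with
        \<open>h\<close> almost everywhere on an open set containing \<open>x\<close>, hence they
        agree at \<open>x\<close>.\<close>
      proof (rule AE_eq_on_open_imp_eq[where S="ball x0 (r - e) \<inter> ball x0 (r - e')"])
        show "AE x in lborel. x \<in> ball x0 (r - e) \<inter> ball x0 (r - e') \<longrightarrow> (1 / c0) *\<^sub>R kernel_conv e' [] h' x = (1 / c0) *\<^sub>R kernel_conv e [] h' x"
          using rep[OF e] rep[OF e'] by eventually_elim auto
        show "x \<in> ball x0 (r - e) \<inter> ball x0 (r - e')" using x e by (simp add: e'_def field_simps)
      qed (intro continuous_intros kernel_conv_continuous h' e e' open_Int open_ball)+
    qed
    show "\<exists>g. (AE x\<in>?B in lebesgue. h x = g x) \<and> smooth_on ?B g \<and>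
         (\<forall>h0. ereal (measure lebesgue ?B powr (real k / real ?n)) *
              Linf_norm (ball x0 (r / 2)) (norm_D k (\<lambda>x. g x - h0))
            \<le> ereal (c * (sqrt (1 / measure lebesgue ?B * (LINT x:?B|lebesgue. (norm (h x - h0))\<^sup>2))
                 + tail s (\<lambda>x. h x - h0) x0 r)))"
    proof (intro exI[of _ g] conjI allI)
      \<comment> \<open>Countably many scales tending to 0 exhaust the ball while leaving a single
        null set.\<close>
      have "AE x in lborel. \<forall>i. x \<in> ball x0 (r - r / real (Suc i)) \<longrightarrow> (1 / c0) *\<^sub>R kernel_conv (r / real (Suc i)) [] h' x = h x"
        unfolding AE_all_countable by (intro allI rep) (use r in simp)
      then have "AE x in lborel. x \<in> ?B \<longrightarrow> h x = g x"
      proof eventually_elim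
        case (elim x)
        show ?case
        proof
          assume x: "x \<in> ?B"
          have "(\<lambda>i. r / real (Suc i)) \<longlonglongrightarrow> 0" by (rule LIMSEQ_Suc[OF lim_const_over_n])
          then have "\<forall>\<^sub>F i in sequentially. r / real (Suc i) < r - dist x0 x"
            using x by (intro order_tendstoD(2)[where a="r - dist x0 x"]) auto
          then obtain i where "r / real (Suc i) < r - dist x0 x"
            using eventually_happens'[OF sequentially_bot] by blast
          then have i: "x \<in> ball x0 (r - r / real (Suc i))" by simp
          then show "h x = g x" using elim g_eq[OF _ i] r by (metis divide_pos_pos of_nat_0_less_iff zero_less_Suc)
        qed
      qed
      then show "AE x\<in>?B in lebesgue. h x = g x" by (rule AE_completion)
      show "smooth_on ?B g"
        unfolding smooth_on_def differentiable_on_def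
      proof (intro allI ballI)
        fix "is" x assume x: "x \<in> ?B"
        define e where "e = (r - dist x0 x) / 2"
        have e: "0 < e" using x by (simp add: e_def)
        have "x \<in> ball x0 (r - e)" using x by (simp add: e_def field_simps)
        then have "partials is g differentiable (at x)"
          by (intro partials_eq_kernel_conv(2)[OF h'(1) e open_ball g_eq[OF e]])
        then show "partials is g differentiable (at x within ?B)" by (rule differentiable_at_withinI)
      qed
      fix h0 :: "real^'m"
      let ?w = "\<lambda>x. h x - h0" and ?w' = "\<lambda>x. h' x - h0"
      let ?a = "real ?n + 2 * s"
      define A where "A = sqrt (1 / measure lebesgue ?B * (LINT x:?B|lebesgue. (norm (h x - h0))\<^sup>2))"
      have w': "tamev ?w'"
        unfolding tamev_def
      proof
        show "integrable lborel (\<lambda>y. norm (h' y - h0) * wt y)"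
        proof (rule Bochner_Integration.integrable_bound)
          show "integrable lborel (\<lambda>y. norm (h' y) * wt y + norm h0 * wt y)"
            using h'(1) integrable_wt by (auto simp: tamev_def)
          show "AE y in lborel. norm (norm (h' y - h0) * wt y) \<le> norm (norm (h' y) * wt y + norm h0 * wt y)"
            by (intro AE_I2) (simp add: abs_mult norm_triangle_ineq4 mult_right_mono flip: distrib_right)
        qed measurable
      qed measurable
      have ww': "AE x in lborel. ?w x = ?w' x" using h'(2) by eventually_elim simp
      have wm: "?w \<in> borel_measurable lebesgue" using hm by measurable
      have weakw: "weak_solution s a0 ?B ?w" using weak by (simp add: weak_solution_def)
      have r2: "0 < r / 2" "r - r / 2 = r / 2" using r by simp_all
      \<comment> \<open>The weak formulation sees only differences, so \<open>h - h0\<close> is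
        again a solution and has its own representation. Comparing it with that of \<open>h\<close>
        brings \<open>h0\<close> under the integral without evaluating the convolution of a
        constant.\<close>
      have gw: "g x - h0 = (1 / c0) *\<^sub>R kernel_conv (r / 2) [] ?w' x" if x: "x \<in> ball x0 (r / 2)" for x
      proof -
        have "(1 / c0) *\<^sub>R kernel_conv (r / 2) [] h' x - h0 = (1 / c0) *\<^sub>R kernel_conv (r / 2) [] ?w' x"
        proof (rule AE_eq_on_open_imp_eq[where S="ball x0 (r / 2)"])
          have "AE x in lborel. x \<in> ball x0 (r - r / 2) \<longrightarrow> (1 / c0) *\<^sub>R kernel_conv (r / 2) [] ?w' x = ?w x"
            unfolding c0_def using ell by (intro representation[OF w' ww' weakw _ \<Lambda> r2(1)]) auto
          then show "AE x in lborel. x \<in> ball x0 (r / 2) \<longrightarrow> (1 / c0) *\<^sub>R kernel_conv (r / 2) [] h' x - h0 = (1 / c0) *\<^sub>R kernel_conv (r / 2) [] ?w' x"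
            using rep[OF r2(1)] unfolding r2(2) by eventually_elim auto
        qed (use x in \<open>auto intro!: continuous_intros kernel_conv_continuous h' w' r2\<close>)
        then show ?thesis using g_eq[OF r2(1), of x] x by (simp add: r2(2))
      qed
      have part: "partials is (\<lambda>x. g x - h0) x = (1 / c0) *\<^sub>R kernel_conv (r / 2) is ?w' x" if "x \<in> ball x0 (r / 2)" for "is" x
        using that by (intro partials_eq_kernel_conv(1)[OF w' r2(1) open_ball gw])
      have mB: "measure lebesgue ?B = measure lborel ?B" by simp
      have vol: "measure lborel ?B = ?\<omega> * r ^ ?n" using content_ball[of r x0] r by simp
      have vpos: "0 < measure lborel ?B" using r by simp
      have finB: "emeasure lborel ?B < \<infinity>" by (rule emeasure_bounded_finite) simp
      have indB: "integrable lborel (indicator ?B :: real^'n \<Rightarrow> real)" using finB by (intro integrable_real_indicator) auto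
      have "integrable lebesgue (\<lambda>x. indicator ?B x * (norm (h x))\<^sup>2)"
        using hh by (auto simp: frac_sobolev_def set_integrable_def)
      then have sq: "integrable lborel (\<lambda>x. indicator ?B x * (norm (h' x))\<^sup>2)"
      proof (subst (asm) integral_lebesgue_cong_borel(2))
        show "(\<lambda>x. indicator ?B x * (norm (h x))\<^sup>2) \<in> borel_measurable lebesgue"
          using hm by (intro borel_measurable_times borel_measurable_indicator borel_measurable_power borel_measurable_norm) auto
        show "AE x in lborel. indicator ?B x * (norm (h x))\<^sup>2 = indicator ?B x * (norm (h' x))\<^sup>2"
          using h'(2) by eventually_elim simp
      qed measurable
      have i2: "integrable lborel (\<lambda>x. indicator ?B x * (norm (?w' x))\<^sup>2)"
      proof (rule Bochner_Integration.integrable_bound)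
        show "integrable lborel (\<lambda>x. 2 * (indicator ?B x * (norm (h' x))\<^sup>2) + 2 * (norm h0)\<^sup>2 * indicator ?B x)"
          by (intro Bochner_Integration.integrable_add integrable_mult_right sq indB)
        have "(norm (h' x - h0))\<^sup>2 \<le> 2 * (norm (h' x))\<^sup>2 + 2 * (norm h0)\<^sup>2" for x
        proof -
          have "(norm (h' x - h0))\<^sup>2 \<le> (norm (h' x) + norm h0)\<^sup>2" by (intro power_mono norm_triangle_ineq4) auto
          also have "\<dots> \<le> 2 * (norm (h' x))\<^sup>2 + 2 * (norm h0)\<^sup>2"
            using sum_squares_bound[of "norm (h' x)" "norm h0"] by (simp add: power2_sum)
          finally show ?thesis .
        qed
        then show "AE x in lborel. norm (indicator ?B x * (norm (?w' x))\<^sup>2) \<le>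
            norm (2 * (indicator ?B x * (norm (h' x))\<^sup>2) + 2 * (norm h0)\<^sup>2 * indicator ?B x)"
          by (intro AE_I2) (auto simp: indicator_def)
      qed measurable
      have i1: "integrable lborel (\<lambda>x. indicator ?B x * norm (?w' x))"
      proof (rule Bochner_Integration.integrable_bound[OF Bochner_Integration.integrable_add[OF indB i2]])
        have "t \<le> 1 + t\<^sup>2" if "0 \<le> t" for t :: real
          using sum_squares_bound[of 1 t] that by simp
        then show "AE x in lborel. norm (indicator ?B x * norm (?w' x)) \<le> norm (indicator ?B x + indicator ?B x * (norm (?w' x))\<^sup>2)"
          by (intro AE_I2) (auto simp: indicator_def)
      qed measurable
      have A_eq: "A = sqrt ((\<integral>x. indicator ?B x * (norm (?w' x))\<^sup>2 \<partial>lborel) / measure lborel ?B)"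
      proof -
        have "(LINT x:?B|lebesgue. (norm (?w x))\<^sup>2) = (\<integral>x. indicator ?B x * (norm (?w' x))\<^sup>2 \<partial>lborel)"
          unfolding set_lebesgue_integral_def real_scaleR_def
        proof (rule integral_lebesgue_cong_borel(1))
          show "(\<lambda>x. indicator ?B x * (norm (?w x))\<^sup>2) \<in> borel_measurable lebesgue"
            using wm by (intro borel_measurable_times borel_measurable_indicator borel_measurable_power borel_measurable_norm) auto
          show "AE x in lborel. indicator ?B x * (norm (?w x))\<^sup>2 = indicator ?B x * (norm (?w' x))\<^sup>2"
            using ww' by eventually_elim simp
        qed measurable
        then show ?thesis unfolding A_def mB by simp
      qed
      have avg: "avg1 ?w' x0 r \<le> A"
        \<comment> \<open>Here the mean of the norm is replaced by the quadratic mean of the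
          theorem.\<close>
        unfolding avg1_def A_eq using mean_le_sqrt_mean_square[OF _ finB vpos i1 i2] by simp
      have far: "far ?w' x0 r = tail s ?w x0 r"
      proof -
        have "(LINT y:(- ?B)|lebesgue. norm (?w y) / norm (y - x0) powr ?a) =
          (\<integral>y. indicator (- ?B) y * (norm (?w' y) * kern (y - x0)) \<partial>lborel)"
          unfolding set_lebesgue_integral_def real_scaleR_def
        proof (rule integral_lebesgue_cong_borel(1))
          have "(\<lambda>y. norm (y - x0) powr ?a) \<in> borel_measurable lebesgue" by (rule measurable_completion) measurable
          then show "(\<lambda>y. indicator (- ?B) y * (norm (?w y) / norm (y - x0) powr ?a)) \<in> borel_measurable lebesgue"
            using wm by (intro borel_measurable_times borel_measurable_indicator borel_measurable_divide borel_measurable_norm) auto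
          show "AE y in lborel. indicator (- ?B) y * (norm (?w y) / norm (y - x0) powr ?a) = indicator (- ?B) y * (norm (?w' y) * kern (y - x0))"
            using ww' by eventually_elim (simp add: kern_eq_divide)
        qed measurable
        then show ?thesis by (simp add: far_def tail_def)
      qed
      let ?E = "A + tail s ?w x0 r"
      have E0: "0 \<le> ?E"
      proof -
        have "0 \<le> avg1 ?w' x0 r" "0 \<le> far ?w' x0 r" unfolding avg1_def far_def
          by (auto intro!: divide_nonneg_nonneg mult_nonneg_nonneg Bochner_Integration.integral_nonneg)
        with avg far show ?thesis by linarith
      qed
      have bound: "norm_D k (\<lambda>x. g x - h0) x \<le> S / (c0 * r ^ k) * ?E" if x: "x \<in> ball x0 (r / 2)" for x
      proof -
        have "norm_D k (\<lambda>x. g x - h0) x = L2_set (\<lambda>is. norm (partials is (\<lambda>x. g x - h0) x)) ?L"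
          by (simp add: norm_D_def L2_set_def)
        also have "\<dots> \<le> (\<Sum>is\<in>?L. norm (partials is (\<lambda>x. g x - h0) x))" by (rule L2_set_le_sum) simp
        also have "\<dots> \<le> (\<Sum>is\<in>?L. C is * (?E / (c0 * r ^ k)))"
        proof (rule sum_mono)
          fix "is" :: "'n list" assume "is \<in> ?L"
          then have l: "length is = k" by simp
          have "norm (partials is (\<lambda>x. g x - h0) x) = norm (kernel_conv (r / 2) is ?w' x) / c0"
            using c0 by (simp add: part[OF x])
          also have "\<dots> \<le> (C is / r ^ k * (avg1 ?w' x0 r + far ?w' x0 r)) / c0"
            using C(2)[OF r w' x, of "is"] c0 l by (intro divide_right_mono) auto
          also have "\<dots> \<le> (C is / r ^ k * ?E) / c0"
            using avg far c0 r C(1)[of "is"] by (intro divide_right_mono mult_left_mono) auto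
          finally show "norm (partials is (\<lambda>x. g x - h0) x) \<le> C is * (?E / (c0 * r ^ k))"
            by (simp add: mult_ac)
        qed
        also have "\<dots> = S / (c0 * r ^ k) * ?E" unfolding S_def sum_distrib_right[symmetric] by simp
        finally show ?thesis .
      qed
      have Linf: "Linf_norm (ball x0 (r / 2)) (norm_D k (\<lambda>x. g x - h0)) \<le> ereal (S / (c0 * r ^ k) * ?E)"
        unfolding Linf_norm_def
      proof (rule esssup_I)
        \<comment> \<open>\<open>esssup\<close> is controlled only for a measurable function. On the
          half ball the tensor norm coincides with this expression, which is continuous on the whole
          space.\<close>
        let ?N = "\<lambda>x. sqrt (\<Sum>is\<in>?L. (norm ((1 / c0) *\<^sub>R kernel_conv (r / 2) is ?w' x))\<^sup>2)"
        have nonneg: "0 \<le> norm_D k (\<lambda>x. g x - h0) x" for x by (simp add: norm_D_def sum_nonneg)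
        have "continuous_on UNIV ?N"
          by (intro continuous_intros kernel_conv_continuous w' r2)
        then have "?N \<in> borel_measurable borel" by (rule borel_measurable_continuous_onI)
        then have "(\<lambda>x. ereal \<bar>?N x\<bar>) \<in> borel_measurable lebesgue"
          by (intro measurable_completion borel_measurable_ereal borel_measurable_abs) simp
        then have "(\<lambda>x. ereal \<bar>?N x\<bar>) \<in> borel_measurable (lebesgue_on (ball x0 (r / 2)))"
          by (rule measurable_restrict_space1)
        then show "(\<lambda>x. ereal \<bar>norm_D k (\<lambda>x. g x - h0) x\<bar>) \<in> borel_measurable (lebesgue_on (ball x0 (r / 2)))"
          by (rule measurable_cong[THEN iffD1, rotated]) (simp add: norm_D_def part)
        show "AE x in lebesgue_on (ball x0 (r / 2)). ereal \<bar>norm_D k (\<lambda>x. g x - h0) x\<bar> \<le> ereal (S / (c0 * r ^ k) * ?E)"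
          using bound nonneg by (intro AE_I2) simp
      qed
      have "measure lebesgue ?B powr (real k / real ?n) = ?\<omega> powr (real k / real ?n) * r ^ k"
      proof -
        have "(r ^ ?n) powr (real k / real ?n) = r ^ k"
          using r by (simp add: powr_realpow[symmetric] powr_powr)
        then show ?thesis unfolding mB vol using r by (simp add: powr_mult)
      qed
      then have "ereal (measure lebesgue ?B powr (real k / real ?n)) * Linf_norm (ball x0 (r / 2)) (norm_D k (\<lambda>x. g x - h0))
        \<le> ereal (?\<omega> powr (real k / real ?n) * r ^ k) * ereal (S / (c0 * r ^ k) * ?E)"
        using r by (simp only:) (intro ereal_mult_left_mono Linf, simp)
      also have "\<dots> = ereal (?\<omega> powr (real k / real ?n) * (S / c0) * ?E)" using r by simp
      also have "\<dots> \<le> ereal (c * ?E)"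
        using E0 unfolding ereal_less_eq c_def by (intro mult_right_mono) auto
      finally show "ereal (measure lebesgue ?B powr (real k / real ?n)) *
              Linf_norm (ball x0 (r / 2)) (norm_D k (\<lambda>x. g x - h0))
            \<le> ereal (c * (sqrt (1 / measure lebesgue ?B * (LINT x:?B|lebesgue. (norm (h x - h0))\<^sup>2))
                 + tail s (\<lambda>x. h x - h0) x0 r))" unfolding A_def .
    qed
  qed
qed

end
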